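(* For all real $\varepsilon>0$ and $r>1$ there exist $\delta>0$ and a constant $C$ (both depending only on $\varepsilon$ and $r$) such that the following holds. Let $p$ be a prime with $p>C$, and let $A\subset\mathbb F_p$ and $S\subset SL_2(p)$ satisfy: (i) $C<|A|<p^{1-\varepsilon}$; (ii) $\log|A|<r\log|S|$; (iii) $|S\cap gH|<|S|^{1-\varepsilon}$ for every proper subgroup $H\subset SL_2(p)$ and every $g\in SL_2(p)$. Then $$ \big|\{(x,y,g)\in A\times A\times S:\ (x,y)\in\Gamma_g\}\big|<|A|^{1-\delta}\,|S|, $$ where, for $g=\begin{pmatrix} a&b\\ c&d\end{pmatrix}\in GL_2(p)$, $\Gamma_g\subset\mathbb F_p^2$ denotes the curve $\{(x,y)\in\mathbb F_p^2:\ cxy-ax+dy-b=0\}$.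
   Context: $\mathbb F_p$ is the field with $p$ elements; $SL_2(p)=SL_2(\mathbb F_p)$ and $GL_2(p)=GL_2(\mathbb F_p)$. $|X|$ denotes the cardinality of a finite set $X$. A proper subgroup of $SL_2(p)$ is any subgroup different from $SL_2(p)$ (the trivial subgroup is allowed). *)

theory Defs
  imports "HOL-Analysis.Determinants" "HOL-Number_Theory.Residues"
begin

text \<open>
  The prime \<open>p\<close> is quantified inside the theorem, so the field with \<open>p\<close> elements cannot be a type.
  It is the ring \<^term>\<open>residue_ring (int p)\<close>, whose carrier is \<open>{0..p - 1}\<close>; equations over it
  are written as congruences modulo \<open>p\<close> between these integer representatives.
\<close>

abbreviation Fp :: "nat \<Rightarrow> int ring" where
  "Fp p \<equiv> residue_ring (int p)"

definition mat_mod :: "nat \<Rightarrow> int^2^2 \<Rightarrow> int^2^2" where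
  "mat_mod p M = (\<chi> i j. M $ i $ j mod int p)"

definition SL2 :: "nat \<Rightarrow> (int^2^2) monoid" where
  "SL2 p =
     \<lparr>carrier = {M. (\<forall>i j. M $ i $ j \<in> carrier (Fp p)) \<and> [det M = 1] (mod int p)},
      monoid.mult = (\<lambda>M N. mat_mod p (M ** N)),
      one = mat 1\<rparr>"

text \<open>With \<open>g = (a b; c d)\<close>, the equation is \<open>cxy - ax + dy - b = 0\<close>.\<close>

definition hyperbola :: "nat \<Rightarrow> int^2^2 \<Rightarrow> (int \<times> int) set" where
  "hyperbola p g =
     {(x, y). x \<in> carrier (Fp p) \<and> y \<in> carrier (Fp p) \<and>
        [g $ 2 $ 1 * x * y - g $ 1 $ 1 * x + g $ 2 $ 2 * y - g $ 1 $ 2 = 0] (mod int p)}"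

lemma mat_mod_nth [simp]: "mat_mod p M $ i $ j = M $ i $ j mod int p"
  by (simp add: mat_mod_def)

lemma mat_mod_mult_left: "mat_mod p (mat_mod p M ** N) = mat_mod p (M ** N)"
  by (simp add: vec_eq_iff matrix_matrix_mult_def sum_2)
    (intro allI, unfold cong_def[symmetric], intro cong_add cong_mult; simp add: cong_def)

lemma mat_mod_mult_right: "mat_mod p (M ** mat_mod p N) = mat_mod p (M ** N)"
  by (simp add: vec_eq_iff matrix_matrix_mult_def sum_2)
    (intro allI, unfold cong_def[symmetric], intro cong_add cong_mult; simp add: cong_def)

lemma det_mat_mod: "[det (mat_mod p M) = det M] (mod int p)"
  unfolding det_2 by (intro cong_diff cong_mult) (simp_all add: cong_def)

lemma carrier_Fp: "p > 0 \<Longrightarrow> carrier (Fp p) = {0..<int p}"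
  by (auto simp: residue_ring_def)

lemma mat_mod_SL2: "[det M = 1] (mod int p) \<Longrightarrow> p > 0 \<Longrightarrow> mat_mod p M \<in> carrier (SL2 p)"
  using cong_trans[OF det_mat_mod] by (auto simp: SL2_def carrier_Fp)

lemma mat_mod_id: "p > 0 \<Longrightarrow> M \<in> carrier (SL2 p) \<Longrightarrow> mat_mod p M = M"
  by (simp add: SL2_def carrier_Fp vec_eq_iff)

lemma group_SL2:
  assumes "p > 1"
  shows "group (SL2 p)"
proof (rule groupI)
  fix M N assume MN: "M \<in> carrier (SL2 p)" "N \<in> carrier (SL2 p)"
  then have "[det (M ** N) = 1 * 1] (mod int p)"
    unfolding det_mul by (intro cong_mult) (auto simp: SL2_def)
  then show "M \<otimes>\<^bsub>SL2 p\<^esub> N \<in> carrier (SL2 p)"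
    using mat_mod_SL2[of "M ** N" p] assms by (simp add: SL2_def)
next
  show "\<one>\<^bsub>SL2 p\<^esub> \<in> carrier (SL2 p)"
    using assms by (simp add: SL2_def carrier_Fp) (simp add: mat_def)
next
  fix M N K
  show "M \<otimes>\<^bsub>SL2 p\<^esub> N \<otimes>\<^bsub>SL2 p\<^esub> K = M \<otimes>\<^bsub>SL2 p\<^esub> (N \<otimes>\<^bsub>SL2 p\<^esub> K)"
    by (simp add: SL2_def mat_mod_mult_left mat_mod_mult_right matrix_mul_assoc)
next
  fix M assume M: "M \<in> carrier (SL2 p)"
  then show "\<one>\<^bsub>SL2 p\<^esub> \<otimes>\<^bsub>SL2 p\<^esub> M = M"
    using mat_mod_id[OF _ M] assms by (simp add: SL2_def)
  let ?N = "vector [vector [M $ 2 $ 2, - M $ 1 $ 2], vector [- M $ 2 $ 1, M $ 1 $ 1]] :: int^2^2"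
  have "[det M = 1] (mod int p)"
    using M by (simp add: SL2_def)
  then have "mat_mod p ?N \<in> carrier (SL2 p)" "mat_mod p (?N ** M) = mat 1"
    using mat_mod_SL2[of ?N p] assms
    by (auto simp: det_2 vec_eq_iff forall_2 matrix_matrix_mult_def sum_2 mat_def cong_def algebra_simps)
  then show "\<exists>N\<in>carrier (SL2 p). N \<otimes>\<^bsub>SL2 p\<^esub> M = \<one>\<^bsub>SL2 p\<^esub>"
    by (intro bexI[of _ "mat_mod p ?N"]) (simp_all add: SL2_def mat_mod_mult_left)
qed

end

theory Submission
  imports Defs "HOL-Analysis.Convex" "HOL-Algebra.Generated_Groups"
begin

text \<open>
  Suppose that the elements of \<open>S\<close> have on average more than \<open>|A|\<^sup>1\<^sup>-\<^sup>\<delta>\<close> incidences with \<open>A \<times> A\<close>. By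
  Cauchy--Schwarz the same holds, with a worse \<open>\<delta>\<close>, for the dyadic convolution powers of the symmetrized
  uniform measure on \<open>S\<close>. Since an element of \<open>SL\<^sub>2\<close> is determined up to sign by the images of three points,
  this bounds the \<open>L\<^sup>2\<close> norms of these powers from below, roughly by \<open>|A|\<^sup>-\<^sup>3\<close>. Hence some power does
  not flatten under the next convolution, and Balog--Szemeredi--Gowers yields an approximate subgroup
  with a coset that contains a large part of \<open>S\<close>. By hypothesis (iii) it generates
  \<open>SL\<^sub>2(p)\<close>, and by Helfgott's growth theorem its size is close to \<open>p\<^sup>3\<close>; but it has size at most
  about \<open>|A|\<^sup>3\<close>, which contradicts \<open>|A| < p\<^sup>1\<^sup>-\<^sup>\<epsilon>\<close>.
\<close>

section \<open>Approximate subgroups of finite groups\<close>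

text \<open>Each convolution squares the loss, so the number \<open>J\<close> of convolutions may
  depend on \<epsilon> and r only. Flattening is therefore measured by a factor \<open>K\<close>
  that is a small power of |S|: the squared L^2 norm starts at 1/|S| or less and cannot fall much
  below |A|^-3, and log |A| < r log |S| makes about 4 r / \<eta> steps enough. This fixes \<delta>
  as a multiple of 2^-J, and all other losses are fixed powers of \<open>K\<close>.

  Helfgott's theorem is needed for sets H whose powers up to the 20th have size at most
  \<open>K\<close> |H|, and is proved by counting traces. A Larsen-Pink bound gives each nonzero
  trace at most about |H|^(2/3) elements; so, by conjugation with H, the centralizer of a suitable
  element has about |H|^(1/3) short words. Pivoting spreads this to all conjugate tori, about p^2 in
  number, and |H| is at least about p^3. Trace zero is avoided because the degenerate case of the
  trace count cancels the trace.

  Entries are integers and equations are divisibilities by p, so that most matrix identities become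
  ideal membership problems.\<close>

lemma card_fibres_le:
  fixes f :: "'a \<Rightarrow> 'b" and \<rho> :: real
  assumes T: "finite T" and Z: "\<And>z. z \<in> Z \<Longrightarrow> \<rho> \<le> real (card {t \<in> T. f t = z})"
  shows "\<rho> * real (card Z) \<le> real (card T)"
proof (cases "finite Z \<and> \<rho> > 0")
  case True
  have "\<rho> * real (card Z) = (\<Sum>z\<in>Z. \<rho>)" by simp
  also have "\<dots> \<le> (\<Sum>z\<in>Z. real (card {t \<in> T. f t = z}))" by (intro sum_mono Z)
  also have "\<dots> = real (card (\<Union>z\<in>Z. {t \<in> T. f t = z}))"
    using True T by (subst card_UN_disjoint) auto
  also have "\<dots> \<le> real (card T)" using T by (intro of_nat_mono card_mono) auto
  finally show ?thesis .
next
  case False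
  then consider "infinite Z" | "\<rho> \<le> 0" by linarith
  then show ?thesis
  proof cases
    case 2
    then have "\<rho> * real (card Z) \<le> 0" by (simp add: mult_nonpos_nonneg)
    then show ?thesis by linarith
  qed simp
qed

lemma card_le_fibres:
  fixes f :: "'a \<Rightarrow> 'b"
  assumes T: "finite T" and Z: "finite Z" "f ` T \<subseteq> Z"
    and n: "\<And>z. z \<in> Z \<Longrightarrow> card {t \<in> T. f t = z} \<le> n"
  shows "card T \<le> n * card Z"
proof -
  have "card T = card (\<Union>z\<in>Z. {t \<in> T. f t = z})"
    using Z by (intro arg_cong[of _ _ card]) auto
  also have "\<dots> \<le> (\<Sum>z\<in>Z. card {t \<in> T. f t = z})" using Z by (intro card_UN_le)
  also have "\<dots> \<le> (\<Sum>z\<in>Z. n)" by (intro sum_mono n)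
  finally show ?thesis by (simp add: mult.commute)
qed

text \<open>This form suits solution sets of quadratic equations: among three solutions two
  coincide, and no roots have to be named. An infinite \<open>W\<close> has
  \<open>card W = 0\<close>, hence no finiteness assumption.\<close>

lemma card_le_2I:
  assumes "\<And>x y z. x \<in> W \<Longrightarrow> y \<in> W \<Longrightarrow> z \<in> W \<Longrightarrow> x = y \<or> y = z \<or> x = z"
  shows "card W \<le> 2"
proof (rule ccontr)
  assume "\<not> card W \<le> 2"
  then have "3 \<le> card W" by simp
  then obtain V where "V \<subseteq> W" "card V = 3"
    by (rule obtain_subset_with_card_n)
  then obtain x y z where "x \<in> W" "y \<in> W" "z \<in> W" "x \<noteq> y" "y \<noteq> z" "x \<noteq> z"
    by (auto simp: card_3_iff)
  with assms show False by blast
qed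

lemma card_pairs_swap:
  assumes "finite A" "finite B"
  shows "(\<Sum>a\<in>A. card {b \<in> B. R a b}) = (\<Sum>b\<in>B. card {a \<in> A. R a b})"
proof -
  have "(\<Sum>a\<in>A. card {b \<in> B. R a b}) = (\<Sum>a\<in>A. \<Sum>b\<in>B. if R a b then 1 else 0)"
    using assms by (intro sum.cong refl) (simp add: sum.If_cases Int_def)
  also have "\<dots> = (\<Sum>b\<in>B. \<Sum>a\<in>A. if R a b then 1 else 0)" by (rule sum.swap)
  also have "\<dots> = (\<Sum>b\<in>B. card {a \<in> A. R a b})"
    using assms by (intro sum.cong refl) (simp add: sum.If_cases Int_def)
  finally show ?thesis .
qed

lemma card_pairs_sum:
  assumes "finite A" "finite B"
  shows "card {(a, b) \<in> A \<times> B. R a b} = (\<Sum>a\<in>A. card {b \<in> B. R a b})"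
proof -
  have "{(a, b) \<in> A \<times> B. R a b} = (SIGMA a:A. {b \<in> B. R a b})" by auto
  then show ?thesis using assms by simp
qed

lemma sum_linear_restrict:
  fixes f :: "'a \<Rightarrow> real"
  assumes "finite A" "B \<subseteq> A"
  shows "(\<Sum>x\<in>A. c * f x + (if x \<in> B then d * f x else 0)) = c * (\<Sum>x\<in>A. f x) + d * (\<Sum>x\<in>B. f x)"
proof -
  have "(\<Sum>x\<in>A. if x \<in> B then d * f x else 0) = (\<Sum>x\<in>B. d * f x)"
    using assms by (simp add: sum.If_cases Int_absorb1)
  then show ?thesis unfolding sum.distrib sum_distrib_left by simp
qed

section \<open>Representation counts and the Balog--Szemeredi--Gowers theorem\<close>

context group
begin

definition quot_count :: "'a set \<Rightarrow> 'a \<Rightarrow> nat" where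
  "quot_count X g = card {(a, b) \<in> X \<times> X. a \<otimes> inv b = g}"

definition quots :: "'a set \<Rightarrow> 'a set" where
  "quots X = {a \<otimes> inv b |a b. a \<in> X \<and> b \<in> X}"

primrec setpow :: "'a set \<Rightarrow> nat \<Rightarrow> 'a set" where
  "setpow H 0 = {\<one>}"
| "setpow H (Suc n) = {h \<otimes> k |h k. h \<in> H \<and> k \<in> setpow H n}"

lemma quot_count_le:
  assumes "finite X" "X \<subseteq> carrier G" "g \<in> carrier G"
  shows "quot_count X g \<le> card X"
  unfolding quot_count_def
proof (rule card_inj_on_le[where f = fst])
  show "inj_on fst {(a, b) \<in> X \<times> X. a \<otimes> inv b = g}"
    using assms by (auto simp: inj_on_def subset_iff)
qed (use assms in auto)

lemma quot_count_inv:
  assumes "X \<subseteq> carrier G" "g \<in> carrier G"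
  shows "quot_count X (inv g) = quot_count X g"
  unfolding quot_count_def
proof (rule bij_betw_same_card[of prod.swap], rule bij_betw_byWitness[where f' = prod.swap])
  show "prod.swap ` {(a, b) \<in> X \<times> X. a \<otimes> inv b = inv g} \<subseteq> {(a, b) \<in> X \<times> X. a \<otimes> inv b = g}"
    using assms by (auto simp: subset_iff) (metis inv_closed inv_inv inv_mult_group)
  show "prod.swap ` {(a, b) \<in> X \<times> X. a \<otimes> inv b = g} \<subseteq> {(a, b) \<in> X \<times> X. a \<otimes> inv b = inv g}"
    using assms by (auto simp: subset_iff) (metis inv_closed inv_inv inv_mult_group)
qed auto

lemma sum_quot_count:
  assumes "finite X" "X \<subseteq> carrier G" "finite (carrier G)"
  shows "(\<Sum>g\<in>carrier G. quot_count X g) = card X ^ 2"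
proof -
  have "(\<Sum>g\<in>carrier G. quot_count X g) =
      card (\<Union>g\<in>carrier G. {(a, b) \<in> X \<times> X. a \<otimes> inv b = g})"
    unfolding quot_count_def using assms
    by (subst card_UN_disjoint) (auto intro: finite_subset[of _ "X \<times> X"])
  also have "(\<Union>g\<in>carrier G. {(a, b) \<in> X \<times> X. a \<otimes> inv b = g}) = X \<times> X"
    using assms by (auto simp: subset_iff)
  finally show ?thesis by (simp add: card_cartesian_product power2_eq_square)
qed


text \<open>Join a and b when their quotient is popular. Dependent random choice yields a
  neighbourhood \<open>U\<close> in which few pairs have few common neighbours. A pair with many
  common neighbours has a quotient that is a product of two popular ones in many ways, and a
  quotient of elements of \<open>Y\<close> is in many ways a product of two quotients of that
  kind.\<close>

theorem balog_szemeredi_gowers: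
  fixes K :: real
  assumes fin: "finite (carrier G)" and X: "X \<subseteq> carrier G" "X \<noteq> {}" and K: "K \<ge> 1"
    and energy: "real (card X) ^ 3 / K \<le> (\<Sum>g\<in>carrier G. real (quot_count X g) ^ 2)"
  obtains Y where "Y \<subseteq> X" "real (card X) \<le> 4 * K * real (card Y)"
    "real (card (quots Y)) \<le> 2 ^ 23 * K ^ 10 * real (card Y)"
proof -
  define n where "n = real (card X)"
  define r where "r g = real (quot_count X g)" for g
  \<comment> \<open>With this threshold the unpopular quotients contribute at most n / (2 K) * n^2,
    half of the assumed energy.\<close>
  define D where "D = {g \<in> carrier G. n / (2 * K) \<le> r g}"
  define E where "E a b \<longleftrightarrow> a \<otimes> inv b \<in> D" for a b
  have finX: "finite X" using fin X finite_subset by blast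
  have n0: "n > 0" using X finX by (simp add: n_def card_gt_0_iff)
  have K0: "K > 0" using K by simp
  have finD: "finite D" using fin by (simp add: D_def)
  have sumr: "(\<Sum>g\<in>carrier G. r g) = n ^ 2"
    using sum_quot_count[OF finX X(1) fin] unfolding r_def n_def
    unfolding of_nat_sum[symmetric] of_nat_power[symmetric] by (rule arg_cong)
  have r_le: "r g \<le> n" if "g \<in> carrier G" for g
    using quot_count_le[OF finX X(1) that] by (simp add: r_def n_def)
  have D_inv: "inv g \<in> D" if "g \<in> D" for g
    using that quot_count_inv[OF X(1), of g] by (auto simp: D_def r_def)
  have E_sym: "E b a" if "E a b" "a \<in> X" "b \<in> X" for a b
  proof -
    have "inv (a \<otimes> inv b) = b \<otimes> inv a"
      using that X by (simp add: inv_mult_group subset_iff)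
    then show ?thesis using D_inv[of "a \<otimes> inv b"] that by (simp add: E_def)
  qed
  have cardD: "real (card D) \<le> 2 * K * n"
  proof -
    have "real (card D) * (n / (2 * K)) = (\<Sum>g\<in>D. n / (2 * K))" by simp
    also have "\<dots> \<le> (\<Sum>g\<in>D. r g)" by (intro sum_mono) (simp add: D_def)
    also have "\<dots> \<le> (\<Sum>g\<in>carrier G. r g)"
      using fin by (intro sum_mono2) (auto simp: D_def r_def)
    finally have "real (card D) * (n / (2 * K)) \<le> n ^ 2" using sumr by simp
    then show ?thesis using n0 K0 by (simp add: field_simps power2_eq_square)
  qed
  have sumD: "n\<^sup>2 / (2 * K) \<le> (\<Sum>g\<in>D. r g)"
  proof -
    have "n ^ 3 / K \<le> (\<Sum>g\<in>carrier G. r g ^ 2)" using energy by (simp add: n_def r_def)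
    also have "\<dots> \<le> (\<Sum>g\<in>carrier G. n / (2 * K) * r g + (if g \<in> D then n * r g else 0))"
    proof (intro sum_mono)
      fix g assume g: "g \<in> carrier G"
      have r0: "r g \<ge> 0" by (simp add: r_def)
      show "r g ^ 2 \<le> n / (2 * K) * r g + (if g \<in> D then n * r g else 0)"
      proof (cases "g \<in> D")
        case True
        have "r g * r g \<le> n * r g" using r_le[OF g] r0 by (intro mult_right_mono) auto
        moreover have "0 \<le> n / (2 * K) * r g" using n0 K0 r0 by simp
        ultimately show ?thesis using True by (simp add: power2_eq_square)
      next
        case False
        then have "r g \<le> n / (2 * K)" using g by (simp add: D_def)
        then have "r g * r g \<le> n / (2 * K) * r g" using r0 by (intro mult_right_mono) auto
        then show ?thesis using False by (simp add: power2_eq_square)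
      qed
    qed
    also have "\<dots> = n / (2 * K) * (\<Sum>g\<in>carrier G. r g) + n * (\<Sum>g\<in>D. r g)"
      by (rule sum_linear_restrict[OF fin]) (auto simp: D_def)
    also have "\<dots> = n / (2 * K) * n ^ 2 + n * (\<Sum>g\<in>D. r g)" by (simp only: sumr)
    finally have "n * (n\<^sup>2 / (2 * K)) \<le> n * (\<Sum>g\<in>D. r g)"
      by (simp add: field_simps power2_eq_square power3_eq_cube)
    then show ?thesis by (rule mult_left_le_imp_le[OF _ n0])
  qed
  have pairs: "(\<Sum>g\<in>D. r g) = (\<Sum>v\<in>X. real (card {a \<in> X. E a v}))"
  proof -
    have "(\<Sum>g\<in>D. quot_count X g) = card (\<Union>g\<in>D. {(a, b) \<in> X \<times> X. a \<otimes> inv b = g})"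
      unfolding quot_count_def using finX finD
      by (subst card_UN_disjoint) (auto intro: finite_subset[of _ "X \<times> X"])
    also have "(\<Union>g\<in>D. {(a, b) \<in> X \<times> X. a \<otimes> inv b = g}) = {(a, b) \<in> X \<times> X. E a b}"
      by (auto simp: E_def)
    also have "card \<dots> = (\<Sum>a\<in>X. card {b \<in> X. E a b})" by (rule card_pairs_sum[OF finX finX])
    also have "\<dots> = (\<Sum>v\<in>X. card {a \<in> X. E a v})" by (rule card_pairs_swap[OF finX finX])
    finally show ?thesis unfolding r_def of_nat_sum[symmetric] by (rule arg_cong)
  qed
  define N where "N v = {a \<in> X. E a v}" for v
  \<comment> \<open>Chosen so that 16 times the bound in \<open>sum_bad\<close> is half of the lower
    bound in \<open>sum_N\<close>.\<close>
  define \<kappa> where "\<kappa> = 1 / (128 * K\<^sup>2)"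
  define codeg where "codeg a b = real (card {v \<in> X. E a v \<and> E b v})" for a b
  define bad where "bad = {(a, b) \<in> X \<times> X. codeg a b < \<kappa> * n}"
  have finbad: "finite bad" using finX by (auto simp: bad_def intro: finite_subset[of _ "X \<times> X"])
  have cardbad: "real (card bad) \<le> n ^ 2"
  proof -
    have "card bad \<le> card (X \<times> X)" using finX by (intro card_mono) (auto simp: bad_def)
    then have "real (card bad) \<le> real (card (X \<times> X))" by (rule of_nat_mono)
    then show ?thesis by (simp add: n_def power2_eq_square card_cartesian_product)
  qed
  have sum_bad: "(\<Sum>v\<in>X. real (card {t \<in> bad. fst t \<in> N v \<and> snd t \<in> N v})) \<le> \<kappa> * n ^ 3"
  proof -
    have "(\<Sum>v\<in>X. card {t \<in> bad. fst t \<in> N v \<and> snd t \<in> N v}) =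
        (\<Sum>t\<in>bad. card {v \<in> X. fst t \<in> N v \<and> snd t \<in> N v})"
      by (rule card_pairs_swap[OF finX finbad])
    then have "(\<Sum>v\<in>X. real (card {t \<in> bad. fst t \<in> N v \<and> snd t \<in> N v})) =
        (\<Sum>t\<in>bad. real (card {v \<in> X. fst t \<in> N v \<and> snd t \<in> N v}))"
      unfolding of_nat_sum[symmetric] by (rule arg_cong)
    also have "\<dots> \<le> (\<Sum>t\<in>bad. \<kappa> * n)"
      by (intro sum_mono) (auto simp: bad_def N_def codeg_def intro: less_imp_le)
    also have "\<dots> = real (card bad) * (\<kappa> * n)" by simp
    also have "\<dots> \<le> n\<^sup>2 * (\<kappa> * n)"
      using cardbad n0 by (intro mult_right_mono) (simp_all add: \<kappa>_def)
    finally show ?thesis by (simp add: power2_eq_square power3_eq_cube mult_ac)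
  qed
  have sum_N: "n ^ 3 / (4 * K\<^sup>2) \<le> (\<Sum>v\<in>X. real (card (N v)) ^ 2)"
  proof -
    have "(n\<^sup>2 / (2 * K)) ^ 2 \<le> (\<Sum>v\<in>X. real (card (N v))) ^ 2"
      using sumD pairs K0 by (intro power_mono) (auto simp: N_def)
    also have "\<dots> \<le> (\<Sum>v\<in>X. real (card (N v)) ^ 2) * n"
      using Cauchy_Schwarz_ineq_sum[of "\<lambda>v. real (card (N v))" "\<lambda>_. 1" X] by (simp add: n_def)
    finally show ?thesis using n0 K0 by (simp add: field_simps power2_eq_square power3_eq_cube)
  qed
  \<comment> \<open>Averaging over v with the bad pairs penalized gives both a large neighbourhood
    and few bad pairs in it. The weight 16 makes them at most u^2 / 16, so that at most u / 4
    elements of \<open>U\<close> have more than u / 4 bad partners.\<close>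
  obtain v where v: "v \<in> X"
    and big: "n\<^sup>2 / (8 * K\<^sup>2) \<le>
      real (card (N v)) ^ 2 - 16 * real (card {t \<in> bad. fst t \<in> N v \<and> snd t \<in> N v})"
  proof (rule ccontr)
    assume "\<not> thesis"
    then have "(\<Sum>v\<in>X. real (card (N v)) ^ 2 - 16 * real (card {t \<in> bad. fst t \<in> N v \<and> snd t \<in> N v}))
      < (\<Sum>v\<in>X. n\<^sup>2 / (8 * K\<^sup>2))"
      using that X finX by (intro sum_strict_mono) (auto simp: not_le[symmetric])
    also have "\<dots> = n ^ 3 / (8 * K\<^sup>2)"
      by (simp add: n_def power2_eq_square power3_eq_cube)
    finally have "n ^ 3 / (4 * K\<^sup>2) - 16 * (\<kappa> * n ^ 3) < n ^ 3 / (8 * K\<^sup>2)"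
      using sum_N sum_bad by (simp add: sum_subtractf sum_distrib_left[symmetric])
    then show False using K0 by (simp add: \<kappa>_def field_simps)
  qed
  define U where "U = N v"
  define u where "u = real (card U)"
  have UX: "U \<subseteq> X" by (auto simp: U_def N_def)
  then have finU: "finite U" using finX finite_subset by blast
  have nu: "n \<le> 3 * K * u"
  proof (rule power2_le_imp_le)
    have "n\<^sup>2 / (8 * K\<^sup>2) \<le> u ^ 2" using big by (simp add: u_def U_def)
    then have "n\<^sup>2 \<le> 8 * (K\<^sup>2 * u\<^sup>2)" using K0 by (simp add: field_simps)
    also have "\<dots> \<le> 9 * (K\<^sup>2 * u\<^sup>2)" by (intro mult_right_mono) auto
    finally show "n\<^sup>2 \<le> (3 * K * u)\<^sup>2" by (simp add: power_mult_distrib)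
  qed (use K0 in \<open>simp add: u_def\<close>)
  have u0: "u > 0" using nu n0 K0 by (smt (verit) mult_nonneg_nonpos)
  define bd where "bd a = {b \<in> U. (a, b) \<in> bad}" for a
  define Y where "Y = {a \<in> U. real (card (bd a)) \<le> u / 4}"
  have YU: "Y \<subseteq> U" by (auto simp: Y_def)
  then have finY: "finite Y" using finU finite_subset by blast
  have sum_bd: "(\<Sum>a\<in>U. real (card (bd a))) \<le> u\<^sup>2 / 16"
  proof -
    have "(\<Sum>a\<in>U. card (bd a)) = card {(a, b) \<in> U \<times> U. (a, b) \<in> bad}"
      unfolding bd_def by (rule card_pairs_sum[OF finU finU, symmetric])
    also have "{(a, b) \<in> U \<times> U. (a, b) \<in> bad} = {t \<in> bad. fst t \<in> N v \<and> snd t \<in> N v}"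
      by (auto simp: U_def)
    finally have "(\<Sum>a\<in>U. real (card (bd a))) = real (card {t \<in> bad. fst t \<in> N v \<and> snd t \<in> N v})"
      unfolding of_nat_sum[symmetric] by (rule arg_cong)
    moreover have "0 \<le> n\<^sup>2 / (8 * K\<^sup>2)" by simp
    ultimately show ?thesis using big unfolding u_def U_def by linarith
  qed
  have cardY: "3 / 4 * u \<le> real (card Y)"
  proof -
    have "u / 4 * real (card (U - Y)) = (\<Sum>a\<in>U - Y. u / 4)" by simp
    also have "\<dots> \<le> (\<Sum>a\<in>U - Y. real (card (bd a)))" by (intro sum_mono) (auto simp: Y_def)
    also have "\<dots> \<le> (\<Sum>a\<in>U. real (card (bd a)))" using finU by (intro sum_mono2) auto
    finally have "u / 4 * real (card (U - Y)) \<le> u / 4 * (u / 4)"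
      using sum_bd by (simp add: power2_eq_square)
    then have "real (card (U - Y)) \<le> u / 4" using u0 by simp
    moreover have "u = real (card Y) + real (card (U - Y))"
      unfolding u_def using YU finU finY
      by (simp add: card_Diff_subset card_mono of_nat_diff)
    ultimately show ?thesis by linarith
  qed
  have nY: "n \<le> 4 * K * real (card Y)"
  proof -
    have "n \<le> 4 * K * (3 / 4 * u)" using nu by simp
    also have "\<dots> \<le> 4 * K * real (card Y)" using cardY K0 by (intro mult_left_mono) auto
    finally show ?thesis .
  qed
  define Q where "Q = {a \<otimes> inv c |a c. a \<in> X \<and> c \<in> X \<and> (a, c) \<notin> bad}"
  have QG: "Q \<subseteq> carrier G" using X by (auto simp: Q_def subset_iff)
  then have finQ: "finite Q" using fin finite_subset by blast
  have cardQ: "real (card Q) \<le> 512 * K ^ 4 * n"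
  proof -
    have "\<kappa> * n * real (card Q) \<le> real (card (D \<times> D))"
    proof (rule card_fibres_le[where f = "\<lambda>(g, h). g \<otimes> h"])
      fix q assume "q \<in> Q"
      then obtain a c where ac: "a \<in> X" "c \<in> X" "(a, c) \<notin> bad" "q = a \<otimes> inv c"
        by (auto simp: Q_def)
      then have "\<kappa> * n \<le> codeg a c" by (auto simp: bad_def)
      also have "codeg a c \<le> real (card {t \<in> D \<times> D. (\<lambda>(g, h). g \<otimes> h) t = q})"
        unfolding codeg_def of_nat_le_iff
      proof (rule card_inj_on_le[where f = "\<lambda>v. (a \<otimes> inv v, v \<otimes> inv c)"])
        show "inj_on (\<lambda>v. (a \<otimes> inv v, v \<otimes> inv c)) {v \<in> X. E a v \<and> E c v}"
          using X ac by (auto simp: inj_on_def subset_iff)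
        have "a \<otimes> inv v \<otimes> (v \<otimes> inv c) = q" if "v \<in> X" for v
          using that X ac by (simp add: subset_iff m_assoc) (simp add: m_assoc[symmetric])
        then show "(\<lambda>v. (a \<otimes> inv v, v \<otimes> inv c)) ` {v \<in> X. E a v \<and> E c v}
            \<subseteq> {t \<in> D \<times> D. (\<lambda>(g, h). g \<otimes> h) t = q}"
          using ac E_sym by (auto simp: E_def)
        show "finite {t \<in> D \<times> D. (\<lambda>(g, h). g \<otimes> h) t = q}" using finD by simp
      qed
      finally show "\<kappa> * n \<le> real (card {t \<in> D \<times> D. (\<lambda>(g, h). g \<otimes> h) t = q})" .
    qed (use finD in simp)
    also have "\<dots> = real (card D) * real (card D)" by (simp add: card_cartesian_product)
    also have "\<dots> \<le> (2 * K * n) * (2 * K * n)" using cardD n0 K0 by (intro mult_mono) auto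
    finally show ?thesis using n0 K0
      by (simp add: \<kappa>_def field_simps power2_eq_square power4_eq_xxxx)
  qed
  have bad_sym: "(c, b) \<in> bad \<longleftrightarrow> (b, c) \<in> bad" for b c
    by (auto simp: bad_def codeg_def conj_commute)
  have "u / 2 * real (card (quots Y)) \<le> real (card (Q \<times> Q))"
  proof (rule card_fibres_le[where f = "\<lambda>(g, h). g \<otimes> h"])
    fix z assume "z \<in> quots Y"
    then obtain a b where ab: "a \<in> Y" "b \<in> Y" "z = a \<otimes> inv b" by (auto simp: quots_def)
    have abG: "a \<in> X" "b \<in> X" using ab YU UX by auto
    \<comment> \<open>Each of a and b excludes at most u / 4 elements c of \<open>U\<close>; every
      other c splits z as (a c^-1)(c b^-1) with both factors in \<open>Q\<close>.\<close>
    have "u / 2 \<le> real (card (U - (bd a \<union> bd b)))"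
    proof -
      have fb: "finite (bd a \<union> bd b)" "bd a \<union> bd b \<subseteq> U"
        using finU by (auto simp: bd_def)
      have "real (card (bd a \<union> bd b)) \<le> real (card (bd a)) + real (card (bd b))"
        using card_Un_le[of "bd a" "bd b"] by linarith
      also have "\<dots> \<le> u / 2" using ab by (simp add: Y_def)
      finally show ?thesis
        using fb finU card_mono[OF finU fb(2)] by (simp add: card_Diff_subset of_nat_diff u_def)
    qed
    also have "\<dots> \<le> real (card {t \<in> Q \<times> Q. (\<lambda>(g, h). g \<otimes> h) t = z})"
      unfolding of_nat_le_iff
    proof (rule card_inj_on_le[where f = "\<lambda>c. (a \<otimes> inv c, c \<otimes> inv b)"])
      show "inj_on (\<lambda>c. (a \<otimes> inv c, c \<otimes> inv b)) (U - (bd a \<union> bd b))"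
        using X abG UX by (auto simp: inj_on_def subset_iff)
      have "a \<otimes> inv c \<otimes> (c \<otimes> inv b) = z" if "c \<in> X" for c
        using that X abG ab by (simp add: subset_iff m_assoc) (simp add: m_assoc[symmetric])
      moreover have "a \<otimes> inv c \<in> Q \<and> c \<otimes> inv b \<in> Q" if "c \<in> U - (bd a \<union> bd b)" for c
        using that abG UX bad_sym[of c b] unfolding Q_def bd_def by blast
      ultimately show "(\<lambda>c. (a \<otimes> inv c, c \<otimes> inv b)) ` (U - (bd a \<union> bd b))
          \<subseteq> {t \<in> Q \<times> Q. (\<lambda>(g, h). g \<otimes> h) t = z}"
        using UX by auto
      show "finite {t \<in> Q \<times> Q. (\<lambda>(g, h). g \<otimes> h) t = z}" using finQ by simp
    qed
    finally show "u / 2 \<le> real (card {t \<in> Q \<times> Q. (\<lambda>(g, h). g \<otimes> h) t = z})" .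
  qed (use finQ in simp)
  also have "\<dots> = real (card Q) * real (card Q)" by (simp add: card_cartesian_product)
  also have "\<dots> \<le> (512 * K ^ 4 * n) * (512 * K ^ 4 * n)" using cardQ n0 K0 by (intro mult_mono) auto
  also have "\<dots> = 2 ^ 18 * K ^ 8 * n * n" by (simp add: power_add[symmetric] mult_ac)
  also have "\<dots> \<le> 2 ^ 18 * K ^ 8 * (3 * K * u) * (4 * K * real (card Y))"
    using nu nY n0 K0 by (intro mult_mono mult_left_mono) (auto simp: u_def)
  also have "\<dots> = u / 2 * (2 ^ 18 * 24 * K ^ 10 * real (card Y))"
    by (simp add: power_numeral_reduce)
  also have "\<dots> \<le> u / 2 * (2 ^ 23 * K ^ 10 * real (card Y))"
    using u0 K0 by (intro mult_left_mono mult_right_mono) auto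
  finally have "real (card (quots Y)) \<le> 2 ^ 23 * K ^ 10 * real (card Y)"
    using u0 by (simp add: mult_ac)
  then show thesis using that[of Y] YU UX nY by (simp add: n_def)
qed


section \<open>Approximate subgroups from sets with few quotients\<close>

definition lquot_count :: "'a set \<Rightarrow> 'a \<Rightarrow> nat" where
  "lquot_count Y g = card {(c, a) \<in> Y \<times> Y. inv c \<otimes> a = g}"

lemma lquot_count_le:
  assumes "finite Y" "Y \<subseteq> carrier G" "g \<in> carrier G"
  shows "lquot_count Y g \<le> card Y"
  unfolding lquot_count_def
proof (rule card_inj_on_le[where f = fst])
  show "inj_on fst {(c, a) \<in> Y \<times> Y. inv c \<otimes> a = g}"
    using assms by (auto simp: inj_on_def subset_iff)
qed (use assms in auto)

lemma lquot_count_inv: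
  assumes "Y \<subseteq> carrier G" "g \<in> carrier G"
  shows "lquot_count Y (inv g) = lquot_count Y g"
  unfolding lquot_count_def
proof (rule bij_betw_same_card[of prod.swap], rule bij_betw_byWitness[where f' = prod.swap])
  show "prod.swap ` {(c, a) \<in> Y \<times> Y. inv c \<otimes> a = inv g} \<subseteq> {(c, a) \<in> Y \<times> Y. inv c \<otimes> a = g}"
    using assms by (auto simp: subset_iff) (metis inv_closed inv_inv inv_mult_group)
  show "prod.swap ` {(c, a) \<in> Y \<times> Y. inv c \<otimes> a = g} \<subseteq> {(c, a) \<in> Y \<times> Y. inv c \<otimes> a = inv g}"
    using assms by (auto simp: subset_iff) (metis inv_closed inv_inv inv_mult_group)
qed auto

text \<open>Both sides count quadruples, since c^-1 a = d^-1 b holds exactly when a b^-1 = c d^-1.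
  This carries energy from right quotients, where it is known, to left quotients, which are the ones
  that can be inserted between an element of Y and the inverse of another.\<close>

lemma sum_lquot_count_sq:
  assumes "finite Y" "Y \<subseteq> carrier G" "finite (carrier G)"
  shows "(\<Sum>g\<in>carrier G. lquot_count Y g ^ 2) = (\<Sum>g\<in>carrier G. quot_count Y g ^ 2)"
proof -
  have sq: "(\<Sum>g\<in>carrier G. card {t \<in> Y \<times> Y. f t = g} ^ 2) =
      card {(t, t') \<in> (Y \<times> Y) \<times> (Y \<times> Y). f t = f t'}"
    if "f ` (Y \<times> Y) \<subseteq> carrier G" for f
  proof -
    have "(\<Sum>g\<in>carrier G. card {t \<in> Y \<times> Y. f t = g} ^ 2) =
        (\<Sum>g\<in>carrier G. card ({t \<in> Y \<times> Y. f t = g} \<times> {t \<in> Y \<times> Y. f t = g}))"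
      by (simp add: power2_eq_square card_cartesian_product)
    also have "\<dots> = card (\<Union>g\<in>carrier G. {t \<in> Y \<times> Y. f t = g} \<times> {t \<in> Y \<times> Y. f t = g})"
      using assms by (subst card_UN_disjoint) auto
    also have "(\<Union>g\<in>carrier G. {t \<in> Y \<times> Y. f t = g} \<times> {t \<in> Y \<times> Y. f t = g}) =
        {(t, t') \<in> (Y \<times> Y) \<times> (Y \<times> Y). f t = f t'}"
      using that by (auto 0 3 simp: image_subset_iff)
    finally show ?thesis .
  qed
  have swap: "inv c \<otimes> a = inv d \<otimes> b \<longleftrightarrow> a \<otimes> inv b = c \<otimes> inv d"
    if "a \<in> carrier G" "b \<in> carrier G" "c \<in> carrier G" "d \<in> carrier G" for a b c d
  proof -
    have "inv c \<otimes> a = inv d \<otimes> b \<longleftrightarrow> a = c \<otimes> (inv d \<otimes> b)"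
      using that by (metis inv_closed inv_solve_left m_closed)
    also have "\<dots> \<longleftrightarrow> a = (c \<otimes> inv d) \<otimes> b" using that by (simp add: m_assoc)
    also have "\<dots> \<longleftrightarrow> a \<otimes> inv b = c \<otimes> inv d"
      using that by (metis inv_closed inv_solve_right m_closed)
    finally show ?thesis .
  qed
  have "card {(t, t') \<in> (Y \<times> Y) \<times> (Y \<times> Y). (\<lambda>(c, a). inv c \<otimes> a) t = (\<lambda>(c, a). inv c \<otimes> a) t'} =
      card {(t, t') \<in> (Y \<times> Y) \<times> (Y \<times> Y). (\<lambda>(a, b). a \<otimes> inv b) t = (\<lambda>(a, b). a \<otimes> inv b) t'}"
    by (rule bij_betw_same_card[of "\<lambda>((c, a), (d, b)). ((a, b), (c, d))"],
        rule bij_betw_byWitness[where f' = "\<lambda>((a, b), (c, d)). ((c, a), (d, b))"])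
       (use assms in \<open>force simp: swap subset_iff\<close>)+
  moreover have "(\<Sum>g\<in>carrier G. lquot_count Y g ^ 2) =
      card {(t, t') \<in> (Y \<times> Y) \<times> (Y \<times> Y). (\<lambda>(c, a). inv c \<otimes> a) t = (\<lambda>(c, a). inv c \<otimes> a) t'}"
  proof -
    have "lquot_count Y g = card {t \<in> Y \<times> Y. (\<lambda>(c, a). inv c \<otimes> a) t = g}" for g
      unfolding lquot_count_def by (rule arg_cong[of _ _ card]) auto
    moreover have "(\<lambda>(c, a). inv c \<otimes> a) ` (Y \<times> Y) \<subseteq> carrier G" using assms by auto
    ultimately show ?thesis using sq[of "\<lambda>(c, a). inv c \<otimes> a"] by presburger
  qed
  moreover have "(\<Sum>g\<in>carrier G. quot_count Y g ^ 2) =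
      card {(t, t') \<in> (Y \<times> Y) \<times> (Y \<times> Y). (\<lambda>(a, b). a \<otimes> inv b) t = (\<lambda>(a, b). a \<otimes> inv b) t'}"
  proof -
    have "quot_count Y g = card {t \<in> Y \<times> Y. (\<lambda>(a, b). a \<otimes> inv b) t = g}" for g
      unfolding quot_count_def by (rule arg_cong[of _ _ card]) auto
    moreover have "(\<lambda>(a, b). a \<otimes> inv b) ` (Y \<times> Y) \<subseteq> carrier G" using assms by auto
    ultimately show ?thesis using sq[of "\<lambda>(a, b). a \<otimes> inv b"] by presburger
  qed
  ultimately show ?thesis by simp
qed

definition popular_quots :: "'a set \<Rightarrow> real \<Rightarrow> 'a set" where
  "popular_quots Y K = {g \<in> carrier G. real (card Y) / (2 * K) \<le> real (lquot_count Y g)}"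

lemma setpow_carrier:
  assumes "H \<subseteq> carrier G"
  shows "setpow H n \<subseteq> carrier G"
  using assms by (induction n) (auto simp: subset_iff)

lemma one_popular_quots:
  assumes "finite Y" "Y \<subseteq> carrier G" "K \<ge> 1"
  shows "\<one> \<in> popular_quots Y K"
proof -
  have "card Y \<le> lquot_count Y \<one>"
    unfolding lquot_count_def
    by (rule card_inj_on_le[where f = "\<lambda>a. (a, a)"])
      (use assms in \<open>auto simp: inj_on_def subset_iff intro: finite_subset[of _ "Y \<times> Y"]\<close>)
  moreover have "real (card Y) / (2 * K) \<le> real (card Y) / 1"
    using assms by (intro divide_left_mono) auto
  ultimately show ?thesis by (simp add: popular_quots_def)
qed

lemma inv_popular_quots:
  assumes "Y \<subseteq> carrier G" "g \<in> popular_quots Y K"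
  shows "inv g \<in> popular_quots Y K"
  using assms by (simp add: popular_quots_def lquot_count_inv)

text \<open>
  Each factor \<open>s = c\<^sup>-\<^sup>1 d\<close> of a product can be split in many ways, and the pieces regroup into few elements
  of the form \<open>a c\<^sup>-\<^sup>1\<close>; this is Tao's substitute for tripling estimates.
\<close>

lemma card_setpow_popular_quots:
  assumes fin: "finite (carrier G)" and Y: "Y \<subseteq> carrier G" "Y \<noteq> {}" and K: "K \<ge> 1"
    and small: "real (card (quots Y)) \<le> K * real (card Y)"
  shows "real (card (setpow (popular_quots Y K) n)) \<le> K * (2 * K\<^sup>2) ^ n * real (card Y)"
proof -
  let ?P = "popular_quots Y K"
  define Z where "Z n = {a \<otimes> w \<otimes> inv b |a w b. a \<in> Y \<and> w \<in> setpow ?P n \<and> b \<in> Y}" for n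
  define y where "y = real (card Y)"
  have finY: "finite Y" using fin Y finite_subset by blast
  have y0: "y > 0" using Y finY by (simp add: y_def card_gt_0_iff)
  have PG: "?P \<subseteq> carrier G" by (auto simp: popular_quots_def)
  note pc = setpow_carrier[OF PG]
  have ZG: "Z n \<subseteq> carrier G" for n
    using Y pc[of n] by (auto simp: Z_def subset_iff)
  then have finZ: "finite (Z n)" for n using fin finite_subset by blast
  have Z0: "Z 0 = quots Y"
    using Y by (auto simp: Z_def quots_def subset_iff) (metis r_one)+
  have step: "real (card (Z (Suc n))) \<le> 2 * K\<^sup>2 * real (card (Z n))" for n
  proof -
    have "y / (2 * K) * real (card (Z (Suc n))) \<le> real (card (Z 0 \<times> Z n))"
    proof (rule card_fibres_le[where f = "\<lambda>(g, h). g \<otimes> h"])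
      fix z assume "z \<in> Z (Suc n)"
      then obtain a s w b where z: "z = a \<otimes> (s \<otimes> w) \<otimes> inv b" "a \<in> Y" "b \<in> Y"
        "s \<in> ?P" "w \<in> setpow ?P n" by (auto simp: Z_def)
      have c: "a \<in> carrier G" "b \<in> carrier G" "s \<in> carrier G" "w \<in> carrier G"
        using z Y PG pc[of n] by auto
      have "y / (2 * K) \<le> real (lquot_count Y s)" using z by (simp add: popular_quots_def y_def)
      also have "\<dots> \<le> real (card {t \<in> Z 0 \<times> Z n. (\<lambda>(g, h). g \<otimes> h) t = z})"
        unfolding lquot_count_def of_nat_le_iff
      proof (rule card_inj_on_le[where f = "\<lambda>(c, d). (a \<otimes> inv c, d \<otimes> w \<otimes> inv b)"])
        show "inj_on (\<lambda>(c, d). (a \<otimes> inv c, d \<otimes> w \<otimes> inv b)) {(c, a) \<in> Y \<times> Y. inv c \<otimes> a = s}"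
          using Y c by (auto simp: inj_on_def subset_iff)
        have "a \<otimes> inv e \<otimes> (d \<otimes> w \<otimes> inv b) = z" if "e \<in> Y" "d \<in> Y" "inv e \<otimes> d = s" for e d
        proof -
          have "e \<in> carrier G" "d \<in> carrier G" using that Y by auto
          then show ?thesis using c that(3)[symmetric] z(1) by (simp add: m_assoc)
        qed
        moreover have "a \<otimes> inv e \<in> Z 0" if "e \<in> Y" for e
          using that z Z0 by (auto simp: quots_def)
        moreover have "d \<otimes> w \<otimes> inv b \<in> Z n" if "d \<in> Y" for d
          using that z by (auto simp: Z_def)
        ultimately show "(\<lambda>(c, d). (a \<otimes> inv c, d \<otimes> w \<otimes> inv b)) ` {(c, a) \<in> Y \<times> Y. inv c \<otimes> a = s}
            \<subseteq> {t \<in> Z 0 \<times> Z n. (\<lambda>(g, h). g \<otimes> h) t = z}" by auto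
        show "finite {t \<in> Z 0 \<times> Z n. (\<lambda>(g, h). g \<otimes> h) t = z}" using finZ by simp
      qed
      finally show "y / (2 * K) \<le> real (card {t \<in> Z 0 \<times> Z n. (\<lambda>(g, h). g \<otimes> h) t = z})" .
    qed (use finZ in simp)
    also have "\<dots> = real (card (quots Y)) * real (card (Z n))" by (simp add: card_cartesian_product Z0)
    also have "\<dots> \<le> K * y * real (card (Z n))" using small by (intro mult_right_mono) (auto simp: y_def)
    finally show ?thesis using y0 K by (simp add: field_simps power2_eq_square)
  qed
  have Zn: "real (card (Z n)) \<le> K * (2 * K\<^sup>2) ^ n * y"
  proof (induction n)
    case 0
    then show ?case using small by (simp add: Z0 y_def)
  next
    case (Suc n)
    have "real (card (Z (Suc n))) \<le> 2 * K\<^sup>2 * real (card (Z n))" by (rule step)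
    also have "\<dots> \<le> 2 * K\<^sup>2 * (K * (2 * K\<^sup>2) ^ n * y)" by (intro mult_left_mono Suc.IH) auto
    finally show ?case by (simp add: mult_ac)
  qed
  obtain a where a: "a \<in> Y" using Y by auto
  have "card (setpow ?P n) \<le> card (Z n)"
  proof (rule card_inj_on_le[where f = "\<lambda>w. a \<otimes> w \<otimes> inv a"])
    show "inj_on (\<lambda>w. a \<otimes> w \<otimes> inv a) (setpow ?P n)"
      using a Y pc[of n] by (auto simp: inj_on_def subset_iff)
  qed (use a finZ in \<open>auto simp: Z_def\<close>)
  then show ?thesis using Zn unfolding y_def by linarith
qed

text \<open>Cauchy--Schwarz on the few quotients gives energy at least y^3 / K. Unpopular left
  quotients carry at most half of it, so at least y^2 / (2 K) pairs of Y have a popular left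
  quotient, and some c is the first member of an average share of them.\<close>

lemma popular_quots_coset:
  assumes fin: "finite (carrier G)" and Y: "Y \<subseteq> carrier G" "Y \<noteq> {}" and K: "K \<ge> 1"
    and small: "real (card (quots Y)) \<le> K * real (card Y)"
  obtains c where "c \<in> Y"
    "real (card Y) / (2 * K) \<le> real (card {a \<in> Y. inv c \<otimes> a \<in> popular_quots Y K})"
proof -
  let ?P = "popular_quots Y K"
  define y where "y = real (card Y)"
  define r where "r g = real (lquot_count Y g)" for g
  have finY: "finite Y" using fin Y finite_subset by blast
  have y0: "y > 0" using Y finY by (simp add: y_def card_gt_0_iff)
  have finP: "finite ?P" using fin by (simp add: popular_quots_def)
  have finq: "finite (quots Y)"
    using fin Y by (rule_tac finite_subset[of _ "carrier G"]) (auto simp: quots_def subset_iff)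
  have sum2: "(\<Sum>g\<in>quots Y. real (quot_count Y g)) = y ^ 2"
  proof -
    have "(\<Sum>g\<in>quots Y. real (quot_count Y g)) = (\<Sum>g\<in>carrier G. real (quot_count Y g))"
    proof (rule sum.mono_neutral_left[OF fin])
      show "quots Y \<subseteq> carrier G" using Y by (auto simp: quots_def subset_iff)
      show "\<forall>i\<in>carrier G - quots Y. real (quot_count Y i) = 0"
        by (fastforce simp: quot_count_def quots_def intro: card_eq_0_iff[THEN iffD2])
    qed
    then show ?thesis using sum_quot_count[OF finY Y(1) fin]
      unfolding y_def of_nat_sum[symmetric] of_nat_power[symmetric] by simp
  qed
  have "y ^ 3 \<le> K * (\<Sum>g\<in>carrier G. r g ^ 2)"
  proof -
    have "(y ^ 2) ^ 2 \<le> (\<Sum>g\<in>quots Y. real (quot_count Y g) ^ 2) * real (card (quots Y))"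
      using Cauchy_Schwarz_ineq_sum[of "\<lambda>g. real (quot_count Y g)" "\<lambda>_. 1" "quots Y"] sum2 by simp
    also have "\<dots> \<le> (\<Sum>g\<in>carrier G. real (quot_count Y g) ^ 2) * (K * y)"
      using small fin Y by (intro mult_mono sum_mono2 sum_nonneg) (auto simp: quots_def subset_iff y_def)
    also have "(\<Sum>g\<in>carrier G. real (quot_count Y g) ^ 2) = (\<Sum>g\<in>carrier G. r g ^ 2)"
      using sum_lquot_count_sq[OF finY Y(1) fin] 
      unfolding r_def of_nat_sum[symmetric] of_nat_power[symmetric] by simp
    finally have "y * y ^ 3 \<le> y * (K * (\<Sum>g\<in>carrier G. r g ^ 2))"
      by (simp add: power_numeral_reduce mult_ac)
    then show ?thesis using y0 by simp
  qed
  also have "(\<Sum>g\<in>carrier G. r g ^ 2) \<le>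
      (\<Sum>g\<in>carrier G. y / (2 * K) * r g + (if g \<in> ?P then y * r g else 0))"
  proof (intro sum_mono)
    fix g assume g: "g \<in> carrier G"
    have r0: "r g \<ge> 0" by (simp add: r_def)
    show "r g ^ 2 \<le> y / (2 * K) * r g + (if g \<in> ?P then y * r g else 0)"
    proof (cases "g \<in> ?P")
      case True
      have "r g * r g \<le> y * r g"
        using lquot_count_le[OF finY Y(1) g] r0 by (intro mult_right_mono) (auto simp: r_def y_def)
      moreover have "0 \<le> y / (2 * K) * r g" using y0 K r0 by simp
      ultimately show ?thesis using True by (simp add: power2_eq_square)
    next
      case False
      then have "r g \<le> y / (2 * K)" using g by (simp add: popular_quots_def r_def y_def)
      then have "r g * r g \<le> y / (2 * K) * r g" using r0 by (intro mult_right_mono) auto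
      then show ?thesis using False by (simp add: power2_eq_square)
    qed
  qed
  also have "\<dots> = y / (2 * K) * (\<Sum>g\<in>carrier G. r g) + y * (\<Sum>g\<in>?P. r g)"
    by (rule sum_linear_restrict[OF fin]) (auto simp: popular_quots_def)
  also have "(\<Sum>g\<in>carrier G. r g) = y ^ 2"
  proof -
    have "(\<Sum>g\<in>carrier G. lquot_count Y g) = card (\<Union>g\<in>carrier G. {(c, a) \<in> Y \<times> Y. inv c \<otimes> a = g})"
      unfolding lquot_count_def using finY fin
      by (subst card_UN_disjoint) (auto intro: finite_subset[of _ "Y \<times> Y"])
    also have "(\<Union>g\<in>carrier G. {(c, a) \<in> Y \<times> Y. inv c \<otimes> a = g}) = Y \<times> Y"
      using Y by (auto simp: subset_iff)
    finally have "(\<Sum>g\<in>carrier G. lquot_count Y g) = card Y ^ 2"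
      by (simp add: power2_eq_square card_cartesian_product)
    then show ?thesis
      unfolding r_def y_def of_nat_sum[symmetric] of_nat_power[symmetric] by (rule arg_cong)
  qed
  finally have "y * y ^ 2 \<le> y * (2 * K * (\<Sum>g\<in>?P. r g))"
    using K by (simp add: field_simps power_numeral_reduce)
  then have sumP: "y ^ 2 / (2 * K) \<le> (\<Sum>g\<in>?P. r g)" using y0 K by (simp add: field_simps)
  have "(\<Sum>g\<in>?P. r g) = (\<Sum>c\<in>Y. real (card {a \<in> Y. inv c \<otimes> a \<in> ?P}))"
  proof -
    have "(\<Sum>g\<in>?P. lquot_count Y g) = card (\<Union>g\<in>?P. {(c, a) \<in> Y \<times> Y. inv c \<otimes> a = g})"
      unfolding lquot_count_def using finY finP
      by (subst card_UN_disjoint) (auto intro: finite_subset[of _ "Y \<times> Y"])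
    also have "(\<Union>g\<in>?P. {(c, a) \<in> Y \<times> Y. inv c \<otimes> a = g}) = {(c, a) \<in> Y \<times> Y. inv c \<otimes> a \<in> ?P}"
      by auto
    also have "card \<dots> = (\<Sum>c\<in>Y. card {a \<in> Y. inv c \<otimes> a \<in> ?P})" by (rule card_pairs_sum[OF finY finY])
    finally show ?thesis unfolding r_def of_nat_sum[symmetric] by (rule arg_cong)
  qed
  with sumP have sumY: "y ^ 2 / (2 * K) \<le> (\<Sum>c\<in>Y. real (card {a \<in> Y. inv c \<otimes> a \<in> ?P}))" by simp
  show thesis
  proof (rule ccontr)
    assume "\<not> thesis"
    then have "(\<Sum>c\<in>Y. real (card {a \<in> Y. inv c \<otimes> a \<in> ?P})) < (\<Sum>c\<in>Y. y / (2 * K))"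
      using that Y finY unfolding y_def by (intro sum_strict_mono) (auto simp: not_le[symmetric])
    also have "\<dots> = y ^ 2 / (2 * K)" by (simp add: y_def power2_eq_square)
    finally show False using sumY by simp
  qed
qed

section \<open>Convolutions and their L^2 norms\<close>

definition conv :: "('a \<Rightarrow> real) \<Rightarrow> ('a \<Rightarrow> real) \<Rightarrow> 'a \<Rightarrow> real" where
  "conv f h g = (\<Sum>x\<in>carrier G. f x * h (inv x \<otimes> g))"

lemma sum_translate_left:
  assumes "x \<in> carrier G"
  shows "(\<Sum>g\<in>carrier G. f (x \<otimes> g)) = (\<Sum>g\<in>carrier G. f g)"
  by (rule sum.reindex_bij_witness[where i = "\<lambda>g. inv x \<otimes> g" and j = "\<lambda>g. x \<otimes> g"])
    (use assms in \<open>auto simp: m_assoc[symmetric]\<close>)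

lemma sum_translate_right:
  assumes "x \<in> carrier G"
  shows "(\<Sum>g\<in>carrier G. f (g \<otimes> x)) = (\<Sum>g\<in>carrier G. f g)"
  by (rule sum.reindex_bij_witness[where i = "\<lambda>g. g \<otimes> inv x" and j = "\<lambda>g. g \<otimes> x"])
    (use assms in \<open>auto simp: m_assoc\<close>)

lemma sum_inverse: "(\<Sum>g\<in>carrier G. f (inv g)) = (\<Sum>g\<in>carrier G. f g)"
  by (rule sum.reindex_bij_witness[where i = "\<lambda>g. inv g" and j = "\<lambda>g. inv g"]) auto

lemma sum_inv_translate:
  assumes "g \<in> carrier G"
  shows "(\<Sum>x\<in>carrier G. f (inv x \<otimes> g)) = (\<Sum>x\<in>carrier G. f x)"
  using sum_inverse[of "\<lambda>x. f (x \<otimes> g)"] sum_translate_right[OF assms, of f] by simp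

lemma conv_alt:
  assumes g: "g \<in> carrier G"
  shows "conv f h g = (\<Sum>y\<in>carrier G. f (g \<otimes> inv y) * h y)"
  unfolding conv_def
  by (rule sum.reindex_bij_witness[where i = "\<lambda>y. g \<otimes> inv y" and j = "\<lambda>x. inv x \<otimes> g"])
    (use g in \<open>auto simp: m_assoc inv_mult_group\<close>, auto simp: m_assoc[symmetric])

lemma sum_conv: "(\<Sum>g\<in>carrier G. conv f h g) = (\<Sum>x\<in>carrier G. f x) * (\<Sum>x\<in>carrier G. h x)"
proof -
  have "(\<Sum>g\<in>carrier G. conv f h g) = (\<Sum>x\<in>carrier G. \<Sum>g\<in>carrier G. f x * h (inv x \<otimes> g))"
    unfolding conv_def by (rule sum.swap)
  also have "\<dots> = (\<Sum>x\<in>carrier G. f x * (\<Sum>x\<in>carrier G. h x))"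
    by (intro sum.cong refl) (simp add: sum_distrib_left[symmetric] sum_translate_left)
  finally show ?thesis by (simp add: sum_distrib_right)
qed

lemma conv_nonneg:
  assumes "\<And>x. x \<in> carrier G \<Longrightarrow> f x \<ge> 0" "\<And>x. x \<in> carrier G \<Longrightarrow> h x \<ge> 0" "g \<in> carrier G"
  shows "conv f h g \<ge> 0"
  unfolding conv_def using assms by (intro sum_nonneg mult_nonneg_nonneg) auto

lemma conv_inv:
  assumes "\<And>x. x \<in> carrier G \<Longrightarrow> f (inv x) = f x" "\<And>x. x \<in> carrier G \<Longrightarrow> h (inv x) = h x"
    "g \<in> carrier G"
  shows "conv f h (inv g) = conv h f g"
proof -
  have "conv h f g = (\<Sum>y\<in>carrier G. f y * h (g \<otimes> inv (inv y)))"
    using assms(3) sum_inverse[of "\<lambda>y. h (g \<otimes> inv y) * f y"]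
    by (simp add: conv_alt assms(1) mult.commute)
  also have "\<dots> = conv f h (inv g)"
    unfolding conv_def
  proof (intro sum.cong refl)
    fix y assume y: "y \<in> carrier G"
    have "h (inv (g \<otimes> y)) = h (g \<otimes> y)" using y assms by (intro assms(2)) auto
    then show "f y * h (g \<otimes> inv (inv y)) = f y * h (inv y \<otimes> inv g)"
      using y assms by (simp add: inv_mult_group)
  qed
  finally show ?thesis by simp
qed

text \<open>\<open>quad f f f f\<close> is the squared L^2 norm of the convolution of f with itself.
  It is written with four independent slots so that f can be decomposed in one slot at a
  time.\<close>

definition quad :: "('a \<Rightarrow> real) \<Rightarrow> ('a \<Rightarrow> real) \<Rightarrow> ('a \<Rightarrow> real) \<Rightarrow> ('a \<Rightarrow> real) \<Rightarrow> real" where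
  "quad f1 f2 f3 f4 = (\<Sum>g\<in>carrier G. conv f1 f2 g * conv f3 f4 g)"

lemma quad_commute: "quad f1 f2 f3 f4 = quad f3 f4 f1 f2"
  by (simp add: quad_def mult.commute)

lemma conv_add_left: "conv (\<lambda>x. f x + f' x) h g = conv f h g + conv f' h g"
  by (simp add: conv_def distrib_right sum.distrib)

lemma conv_add_right: "conv f (\<lambda>x. h x + h' x) g = conv f h g + conv f h' g"
  by (simp add: conv_def distrib_left sum.distrib)

lemma quad_add1: "quad (\<lambda>x. f x + f' x) f2 f3 f4 = quad f f2 f3 f4 + quad f' f2 f3 f4"
  by (simp add: quad_def conv_add_left distrib_right sum.distrib)

lemma quad_add2: "quad f1 (\<lambda>x. f x + f' x) f3 f4 = quad f1 f f3 f4 + quad f1 f' f3 f4"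
  by (simp add: quad_def conv_add_right distrib_right sum.distrib)

lemma quad_add3: "quad f1 f2 (\<lambda>x. f x + f' x) f4 = quad f1 f2 f f4 + quad f1 f2 f' f4"
  by (simp add: quad_def conv_add_left distrib_left sum.distrib)

lemma quad_add4: "quad f1 f2 f3 (\<lambda>x. f x + f' x) = quad f1 f2 f3 f + quad f1 f2 f3 f'"
  by (simp add: quad_def conv_add_right distrib_left sum.distrib)

lemma conv_mono:
  assumes "\<And>x. x \<in> carrier G \<Longrightarrow> 0 \<le> f x \<and> f x \<le> f' x" "\<And>x. x \<in> carrier G \<Longrightarrow> 0 \<le> h x \<and> h x \<le> h' x"
    "g \<in> carrier G"
  shows "conv f h g \<le> conv f' h' g"
  unfolding conv_def using assms by (intro sum_mono mult_mono) (force intro: order_trans)+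

lemma quad_mono:
  assumes "\<And>x. x \<in> carrier G \<Longrightarrow> 0 \<le> f1 x \<and> f1 x \<le> h1 x" "\<And>x. x \<in> carrier G \<Longrightarrow> 0 \<le> f2 x \<and> f2 x \<le> h2 x"
    "\<And>x. x \<in> carrier G \<Longrightarrow> 0 \<le> f3 x \<and> f3 x \<le> h3 x" "\<And>x. x \<in> carrier G \<Longrightarrow> 0 \<le> f4 x \<and> f4 x \<le> h4 x"
  shows "quad f1 f2 f3 f4 \<le> quad h1 h2 h3 h4"
  unfolding quad_def
  by (intro sum_mono mult_mono conv_mono conv_nonneg) (use assms in \<open>force intro: order_trans\<close>)+

text \<open>This handles the small values of a measure: three slots of mass one turn a pointwise
  bound in the remaining slot into a bound for the whole form.\<close>

lemma quad_le_Sup1: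
  assumes f1: "\<And>x. x \<in> carrier G \<Longrightarrow> 0 \<le> f1 x \<and> f1 x \<le> l"
    and f2: "\<And>x. x \<in> carrier G \<Longrightarrow> 0 \<le> f2 x" and f3: "\<And>x. x \<in> carrier G \<Longrightarrow> 0 \<le> f3 x"
    and f4: "\<And>x. x \<in> carrier G \<Longrightarrow> 0 \<le> f4 x"
  shows "quad f1 f2 f3 f4 \<le> l * (\<Sum>x\<in>carrier G. f2 x) * (\<Sum>x\<in>carrier G. f3 x) * (\<Sum>x\<in>carrier G. f4 x)"
proof -
  have "conv f1 f2 g \<le> l * (\<Sum>x\<in>carrier G. f2 x)" if g: "g \<in> carrier G" for g
  proof -
    have "conv f1 f2 g \<le> (\<Sum>x\<in>carrier G. l * f2 (inv x \<otimes> g))"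
      unfolding conv_def using g f1 f2 by (intro sum_mono mult_right_mono) auto
    then show ?thesis using g by (simp add: sum_distrib_left[symmetric] sum_inv_translate)
  qed
  then have "quad f1 f2 f3 f4 \<le> (\<Sum>g\<in>carrier G. l * (\<Sum>x\<in>carrier G. f2 x) * conv f3 f4 g)"
    unfolding quad_def using f3 f4 by (intro sum_mono mult_right_mono conv_nonneg) auto
  then show ?thesis by (simp add: sum_distrib_left[symmetric] sum_conv mult_ac)
qed

lemma quad_le_Sup2:
  assumes f1: "\<And>x. x \<in> carrier G \<Longrightarrow> 0 \<le> f1 x"
    and f2: "\<And>x. x \<in> carrier G \<Longrightarrow> 0 \<le> f2 x \<and> f2 x \<le> l" and f3: "\<And>x. x \<in> carrier G \<Longrightarrow> 0 \<le> f3 x"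
    and f4: "\<And>x. x \<in> carrier G \<Longrightarrow> 0 \<le> f4 x"
  shows "quad f1 f2 f3 f4 \<le> l * (\<Sum>x\<in>carrier G. f1 x) * (\<Sum>x\<in>carrier G. f3 x) * (\<Sum>x\<in>carrier G. f4 x)"
proof -
  have "conv f1 f2 g \<le> l * (\<Sum>x\<in>carrier G. f1 x)" if g: "g \<in> carrier G" for g
  proof -
    have "conv f1 f2 g \<le> (\<Sum>x\<in>carrier G. f1 x * l)"
      unfolding conv_def using g f1 f2 by (intro sum_mono mult_left_mono) auto
    then show ?thesis by (simp add: sum_distrib_left mult.commute)
  qed
  then have "quad f1 f2 f3 f4 \<le> (\<Sum>g\<in>carrier G. l * (\<Sum>x\<in>carrier G. f1 x) * conv f3 f4 g)"
    unfolding quad_def using f3 f4 by (intro sum_mono mult_right_mono conv_nonneg) auto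
  then show ?thesis by (simp add: sum_distrib_left[symmetric] sum_conv mult_ac)
qed

lemma sum_mult_le_of_squares:
  fixes u w :: "'c \<Rightarrow> real"
  assumes "(\<Sum>x\<in>A. u x ^ 2) \<le> q" "(\<Sum>x\<in>A. w x ^ 2) \<le> q" "q \<ge> 0"
  shows "(\<Sum>x\<in>A. u x * w x) \<le> q"
proof (rule power2_le_imp_le)
  have "(\<Sum>x\<in>A. u x * w x)\<^sup>2 \<le> (\<Sum>x\<in>A. u x ^ 2) * (\<Sum>x\<in>A. w x ^ 2)"
    by (rule Cauchy_Schwarz_ineq_sum)
  also have "\<dots> \<le> q * q" using assms by (intro mult_mono) (auto intro: sum_nonneg)
  finally show "(\<Sum>x\<in>A. u x * w x)\<^sup>2 \<le> q\<^sup>2" by (simp add: power2_eq_square)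
qed fact

text \<open>This handles the large values of a measure, which have no useful pointwise bound but
  little total mass. Slots 2 and 4 are paired by Cauchy--Schwarz for each pair of translations, so
  that only the masses of slots 1 and 3 remain.\<close>

lemma quad_le_L2_1:
  assumes f1: "\<And>x. x \<in> carrier G \<Longrightarrow> 0 \<le> f1 x" and f3: "\<And>x. x \<in> carrier G \<Longrightarrow> 0 \<le> f3 x"
    and q: "(\<Sum>x\<in>carrier G. f2 x ^ 2) \<le> q" "(\<Sum>x\<in>carrier G. f4 x ^ 2) \<le> q" "q \<ge> 0"
  shows "quad f1 f2 f3 f4 \<le> (\<Sum>x\<in>carrier G. f1 x) * (\<Sum>x\<in>carrier G. f3 x) * q"
proof -
  have "quad f1 f2 f3 f4 = (\<Sum>g\<in>carrier G. \<Sum>x\<in>carrier G. \<Sum>z\<in>carrier G.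
      (f1 x * f2 (inv x \<otimes> g)) * (f3 z * f4 (inv z \<otimes> g)))"
    unfolding quad_def conv_def by (simp add: sum_product)
  also have "\<dots> = (\<Sum>x\<in>carrier G. \<Sum>g\<in>carrier G. \<Sum>z\<in>carrier G.
      (f1 x * f2 (inv x \<otimes> g)) * (f3 z * f4 (inv z \<otimes> g)))" by (rule sum.swap)
  also have "\<dots> = (\<Sum>x\<in>carrier G. \<Sum>z\<in>carrier G. \<Sum>g\<in>carrier G.
      (f1 x * f2 (inv x \<otimes> g)) * (f3 z * f4 (inv z \<otimes> g)))" by (rule sum.cong[OF refl], rule sum.swap)
  also have "\<dots> = (\<Sum>x\<in>carrier G. \<Sum>z\<in>carrier G. f1 x * f3 z *
      (\<Sum>g\<in>carrier G. f2 (inv x \<otimes> g) * f4 (inv z \<otimes> g)))"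
    by (simp add: sum_distrib_left mult_ac)
  also have "\<dots> \<le> (\<Sum>x\<in>carrier G. \<Sum>z\<in>carrier G. f1 x * f3 z * q)"
  proof (intro sum_mono mult_left_mono)
    fix x z assume xz: "x \<in> carrier G" "z \<in> carrier G"
    show "(\<Sum>g\<in>carrier G. f2 (inv x \<otimes> g) * f4 (inv z \<otimes> g)) \<le> q"
    proof (rule sum_mult_le_of_squares)
      show "(\<Sum>g\<in>carrier G. f2 (inv x \<otimes> g) ^ 2) \<le> q"
        using xz q sum_translate_left[of "inv x" "\<lambda>x. f2 x ^ 2"] by simp
      show "(\<Sum>g\<in>carrier G. f4 (inv z \<otimes> g) ^ 2) \<le> q"
        using xz q sum_translate_left[of "inv z" "\<lambda>x. f4 x ^ 2"] by simp
    qed (rule q(3))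
    show "0 \<le> f1 x * f3 z" using xz f1 f3 by simp
  qed
  also have "\<dots> = (\<Sum>x\<in>carrier G. f1 x) * (\<Sum>x\<in>carrier G. f3 x) * q"
    unfolding sum_product by (simp only: sum_distrib_right)
  finally show ?thesis .
qed

lemma quad_le_L2_2:
  assumes f2: "\<And>x. x \<in> carrier G \<Longrightarrow> 0 \<le> f2 x" and f4: "\<And>x. x \<in> carrier G \<Longrightarrow> 0 \<le> f4 x"
    and q: "(\<Sum>x\<in>carrier G. f1 x ^ 2) \<le> q" "(\<Sum>x\<in>carrier G. f3 x ^ 2) \<le> q" "q \<ge> 0"
  shows "quad f1 f2 f3 f4 \<le> (\<Sum>x\<in>carrier G. f2 x) * (\<Sum>x\<in>carrier G. f4 x) * q"
proof -
  have "quad f1 f2 f3 f4 = (\<Sum>g\<in>carrier G. \<Sum>x\<in>carrier G. \<Sum>z\<in>carrier G.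
      (f1 (g \<otimes> inv x) * f2 x) * (f3 (g \<otimes> inv z) * f4 z))"
    unfolding quad_def by (simp add: conv_alt sum_product)
  also have "\<dots> = (\<Sum>x\<in>carrier G. \<Sum>g\<in>carrier G. \<Sum>z\<in>carrier G.
      (f1 (g \<otimes> inv x) * f2 x) * (f3 (g \<otimes> inv z) * f4 z))" by (rule sum.swap)
  also have "\<dots> = (\<Sum>x\<in>carrier G. \<Sum>z\<in>carrier G. \<Sum>g\<in>carrier G.
      (f1 (g \<otimes> inv x) * f2 x) * (f3 (g \<otimes> inv z) * f4 z))" by (rule sum.cong[OF refl], rule sum.swap)
  also have "\<dots> = (\<Sum>x\<in>carrier G. \<Sum>z\<in>carrier G. f2 x * f4 z *
      (\<Sum>g\<in>carrier G. f1 (g \<otimes> inv x) * f3 (g \<otimes> inv z)))"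
    by (simp add: sum_distrib_left mult_ac)
  also have "\<dots> \<le> (\<Sum>x\<in>carrier G. \<Sum>z\<in>carrier G. f2 x * f4 z * q)"
  proof (intro sum_mono mult_left_mono)
    fix x z assume xz: "x \<in> carrier G" "z \<in> carrier G"
    show "(\<Sum>g\<in>carrier G. f1 (g \<otimes> inv x) * f3 (g \<otimes> inv z)) \<le> q"
    proof (rule sum_mult_le_of_squares)
      show "(\<Sum>g\<in>carrier G. f1 (g \<otimes> inv x) ^ 2) \<le> q"
        using xz q sum_translate_right[of "inv x" "\<lambda>x. f1 x ^ 2"] by simp
      show "(\<Sum>g\<in>carrier G. f3 (g \<otimes> inv z) ^ 2) \<le> q"
        using xz q sum_translate_right[of "inv z" "\<lambda>x. f3 x ^ 2"] by simp
    qed (rule q(3))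
    show "0 \<le> f2 x * f4 z" using xz f2 f4 by simp
  qed
  also have "\<dots> = (\<Sum>x\<in>carrier G. f2 x) * (\<Sum>x\<in>carrier G. f4 x) * q"
    unfolding sum_product by (simp only: sum_distrib_right)
  finally show ?thesis .
qed

lemma conv_indicator:
  assumes fin: "finite (carrier G)" and X: "X \<subseteq> carrier G" and inv: "\<And>x. x \<in> X \<Longrightarrow> inv x \<in> X"
    and g: "g \<in> carrier G"
  shows "conv (\<lambda>x. of_bool (x \<in> X)) (\<lambda>x. of_bool (x \<in> X)) g = real (quot_count X g)"
proof -
  have "conv (\<lambda>x. of_bool (x \<in> X)) (\<lambda>x. of_bool (x \<in> X)) g = real (card {x \<in> carrier G. x \<in> X \<and> inv x \<otimes> g \<in> X})"
  proof -
    have "of_bool (x \<in> X) * of_bool (y \<in> X) = (if x \<in> X \<and> y \<in> X then 1 else 0 :: real)" for x y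
      by simp
    then show ?thesis unfolding conv_def using fin by (simp add: sum.If_cases Int_def)
  qed
  also have "card {x \<in> carrier G. x \<in> X \<and> inv x \<otimes> g \<in> X} = quot_count X g"
    unfolding quot_count_def
  proof (rule bij_betw_same_card[of "\<lambda>x. (x, inv g \<otimes> x)"], rule bij_betw_byWitness[where f' = fst])
    have "inv g \<otimes> x \<in> X \<and> x \<otimes> inv (inv g \<otimes> x) = g" if "x \<in> X" "inv x \<otimes> g \<in> X" for x
    proof -
      have x: "x \<in> carrier G" using that X by auto
      have "inv (inv x \<otimes> g) = inv g \<otimes> x" using x g by (simp add: inv_mult_group)
      moreover have "x \<otimes> (inv x \<otimes> g) = g" using x g by (simp add: m_assoc[symmetric])
      ultimately show ?thesis using inv[OF that(2)] x g by (simp add: inv_mult_group)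
    qed
    then show "(\<lambda>x. (x, inv g \<otimes> x)) ` {x \<in> carrier G. x \<in> X \<and> inv x \<otimes> g \<in> X}
        \<subseteq> {(a, b) \<in> X \<times> X. a \<otimes> inv b = g}" by auto
    have *: "inv a \<otimes> (a \<otimes> inv b) = inv b" "inv (a \<otimes> inv b) \<otimes> a = b" if "a \<in> X" "b \<in> X" for a b
    proof -
      have "a \<in> carrier G" "b \<in> carrier G" using that X by auto
      then show "inv a \<otimes> (a \<otimes> inv b) = inv b" "inv (a \<otimes> inv b) \<otimes> a = b"
        by (simp_all add: m_assoc[symmetric] inv_mult_group) (simp add: m_assoc)
    qed
    show "fst ` {(a, b) \<in> X \<times> X. a \<otimes> inv b = g} \<subseteq> {x \<in> carrier G. x \<in> X \<and> inv x \<otimes> g \<in> X}"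
      using * X inv by auto
    show "\<forall>a'\<in>{(a, b) \<in> X \<times> X. a \<otimes> inv b = g}. (\<lambda>x. (x, inv g \<otimes> x)) (fst a') = a'"
      using * by auto
  qed auto
  finally show ?thesis .
qed


text \<open>
  Quadruples containing a value of \<open>\<nu>\<close> outside \<open>[q / (16 K), 16 K q]\<close> contribute at most half of the
  energy, so the energy is carried by the level set \<open>X\<close>.
\<close>

lemma rich_set_of_no_flattening:
  fixes \<nu> :: "'a \<Rightarrow> real" and K :: real
  defines "q \<equiv> \<Sum>g\<in>carrier G. \<nu> g ^ 2"
  assumes fin: "finite (carrier G)"
    and nonneg: "\<And>g. g \<in> carrier G \<Longrightarrow> 0 \<le> \<nu> g" and one: "(\<Sum>g\<in>carrier G. \<nu> g) = 1"
    and sym: "\<And>g. g \<in> carrier G \<Longrightarrow> \<nu> (inv g) = \<nu> g" and K: "K \<ge> 1"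
    and flat: "q / K \<le> (\<Sum>g\<in>carrier G. conv \<nu> \<nu> g ^ 2)"
  obtains X where "X \<subseteq> carrier G" "X \<noteq> {}" "\<And>g. g \<in> X \<Longrightarrow> q / (16 * K) \<le> \<nu> g"
    "real (card X) \<le> 16 * K / q" "1 \<le> 2 ^ 17 * K ^ 5 * (q * real (card X)) ^ 3"
    "1 \<le> 2 ^ 17 * K ^ 5 * q ^ 3 * (\<Sum>g\<in>carrier G. real (quot_count X g) ^ 2)" "q > 0"
proof -
  \<comment> \<open>Large values stay in \<open>X\<close>: its cardinality is bounded through the
    lower cutoff alone, and what is used of \<open>T\<close> is that \<open>M\<close> is at most
    \<open>T\<close> times the indicator of \<open>X\<close>.\<close>
  define X where "X = {g \<in> carrier G. q / (16 * K) \<le> \<nu> g}"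
  define T where "T = 16 * K * q"
  define M where "M g = (if q / (16 * K) \<le> \<nu> g \<and> \<nu> g \<le> T then \<nu> g else 0)" for g
  define Lo where "Lo g = (if \<nu> g < q / (16 * K) then \<nu> g else 0)" for g
  define Hi where "Hi g = (if \<nu> g > T then \<nu> g else 0)" for g
  define O' where "O' g = \<nu> g - M g" for g
  have K0: "K > 0" using K by simp
  have XG: "X \<subseteq> carrier G" by (auto simp: X_def)
  have X_inv: "inv x \<in> X" if "x \<in> X" for x using that sym by (simp add: X_def)
  have q0: "q > 0"
  proof -
    have "q \<ge> 0" unfolding q_def by (intro sum_nonneg) auto
    moreover have "q \<noteq> 0"
    proof
      assume "q = 0"
      then have "\<And>g. g \<in> carrier G \<Longrightarrow> \<nu> g = 0"
        unfolding q_def using fin by (subst (asm) sum_nonneg_eq_0_iff) auto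
      then show False using one by simp
    qed
    ultimately show ?thesis by simp
  qed
  have lt: "q / (16 * K) \<le> T"
  proof -
    have "q / (16 * K) \<le> q / 1" using K q0 by (intro divide_left_mono) auto
    also have "\<dots> \<le> T" using mult_right_mono[of 1 "16 * K" q] K q0 by (simp add: T_def)
    finally show ?thesis .
  qed
  have M: "0 \<le> M g \<and> M g \<le> \<nu> g" and O': "0 \<le> O' g \<and> O' g \<le> \<nu> g" and O'_le: "O' g \<le> Lo g + Hi g"
    and Lo: "0 \<le> Lo g \<and> Lo g \<le> q / (16 * K)" and Hi: "0 \<le> Hi g" and Hi': "T * Hi g \<le> \<nu> g ^ 2"
    if "g \<in> carrier G" for g
    using nonneg[OF that] lt q0 K0 mult_right_mono[of T "\<nu> g" "\<nu> g"]
    by (auto simp: M_def O'_def Lo_def Hi_def power2_eq_square)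
  have sumHi: "(\<Sum>g\<in>carrier G. Hi g) \<le> 1 / (16 * K)"
  proof -
    have "T * (\<Sum>g\<in>carrier G. Hi g) \<le> q"
      unfolding q_def sum_distrib_left using Hi' by (intro sum_mono)
    then show ?thesis using q0 K0 by (simp add: T_def field_simps)
  qed
  have nu: "\<nu> = (\<lambda>g. M g + O' g)" by (simp add: O'_def)
  have qsum: "(\<Sum>g\<in>carrier G. \<nu> g ^ 2) \<le> q" by (simp add: q_def)
  \<comment> \<open>The low part costs its supremum q / (16 K). The high part has mass at most q / T
    = 1 / (16 K) and costs that times q. The four slots together lose 4 * q / (8 K), half of q /
    K.\<close>
  have Ob1: "quad O' \<nu> \<nu> \<nu> \<le> q / (8 * K)"
  proof -
    have "quad O' \<nu> \<nu> \<nu> \<le> quad (\<lambda>g. Lo g + Hi g) \<nu> \<nu> \<nu>"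
      using O' O'_le nonneg by (intro quad_mono) auto
    also have "\<dots> = quad Lo \<nu> \<nu> \<nu> + quad Hi \<nu> \<nu> \<nu>" by (rule quad_add1)
    also have "quad Lo \<nu> \<nu> \<nu> \<le> q / (16 * K)"
      using quad_le_Sup1[of Lo "q / (16 * K)" \<nu> \<nu> \<nu>] Lo nonneg one by simp
    also have "quad Hi \<nu> \<nu> \<nu> \<le> (\<Sum>g\<in>carrier G. Hi g) * 1 * q"
      using quad_le_L2_1[of Hi \<nu> \<nu> q \<nu>] Hi nonneg one qsum q0 by simp
    also have "\<dots> \<le> 1 / (16 * K) * 1 * q" using sumHi q0 by (intro mult_right_mono) auto
    finally show ?thesis by (simp add: field_simps)
  qed
  have Ob2: "quad \<nu> O' \<nu> \<nu> \<le> q / (8 * K)"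
  proof -
    have "quad \<nu> O' \<nu> \<nu> \<le> quad \<nu> (\<lambda>g. Lo g + Hi g) \<nu> \<nu>"
      using O' O'_le nonneg by (intro quad_mono) auto
    also have "\<dots> = quad \<nu> Lo \<nu> \<nu> + quad \<nu> Hi \<nu> \<nu>" by (rule quad_add2)
    also have "quad \<nu> Lo \<nu> \<nu> \<le> q / (16 * K)"
      using quad_le_Sup2[of \<nu> Lo "q / (16 * K)" \<nu> \<nu>] Lo nonneg one by simp
    also have "quad \<nu> Hi \<nu> \<nu> \<le> (\<Sum>g\<in>carrier G. Hi g) * 1 * q"
      using quad_le_L2_2[of Hi \<nu> \<nu> q \<nu>] Hi nonneg one qsum q0 by simp
    also have "\<dots> \<le> 1 / (16 * K) * 1 * q" using sumHi q0 by (intro mult_right_mono) auto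
    finally show ?thesis by (simp add: field_simps)
  qed
  have "q / K \<le> quad \<nu> \<nu> \<nu> \<nu>" using flat by (simp add: quad_def power2_eq_square)
  also have "\<dots> = quad M \<nu> \<nu> \<nu> + quad O' \<nu> \<nu> \<nu>" by (subst (1) nu) (rule quad_add1)
  also have "quad M \<nu> \<nu> \<nu> = quad M M \<nu> \<nu> + quad M O' \<nu> \<nu>" by (subst (1) nu) (rule quad_add2)
  also have "quad M M \<nu> \<nu> = quad M M M \<nu> + quad M M O' \<nu>" by (subst (1) nu) (rule quad_add3)
  also have "quad M M M \<nu> = quad M M M M + quad M M M O'" by (subst (1) nu) (rule quad_add4)
  also have "quad M O' \<nu> \<nu> \<le> quad \<nu> O' \<nu> \<nu>" using M O' nonneg by (intro quad_mono) auto
  also have "quad M M O' \<nu> \<le> quad \<nu> \<nu> O' \<nu>" using M O' nonneg by (intro quad_mono) auto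
  also have "\<dots> = quad O' \<nu> \<nu> \<nu>" by (rule quad_commute)
  also have "quad M M M O' \<le> quad \<nu> \<nu> \<nu> O'" using M O' nonneg by (intro quad_mono) auto
  also have "\<dots> = quad \<nu> O' \<nu> \<nu>" by (rule quad_commute)
  finally have "q / K \<le> quad M M M M + q / (8 * K) + q / (8 * K) + q / (8 * K) + q / (8 * K)"
    using Ob1 Ob2 by linarith
  then have "q / (2 * K) \<le> quad M M M M" by (simp add: field_simps)
  also have "\<dots> \<le> quad (\<lambda>x. T * of_bool (x \<in> X)) (\<lambda>x. T * of_bool (x \<in> X))
      (\<lambda>x. T * of_bool (x \<in> X)) (\<lambda>x. T * of_bool (x \<in> X))"
  proof -
    have "0 \<le> M g \<and> M g \<le> T * of_bool (g \<in> X)" if "g \<in> carrier G" for g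
      using that nonneg[OF that] q0 K0 by (auto simp: M_def X_def T_def)
    then show ?thesis by (intro quad_mono)
  qed
  also have "\<dots> = T ^ 4 * (\<Sum>g\<in>carrier G. conv (\<lambda>x. of_bool (x \<in> X)) (\<lambda>x. of_bool (x \<in> X)) g ^ 2)"
    by (simp add: quad_def conv_def sum_distrib_left power_numeral_reduce mult_ac sum_product)
  also have "\<dots> = T ^ 4 * (\<Sum>g\<in>carrier G. real (quot_count X g) ^ 2)"
    by (intro arg_cong2[of _ _ _ _ "(*)"] refl sum.cong) (simp add: conv_indicator[OF fin XG X_inv])
  finally have main: "q / (2 * K) \<le> T ^ 4 * (\<Sum>g\<in>carrier G. real (quot_count X g) ^ 2)" .
  define E where "E = (\<Sum>g\<in>carrier G. real (quot_count X g) ^ 2)"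
  have finX: "finite X" using fin XG finite_subset by blast
  have "q * 1 \<le> 2 * K * (T ^ 4 * E)"
    using main K0 unfolding E_def[symmetric] by (simp add: pos_divide_le_eq mult_ac)
  also have "\<dots> = q * (2 ^ 17 * K ^ 5 * q ^ 3 * E)" 
    using power_Suc[of K 4] power_Suc[of q 3] by (simp add: T_def power_mult_distrib)
  finally have "q * 1 \<le> q * (2 ^ 17 * K ^ 5 * q ^ 3 * E)" .
  then have E1: "1 \<le> 2 ^ 17 * K ^ 5 * q ^ 3 * E" using q0 by (rule mult_left_le_imp_le)
  have cardX: "real (card X) \<le> 16 * K / q"
  proof -
    have "q / (16 * K) * real (card X) = (\<Sum>g\<in>X. q / (16 * K))" by simp
    also have "\<dots> \<le> (\<Sum>g\<in>X. \<nu> g)" by (intro sum_mono) (simp add: X_def)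
    also have "\<dots> \<le> 1" unfolding one[symmetric] using fin nonneg by (intro sum_mono2 XG) auto
    finally show ?thesis using q0 K0 by (simp add: field_simps)
  qed
  have "E \<le> real (card X) ^ 3"
  proof -
    have "E \<le> (\<Sum>g\<in>carrier G. real (card X) * real (quot_count X g))"
      unfolding E_def power2_eq_square using quot_count_le[OF finX XG]
      by (intro sum_mono mult_right_mono) auto
    also have "\<dots> = real (card X) * real (\<Sum>g\<in>carrier G. quot_count X g)"
      by (simp add: sum_distrib_left)
    also have "\<dots> = real (card X) ^ 3"
      unfolding sum_quot_count[OF finX XG fin] by (simp add: power2_eq_square power3_eq_cube)
    finally show ?thesis .
  qed
  then have "2 ^ 17 * K ^ 5 * q ^ 3 * E \<le> 2 ^ 17 * K ^ 5 * q ^ 3 * real (card X) ^ 3"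
    using K0 q0 by (intro mult_left_mono) auto
  with E1 have E2: "1 \<le> 2 ^ 17 * K ^ 5 * (q * real (card X)) ^ 3"
    by (simp add: power_mult_distrib mult_ac)
  then have "X \<noteq> {}" by auto
  moreover have "q / (16 * K) \<le> \<nu> g" if "g \<in> X" for g using that by (simp add: X_def)
  ultimately show thesis using that[of X] XG cardX E1 E2 q0 unfolding E_def by blast
qed


lemma setpow_one:
  assumes "H \<subseteq> carrier G"
  shows "setpow H (Suc 0) = H"
  using assms by (force simp: subset_iff)

text \<open>\<open>P\<close> consists of the popular left quotients of the set \<open>Y\<close>
  found by Balog--Szemeredi--Gowers inside the level set \<open>X\<close>. The coset of
  \<open>P\<close> is heavy because it contains a large part of \<open>Y\<close>, where
  \<open>\<nu>\<close> is at least q / (16 K). Since K is at least 2, all numerical constants are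
  absorbed into powers of K; the final exponents are rounded up. Powers up to 20 are those that
  Helfgott's theorem inspects.\<close>

theorem approximate_subgroup_of_no_flattening:
  fixes \<nu> :: "'a \<Rightarrow> real" and K :: real
  defines "q \<equiv> \<Sum>g\<in>carrier G. \<nu> g ^ 2"
  assumes fin: "finite (carrier G)"
    and nonneg: "\<And>g. g \<in> carrier G \<Longrightarrow> 0 \<le> \<nu> g" and one: "(\<Sum>g\<in>carrier G. \<nu> g) = 1"
    and sym: "\<And>g. g \<in> carrier G \<Longrightarrow> \<nu> (inv g) = \<nu> g" and K: "K \<ge> 2"
    and flat: "q / K \<le> (\<Sum>g\<in>carrier G. conv \<nu> \<nu> g ^ 2)"
  obtains P c where "P \<subseteq> carrier G" "\<one> \<in> P" "\<And>g. g \<in> P \<Longrightarrow> inv g \<in> P" "c \<in> carrier G"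
    "1 \<le> K ^ 500 * (\<Sum>g | g \<in> carrier G \<and> inv c \<otimes> g \<in> P. \<nu> g)"
    "real (card P) \<le> K ^ 2000 / q"
    "\<And>n. n \<le> 20 \<Longrightarrow> real (card (setpow P n)) \<le> K ^ 20000 * real (card P)"
proof -
  have K1: "K \<ge> 1" and K0: "K > 0" using K by auto
  obtain X where X: "X \<subseteq> carrier G" "X \<noteq> {}" and Xnu: "\<And>g. g \<in> X \<Longrightarrow> q / (16 * K) \<le> \<nu> g"
    and cardX: "real (card X) \<le> 16 * K / q" and X1: "1 \<le> 2 ^ 17 * K ^ 5 * (q * real (card X)) ^ 3"
    and XE: "1 \<le> 2 ^ 17 * K ^ 5 * q ^ 3 * (\<Sum>g\<in>carrier G. real (quot_count X g) ^ 2)"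
    and q0: "q > 0"
    using rich_set_of_no_flattening[OF fin nonneg one sym K1] flat unfolding q_def by blast
  define E where "E = (\<Sum>g\<in>carrier G. real (quot_count X g) ^ 2)"
  have E0: "E \<ge> 0" unfolding E_def by (intro sum_nonneg) auto
  have two: "2 ^ n \<le> K ^ n" for n using K by (intro power_mono) auto
  have K5: "K ^ 4 * K = K ^ 5" by (simp add: power_numeral_reduce)
  have finX: "finite X" using fin X finite_subset by blast
  \<comment> \<open>The energy loss is 2^12 K^3 * 2^17 K^5 = 2^29 K^8, at most K^37.\<close>
  have "real (card X) ^ 3 / K ^ 37 \<le> E"
  proof -
    have "real (card X) ^ 3 \<le> (16 * K / q) ^ 3" using cardX by (intro power_mono) auto
    also have "\<dots> = 2 ^ 12 * K ^ 3 / q ^ 3 * 1" by (simp add: power_divide power_mult_distrib)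
    also have "\<dots> \<le> 2 ^ 12 * K ^ 3 / q ^ 3 * (2 ^ 17 * K ^ 5 * q ^ 3 * E)"
      using XE K0 q0 unfolding E_def[symmetric] by (intro mult_left_mono) auto
    also have "\<dots> = 2 ^ 29 * K ^ 8 * E" using q0 by (simp add: field_simps power_numeral_reduce)
    also have "\<dots> \<le> K ^ 29 * K ^ 8 * E" using two[of 29] K0 E0 by (intro mult_right_mono) auto
    finally show ?thesis using K0 by (simp add: field_simps flip: power_add)
  qed
  moreover have "1 \<le> K ^ 37" using K1 by simp
  ultimately obtain Y where Y: "Y \<subseteq> X" and XY: "real (card X) \<le> 4 * K ^ 37 * real (card Y)"
    and quotsY: "real (card (quots Y)) \<le> 2 ^ 23 * (K ^ 37) ^ 10 * real (card Y)"
    using balog_szemeredi_gowers[OF fin X, of "K ^ 37"] unfolding E_def by blast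
  \<comment> \<open>393 = 23 + 37 * 10, from 2^23 (K^37)^10 in \<open>quotsY\<close>.\<close>
  define L where "L = K ^ 393"
  have L1: "L \<ge> 1" using K1 by (simp add: L_def)
  have "2 ^ 23 * (K ^ 37) ^ 10 \<le> L"
  proof -
    have "2 ^ 23 * (K ^ 37) ^ 10 \<le> K ^ 23 * (K ^ 37) ^ 10"
      using two[of 23] K0 by (intro mult_right_mono) auto
    also have "\<dots> = L" by (simp add: L_def flip: power_mult power_add)
    finally show ?thesis .
  qed
  then have small: "real (card (quots Y)) \<le> L * real (card Y)"
    by (rule order_trans[OF quotsY mult_right_mono]) simp
  have XY': "real (card X) \<le> K ^ 39 * real (card Y)"
  proof -
    have "4 * K ^ 37 \<le> K ^ 2 * K ^ 37" using two[of 2] K0 by (intro mult_right_mono) auto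
    then have "4 * K ^ 37 \<le> K ^ 39" by (simp flip: power_add)
    then show ?thesis by (rule order_trans[OF XY mult_right_mono]) simp
  qed
  have YG: "Y \<subseteq> carrier G" using Y X by auto
  have finY: "finite Y" using finX Y finite_subset by blast
  have "Y \<noteq> {}" using XY X finX K0 by (auto simp: card_eq_0_iff)
  note Yne = this
  define y where "y = real (card Y)"
  have y0: "y > 0" using Yne finY by (simp add: y_def card_gt_0_iff)
  define P where "P = popular_quots Y L"
  have PG: "P \<subseteq> carrier G" by (auto simp: P_def popular_quots_def)
  have finP: "finite P" using PG fin finite_subset by blast
  obtain c where c: "c \<in> Y" and cP: "y / (2 * L) \<le> real (card {a \<in> Y. inv c \<otimes> a \<in> P})"
    using popular_quots_coset[OF fin YG Yne L1 small] unfolding P_def y_def by blast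
  have cG: "c \<in> carrier G" using c YG by auto
  have L2: "2 * L \<le> K ^ 394"
  proof -
    have "2 * L \<le> K * L" using K L1 by (intro mult_right_mono) auto
    then show ?thesis using power_Suc[of K 393] by (simp add: L_def)
  qed
  have yL: "y \<le> K ^ 394 * real (card {a \<in> Y. inv c \<otimes> a \<in> P})"
  proof -
    have "y \<le> 2 * L * real (card {a \<in> Y. inv c \<otimes> a \<in> P})" using cP L1 by (simp add: field_simps)
    also have "\<dots> \<le> K ^ 394 * real (card {a \<in> Y. inv c \<otimes> a \<in> P})" using L2 by (intro mult_right_mono) auto
    finally show ?thesis .
  qed
  have cardP: "y \<le> K ^ 394 * real (card P)"
  proof -
    have "card {a \<in> Y. inv c \<otimes> a \<in> P} \<le> card P"
      by (rule card_inj_on_le[where f = "\<lambda>a. inv c \<otimes> a"])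
        (use YG cG finP in \<open>auto simp: inj_on_def subset_iff\<close>)
    then have "K ^ 394 * real (card {a \<in> Y. inv c \<otimes> a \<in> P}) \<le> K ^ 394 * real (card P)"
      using K0 by (intro mult_left_mono) auto
    with yL show ?thesis by linarith
  qed
  have pow: "real (card (setpow P n)) \<le> K ^ (393 + 787 * n) * y" for n
  proof -
    have "real (card (setpow P n)) \<le> L * (2 * L\<^sup>2) ^ n * y"
      unfolding P_def y_def by (rule card_setpow_popular_quots[OF fin YG Yne L1 small])
    also have "\<dots> \<le> L * (K * L\<^sup>2) ^ n * y"
      using K L1 y0 by (intro mult_right_mono mult_left_mono power_mono) auto
    also have "K * L\<^sup>2 = K ^ 787" using power_Suc[of K 786] by (simp add: L_def flip: power_mult)
    also have "L * (K ^ 787) ^ n = K ^ (393 + 787 * n)" by (simp add: L_def power_add power_mult)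
    finally show ?thesis .
  qed
  show thesis
  proof (rule that[of P c])
    show "P \<subseteq> carrier G" "c \<in> carrier G" by fact+
    show "\<one> \<in> P" unfolding P_def by (rule one_popular_quots[OF finY YG L1])
    show "inv g \<in> P" if "g \<in> P" for g
      using inv_popular_quots[OF YG] that unfolding P_def by blast
    show "real (card (setpow P n)) \<le> K ^ 20000 * real (card P)" if "n \<le> 20" for n
    proof -
      have "real (card (setpow P n)) \<le> K ^ (393 + 787 * n) * (K ^ 394 * real (card P))"
        by (rule order_trans[OF pow mult_left_mono[OF cardP]]) (use K0 in simp)
      also have "\<dots> = K ^ (787 + 787 * n) * real (card P)" by (simp add: power_add)
      also have "\<dots> \<le> K ^ 20000 * real (card P)"
        using that by (intro mult_right_mono power_increasing K1) auto
      finally show ?thesis .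
    qed
    show "real (card P) \<le> K ^ 2000 / q"
    proof -
      have "real (card P) \<le> K ^ 1180 * y" using pow[of 1] setpow_one[OF PG] by simp
      also have "y \<le> real (card X)" unfolding y_def using Y finX by (simp add: card_mono)
      also have "real (card X) \<le> 16 * K / q" by fact
      also have "K ^ 1180 * (16 * K / q) \<le> K ^ 1180 * (K ^ 4 * K / q)"
        using two[of 4] K0 q0 by (intro mult_left_mono divide_right_mono mult_right_mono) auto
      also have "\<dots> = K ^ 1185 / q" using K5 by (simp flip: power_add)
      also have "\<dots> \<le> K ^ 2000 / q"
        using q0 K1 by (intro divide_right_mono power_increasing) auto
      finally show ?thesis using K0 by (simp add: mult_left_mono)
    qed
    show "1 \<le> K ^ 500 * (\<Sum>g | g \<in> carrier G \<and> inv c \<otimes> g \<in> P. \<nu> g)"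
    proof -
      let ?s = "\<Sum>g | g \<in> carrier G \<and> inv c \<otimes> g \<in> P. \<nu> g"
      have qX: "1 \<le> K ^ 8 * (q * real (card X))"
      proof -
        have "2 ^ 17 * K ^ 5 * (q * real (card X)) ^ 3 \<le> K ^ 17 * K ^ 5 * (q * real (card X)) ^ 3"
          using two[of 17] K0 q0 by (intro mult_right_mono) auto
        also have "K ^ 17 * K ^ 5 = K ^ 22" by (simp flip: power_add)
        also have "K ^ 22 * (q * real (card X)) ^ 3 \<le> K ^ 24 * (q * real (card X)) ^ 3"
          using K1 q0 by (intro mult_right_mono power_increasing) auto
        also have "\<dots> = (K ^ 8 * (q * real (card X))) ^ 3"
          by (simp add: power_mult_distrib flip: power_mult)
        finally have "1 ^ 3 \<le> (K ^ 8 * (q * real (card X))) ^ 3"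
          unfolding power_one using X1 by linarith
        then show ?thesis
          by (subst (asm) power_mono_iff) (use K0 q0 in auto)
      qed
      let ?Z = "{a \<in> Y. inv c \<otimes> a \<in> P}"
      have "q / (16 * K) * real (card ?Z) = (\<Sum>g\<in>?Z. q / (16 * K))" by simp
      also have "\<dots> \<le> (\<Sum>g\<in>?Z. \<nu> g)" using Y Xnu by (intro sum_mono) auto
      also have "\<dots> \<le> ?s" using fin YG nonneg by (intro sum_mono2) auto
      finally have Z: "q / (16 * K) * real (card ?Z) \<le> ?s" .
      have s0: "?s \<ge> 0" using nonneg by (intro sum_nonneg) auto
      have "1 \<le> K ^ 8 * (q * real (card X))" by (rule qX)
      also have "\<dots> \<le> K ^ 8 * (q * (K ^ 39 * y))"
        using XY' K0 q0 unfolding y_def by (intro mult_left_mono) auto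
      also have "\<dots> \<le> K ^ 8 * (q * (K ^ 39 * (K ^ 394 * real (card ?Z))))"
        using yL K0 q0 by (intro mult_left_mono) auto
      also have "\<dots> = K ^ 441 * (16 * K) * (q / (16 * K) * real (card ?Z))"
        using K0 by (simp flip: power_add)
      also have "\<dots> \<le> K ^ 441 * (16 * K) * ?s" using Z K0 by (intro mult_left_mono) auto
      also have "\<dots> \<le> K ^ 441 * (K ^ 4 * K) * ?s"
        using two[of 4] K0 s0 by (intro mult_right_mono mult_left_mono) auto
      also have "\<dots> = K ^ 446 * ?s" using K5 by (simp flip: power_add)
      also have "\<dots> \<le> K ^ 500 * ?s" using s0 by (intro mult_right_mono power_increasing K1) auto
      finally show ?thesis .
    qed
  qed
qed

section \<open>Product sets and generation\<close>

lemma setpow_add: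
  assumes H: "H \<subseteq> carrier G" and "a \<in> setpow H m" "b \<in> setpow H n"
  shows "a \<otimes> b \<in> setpow H (m + n)"
  using assms(2)
proof (induction m arbitrary: a)
  case 0
  then show ?case using assms(3) setpow_carrier[OF H, of n] by auto
next
  case (Suc m)
  then obtain h k where hk: "h \<in> H" "k \<in> setpow H m" "a = h \<otimes> k" by auto
  have "k \<in> carrier G" "b \<in> carrier G" "h \<in> carrier G"
    using hk assms(3) setpow_carrier[OF H] H by auto
  then have "a \<otimes> b = h \<otimes> (k \<otimes> b)" using hk by (simp add: m_assoc)
  then show ?case using Suc.IH[OF hk(2)] hk(1) by auto
qed

lemma setpow_inv:
  assumes H: "H \<subseteq> carrier G" "\<And>h. h \<in> H \<Longrightarrow> inv h \<in> H" and "a \<in> setpow H n"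
  shows "inv a \<in> setpow H n"
  using assms(3)
proof (induction n arbitrary: a)
  case (Suc n)
  then obtain h k where hk: "h \<in> H" "k \<in> setpow H n" "a = h \<otimes> k" by auto
  have c: "k \<in> carrier G" "h \<in> carrier G" using hk setpow_carrier[OF H(1)] H by auto
  have "inv h \<in> setpow H (Suc 0)" using H hk setpow_one[OF H(1)] by blast
  then have "inv k \<otimes> inv h \<in> setpow H (n + Suc 0)"
    using Suc.IH[OF hk(2)] by (intro setpow_add H) auto
  then show ?case using c hk by (simp add: inv_mult_group)
qed simp

lemma setpow_mono:
  assumes H: "H \<subseteq> carrier G" "\<one> \<in> H" and "m \<le> n"
  shows "setpow H m \<subseteq> setpow H n"
proof -
  have "setpow H n \<subseteq> setpow H (Suc n)" for n
  proof
    fix a assume a: "a \<in> setpow H n"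
    then have "a \<in> carrier G" using setpow_carrier[OF H(1)] by auto
    then have "a = \<one> \<otimes> a" by simp
    then show "a \<in> setpow H (Suc n)" using a H(2) by auto
  qed
  then show ?thesis by (rule lift_Suc_mono_le) fact
qed

text \<open>As H is closed under inverses, every group element is a word in H, and a property stable
  under left multiplication by H propagates along words.\<close>

lemma generating_induct [consumes 4, case_names one step]:
  assumes H: "H \<subseteq> carrier G" "\<And>h. h \<in> H \<Longrightarrow> inv h \<in> H"
    and gen: "\<And>L. subgroup L G \<Longrightarrow> H \<subseteq> L \<Longrightarrow> L = carrier G"
    and g: "g \<in> carrier G" and one: "P \<one>"
    and step: "\<And>h g. h \<in> H \<Longrightarrow> g \<in> carrier G \<Longrightarrow> P g \<Longrightarrow> P (h \<otimes> g)"
  shows "P g"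
proof -
  have "generate G H = carrier G"
    using H(1) by (intro gen generate_is_subgroup) (auto intro: generate.incl)
  \<comment> \<open>The claim says that left multiplication by x preserves \<open>P\<close>, because
    in this form it passes to products.\<close>
  moreover have "\<forall>k\<in>carrier G. P k \<longrightarrow> P (x \<otimes> k)" if "x \<in> generate G H" for x
    using that
  proof (induction x rule: generate.induct)
    case (eng x y)
    have "x \<in> carrier G" "y \<in> carrier G"
      using eng generate_in_carrier[OF H(1)] by auto
    then show ?case using eng.IH by (simp add: m_assoc)
  qed (use step H in auto)
  ultimately have "P (g \<otimes> \<one>)" using g one by blast
  then show ?thesis using g by simp
qed

lemma sum_conv_mult:
  fixes f :: "'a \<Rightarrow> real"
  shows "(\<Sum>g\<in>carrier G. conv f f g * h g) = (\<Sum>x\<in>carrier G. \<Sum>y\<in>carrier G. f x * f y * h (x \<otimes> y))"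
proof -
  have "(\<Sum>g\<in>carrier G. conv f f g * h g) =
      (\<Sum>g\<in>carrier G. \<Sum>x\<in>carrier G. f x * f (inv x \<otimes> g) * h g)"
    by (simp add: conv_def sum_distrib_right)
  also have "\<dots> = (\<Sum>x\<in>carrier G. \<Sum>g\<in>carrier G. f x * f (inv x \<otimes> g) * h g)" by (rule sum.swap)
  also have "\<dots> = (\<Sum>x\<in>carrier G. \<Sum>y\<in>carrier G. f x * f y * h (x \<otimes> y))"
  proof (rule sum.cong[OF refl])
    fix x assume x: "x \<in> carrier G"
    have "(\<Sum>g\<in>carrier G. f x * f (inv x \<otimes> g) * h g) =
        (\<Sum>y\<in>carrier G. f x * f (inv x \<otimes> (x \<otimes> y)) * h (x \<otimes> y))"
      by (rule sum_translate_left[OF x, symmetric])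
    also have "\<dots> = (\<Sum>y\<in>carrier G. f x * f y * h (x \<otimes> y))"
      using x by (intro sum.cong refl) (simp add: m_assoc[symmetric])
    finally show "(\<Sum>g\<in>carrier G. f x * f (inv x \<otimes> g) * h g) = (\<Sum>y\<in>carrier G. f x * f y * h (x \<otimes> y))" .
  qed
  finally show ?thesis .
qed

section \<open>Coset masses and the symmetrized measure\<close>

definition coset_mass :: "('a \<Rightarrow> real) \<Rightarrow> 'a set \<Rightarrow> 'a \<Rightarrow> real" where
  "coset_mass f P c = (\<Sum>g | g \<in> carrier G \<and> inv c \<otimes> g \<in> P. f g)"

lemma coset_mass_alt:
  assumes "finite (carrier G)"
  shows "coset_mass f P c = (\<Sum>g\<in>carrier G. if inv c \<otimes> g \<in> P then f g else 0)"
  unfolding coset_mass_def using assms by (simp add: sum.If_cases Int_def)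

text \<open>The mass that a convolution gives to c P is an average, weighted by f, of the masses
  that h gives to the cosets x^-1 c P. So the largest coset mass does not increase under
  convolution, and a coset heavy for a high power reveals one heavy for the original
  measure.\<close>

lemma coset_mass_conv:
  assumes fin: "finite (carrier G)" and f: "\<And>x. x \<in> carrier G \<Longrightarrow> 0 \<le> f x" "(\<Sum>x\<in>carrier G. f x) = 1"
    and h: "\<And>c. c \<in> carrier G \<Longrightarrow> coset_mass h P c \<le> B" and c: "c \<in> carrier G"
  shows "coset_mass (conv f h) P c \<le> B"
proof -
  have "coset_mass (conv f h) P c =
      (\<Sum>g\<in>carrier G. \<Sum>x\<in>carrier G. f x * (if inv c \<otimes> g \<in> P then h (inv x \<otimes> g) else 0))"
    unfolding coset_mass_alt[OF fin] by (intro sum.cong refl) (simp add: conv_def)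
  also have "\<dots> = (\<Sum>x\<in>carrier G. \<Sum>g\<in>carrier G. f x * (if inv c \<otimes> g \<in> P then h (inv x \<otimes> g) else 0))"
    by (rule sum.swap)
  also have "\<dots> = (\<Sum>x\<in>carrier G. f x * coset_mass h P (inv x \<otimes> c))"
  proof (rule sum.cong[OF refl])
    fix x assume x: "x \<in> carrier G"
    have "(\<Sum>g\<in>carrier G. f x * (if inv c \<otimes> g \<in> P then h (inv x \<otimes> g) else 0)) =
        (\<Sum>g\<in>carrier G. f x * (if inv c \<otimes> (x \<otimes> g) \<in> P then h (inv x \<otimes> (x \<otimes> g)) else 0))"
      by (rule sum_translate_left[OF x, symmetric])
    also have "\<dots> = (\<Sum>g\<in>carrier G. f x * (if inv (inv x \<otimes> c) \<otimes> g \<in> P then h g else 0))"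
    proof (rule sum.cong[OF refl])
      fix g assume g: "g \<in> carrier G"
      have "inv x \<otimes> (x \<otimes> g) = g" using x g by (simp add: m_assoc[symmetric])
      moreover have "inv c \<otimes> (x \<otimes> g) = inv (inv x \<otimes> c) \<otimes> g"
        using x g c by (simp add: m_assoc inv_mult_group)
      ultimately show "f x * (if inv c \<otimes> (x \<otimes> g) \<in> P then h (inv x \<otimes> (x \<otimes> g)) else 0) =
          f x * (if inv (inv x \<otimes> c) \<otimes> g \<in> P then h g else 0)" by simp
    qed
    finally show "(\<Sum>g\<in>carrier G. f x * (if inv c \<otimes> g \<in> P then h (inv x \<otimes> g) else 0)) =
        f x * coset_mass h P (inv x \<otimes> c)"
      unfolding coset_mass_alt[OF fin] sum_distrib_left .
  qed
  also have "\<dots> \<le> (\<Sum>x\<in>carrier G. f x * B)"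
    using f c by (intro sum_mono mult_left_mono h) auto
  also have "\<dots> = B" by (simp add: f(2) flip: sum_distrib_right)
  finally show ?thesis .
qed

text \<open>This is the law of s^-1 t for independent uniform s and t in U. It is symmetric even if
  U is not, as the energy arguments require.\<close>

definition sym_mean :: "'a set \<Rightarrow> 'a \<Rightarrow> real" where
  "sym_mean U g = real (lquot_count U g) / real (card U) ^ 2"

lemma sym_mean_sum:
  assumes fin: "finite (carrier G)" and U: "U \<subseteq> carrier G"
  shows "(\<Sum>g\<in>carrier G. sym_mean U g * h g) =
    (\<Sum>s\<in>U. \<Sum>t\<in>U. h (inv s \<otimes> t)) / real (card U) ^ 2"
proof -
  have finU: "finite U" using fin U finite_subset by blast
  have "(\<Sum>g\<in>carrier G. real (lquot_count U g) * h g) =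
      (\<Sum>g\<in>carrier G. \<Sum>w\<in>{w \<in> U \<times> U. inv (fst w) \<otimes> snd w = g}. h (inv (fst w) \<otimes> snd w))"
  proof (rule sum.cong[OF refl])
    fix g
    have "lquot_count U g = card {w \<in> U \<times> U. inv (fst w) \<otimes> snd w = g}"
      unfolding lquot_count_def by (rule arg_cong[of _ _ card]) auto
    then show "real (lquot_count U g) * h g =
        (\<Sum>w\<in>{w \<in> U \<times> U. inv (fst w) \<otimes> snd w = g}. h (inv (fst w) \<otimes> snd w))" by simp
  qed
  also have "\<dots> = (\<Sum>w\<in>U \<times> U. h (inv (fst w) \<otimes> snd w))"
    by (rule sum.group) (use fin finU U in \<open>auto simp: subset_iff\<close>)
  also have "\<dots> = (\<Sum>s\<in>U. \<Sum>t\<in>U. h (inv s \<otimes> t))" by (simp add: sum.cartesian_product split_def)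
  finally show ?thesis by (simp add: sym_mean_def flip: sum_divide_distrib)
qed

lemma sym_mean_props:
  assumes fin: "finite (carrier G)" and U: "U \<subseteq> carrier G" "U \<noteq> {}"
  shows "0 \<le> sym_mean U g" "(\<Sum>g\<in>carrier G. sym_mean U g) = 1"
    "g \<in> carrier G \<Longrightarrow> sym_mean U (inv g) = sym_mean U g"
    "(\<Sum>g\<in>carrier G. sym_mean U g ^ 2) \<le> 1 / real (card U)"
proof -
  have finU: "finite U" using fin U finite_subset by blast
  have u: "real (card U) > 0" using U finU by (simp add: card_gt_0_iff)
  show "0 \<le> sym_mean U g" by (simp add: sym_mean_def)
  show one: "(\<Sum>g\<in>carrier G. sym_mean U g) = 1"
    using sym_mean_sum[OF fin U(1), of "\<lambda>_. 1"] u by (simp add: power2_eq_square)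
  show "sym_mean U (inv g) = sym_mean U g" if "g \<in> carrier G"
    using lquot_count_inv[OF U(1) that] by (simp add: sym_mean_def)
  have "(\<Sum>g\<in>carrier G. sym_mean U g ^ 2) \<le> (\<Sum>g\<in>carrier G. sym_mean U g * (1 / real (card U)))"
    unfolding power2_eq_square
  proof (intro sum_mono mult_left_mono)
    fix g assume "g \<in> carrier G"
    then have "real (lquot_count U g) \<le> real (card U)" using lquot_count_le[OF finU U(1)] by simp
    then show "sym_mean U g \<le> 1 / real (card U)"
      using u by (simp add: sym_mean_def field_simps power2_eq_square)
  qed (simp add: sym_mean_def)
  also have "\<dots> = 1 / real (card U)" by (simp only: sum_distrib_right[symmetric] one mult_1)
  finally show "(\<Sum>g\<in>carrier G. sym_mean U g ^ 2) \<le> 1 / real (card U)" .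
qed

text \<open>For fixed s, the product s^-1 t lies in c P exactly when t lies in (s c) P.\<close>

lemma coset_mass_sym_mean:
  assumes fin: "finite (carrier G)" and U: "U \<subseteq> carrier G" "U \<noteq> {}"
    and B: "\<And>x. x \<in> carrier G \<Longrightarrow> real (card {s \<in> U. inv x \<otimes> s \<in> P}) \<le> B * real (card U)"
    and c: "c \<in> carrier G"
  shows "coset_mass (sym_mean U) P c \<le> B"
proof -
  have finU: "finite U" using fin U finite_subset by blast
  have u: "real (card U) > 0" using U finU by (simp add: card_gt_0_iff)
  have "coset_mass (sym_mean U) P c = (\<Sum>g\<in>carrier G. sym_mean U g * (if inv c \<otimes> g \<in> P then 1 else 0))"
    unfolding coset_mass_alt[OF fin] by (intro sum.cong refl) simp
  also have "\<dots> = (\<Sum>s\<in>U. \<Sum>t\<in>U. if inv c \<otimes> (inv s \<otimes> t) \<in> P then 1 else 0) / real (card U) ^ 2"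
    by (rule sym_mean_sum[OF fin U(1)])
  also have "\<dots> \<le> (\<Sum>s\<in>U. B * real (card U)) / real (card U) ^ 2"
  proof (intro divide_right_mono sum_mono)
    fix s assume s: "s \<in> U"
    have "(\<Sum>t\<in>U. if inv c \<otimes> (inv s \<otimes> t) \<in> P then 1 else 0) = real (card {t \<in> U. inv c \<otimes> (inv s \<otimes> t) \<in> P})"
      using finU by (simp add: sum.If_cases Int_def)
    also have "{t \<in> U. inv c \<otimes> (inv s \<otimes> t) \<in> P} = {t \<in> U. inv (s \<otimes> c) \<otimes> t \<in> P}"
      using s U c by (auto simp: inv_mult_group m_assoc subset_iff)
    also have "real (card \<dots>) \<le> B * real (card U)" using s U c by (intro B) auto
    finally show "(\<Sum>t\<in>U. if inv c \<otimes> (inv s \<otimes> t) \<in> P then 1 else 0) \<le> B * real (card U)" .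
  qed simp
  also have "\<dots> = B" using u by (simp add: power2_eq_square)
  finally show ?thesis .
qed

primrec dyadic_conv :: "('a \<Rightarrow> real) \<Rightarrow> nat \<Rightarrow> 'a \<Rightarrow> real" where
  "dyadic_conv f 0 = f"
| "dyadic_conv f (Suc k) = conv (dyadic_conv f k) (dyadic_conv f k)"

lemma dyadic_conv_props:
  assumes f: "\<And>g. g \<in> carrier G \<Longrightarrow> 0 \<le> f g" "(\<Sum>g\<in>carrier G. f g) = 1"
    "\<And>g. g \<in> carrier G \<Longrightarrow> f (inv g) = f g"
  shows "(\<forall>g\<in>carrier G. 0 \<le> dyadic_conv f k g \<and> dyadic_conv f k (inv g) = dyadic_conv f k g) \<and>
    (\<Sum>g\<in>carrier G. dyadic_conv f k g) = 1"
proof (induction k)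
  case 0
  then show ?case using f by simp
next
  case (Suc k)
  then show ?case by (auto simp: sum_conv conv_inv intro!: conv_nonneg)
qed

end

section \<open>Two-by-two matrices modulo a prime\<close>

text \<open>
  Points of the projective line over the field with \<open>p\<close> elements are represented by integer vectors
  that do not vanish modulo \<open>p\<close>, up to proportionality modulo \<open>p\<close> (predicates \<open>nz\<close> and \<open>par\<close> below).
\<close>

definition app :: "int^2^2 \<Rightarrow> int \<times> int \<Rightarrow> int \<times> int" where
  "app g e = (g$1$1 * fst e + g$1$2 * snd e, g$2$1 * fst e + g$2$2 * snd e)"

definition cross :: "int \<times> int \<Rightarrow> int \<times> int \<Rightarrow> int" where
  "cross e f = fst e * snd f - snd e * fst f"

definition tr :: "int^2^2 \<Rightarrow> int" where
  "tr g = g$1$1 + g$2$2"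

text \<open>
  The commutator \<open>uv - vu\<close> has rows \<open>(bra, brb)\<close> and \<open>(brc, - bra)\<close>, and \<open>disc\<close> is minus its determinant.
\<close>

definition bra :: "int^2^2 \<Rightarrow> int^2^2 \<Rightarrow> int" where
  "bra u v = u$1$2 * v$2$1 - v$1$2 * u$2$1"

definition brb :: "int^2^2 \<Rightarrow> int^2^2 \<Rightarrow> int" where
  "brb u v = (u$1$1 - u$2$2) * v$1$2 - (v$1$1 - v$2$2) * u$1$2"

definition brc :: "int^2^2 \<Rightarrow> int^2^2 \<Rightarrow> int" where
  "brc u v = u$2$1 * (v$1$1 - v$2$2) - v$2$1 * (u$1$1 - u$2$2)"

definition disc :: "int^2^2 \<Rightarrow> int^2^2 \<Rightarrow> int" where
  "disc u v = (bra u v)\<^sup>2 + brb u v * brc u v"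

locale SL2_prime =
  fixes p :: nat
  assumes prime_p: "prime p" and p_gt_3: "p > 3"
begin

abbreviation Z :: "int \<Rightarrow> bool" where
  "Z x \<equiv> int p dvd x"

definition par :: "int \<times> int \<Rightarrow> int \<times> int \<Rightarrow> bool" where
  "par e f \<longleftrightarrow> Z (cross e f)"

definition nz :: "int \<times> int \<Rightarrow> bool" where
  "nz e \<longleftrightarrow> \<not> (Z (fst e) \<and> Z (snd e))"

definition maps :: "int^2^2 \<Rightarrow> int \<times> int \<Rightarrow> int \<times> int \<Rightarrow> bool" where
  "maps g e f \<longleftrightarrow> par (app g e) f"

definition scal :: "int^2^2 \<Rightarrow> bool" where
  "scal g \<longleftrightarrow> Z (g$1$2) \<and> Z (g$2$1) \<and> Z (g$1$1 - g$2$2)"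

definition commutes :: "int^2^2 \<Rightarrow> int^2^2 \<Rightarrow> bool" where
  "commutes u v \<longleftrightarrow> Z (bra u v) \<and> Z (brb u v) \<and> Z (brc u v)"

abbreviation "S \<equiv> SL2 p"

abbreviation mul :: "int^2^2 \<Rightarrow> int^2^2 \<Rightarrow> int^2^2" (infixl "\<cdot>" 70) where
  "g \<cdot> h \<equiv> g \<otimes>\<^bsub>S\<^esub> h"

abbreviation inverse_SL2 :: "int^2^2 \<Rightarrow> int^2^2" ("\<iota> _" [81] 80) where
  "\<iota> g \<equiv> inv\<^bsub>S\<^esub> g"

sublocale SL: group "SL2 p"
  using group_SL2[of p] p_gt_3 by simp

lemma Z_mult: "Z (a * b) \<longleftrightarrow> Z a \<or> Z b"
  using prime_p by (simp add: prime_dvd_mult_iff)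

lemma Z_1: "\<not> Z 1"
  using p_gt_3 by (simp add: zdvd1_eq)

lemma Z_2: "\<not> Z 2"
  using p_gt_3 by (auto dest: zdvd_imp_le)

lemma Z_small: "Z (a - b) \<Longrightarrow> 0 \<le> a \<Longrightarrow> a < int p \<Longrightarrow> 0 \<le> b \<Longrightarrow> b < int p \<Longrightarrow> a = b"
  by (metis mod_eq_dvd_iff mod_pos_pos_trivial)

lemma Z_inverse:
  assumes "\<not> Z a"
  obtains b where "Z (a * b - 1)"
proof -
  have "coprime a (int p)"
    using assms prime_p prime_imp_coprime[of "int p" a] by (simp add: coprime_commute)
  then obtain b where "[a * b = 1] (mod int p)" using cong_solve_coprime_int by blast
  then show thesis using that by (simp add: cong_iff_dvd_diff)
qed

lemma Z_sum_cancel: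
  assumes "Z (a - b)"
  shows "Z a \<longleftrightarrow> Z b"
  using assms dvd_diff_right_iff dvd_diff_commute by (metis dvd_add_left_iff diff_add_cancel)

lemma carrier_bounds:
  assumes "g \<in> carrier S"
  shows "0 \<le> g $ i $ j" "g $ i $ j < int p"
  using assms p_gt_3 by (auto simp: SL2_def carrier_Fp)

lemma carrier_det:
  assumes "g \<in> carrier S"
  shows "Z (g$1$1 * g$2$2 - g$1$2 * g$2$1 - 1)"
  using assms by (simp add: SL2_def det_2 cong_iff_dvd_diff)

lemma finite_carrier: "finite (carrier S)"
proof -
  have "carrier S \<subseteq> (\<lambda>(a, b, c, d). vector [vector [a, b], vector [c, d]]) `
      ({0..<int p} \<times> {0..<int p} \<times> {0..<int p} \<times> {0..<int p})"
  proof
    fix g assume g: "g \<in> carrier S"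
    have "g = (\<lambda>(a, b, c, d). vector [vector [a, b], vector [c, d]])
        (g$1$1, g$1$2, g$2$1, g$2$2)"
      by (simp add: vec_eq_iff forall_2)
    then show "g \<in> (\<lambda>(a, b, c, d). vector [vector [a, b], vector [c, d]]) `
      ({0..<int p} \<times> {0..<int p} \<times> {0..<int p} \<times> {0..<int p})"
      by (rule image_eqI) (simp add: carrier_bounds[OF g])
  qed
  then show ?thesis by (rule finite_subset) auto
qed

lemma SL2_eqI:
  assumes "g \<in> carrier S" "h \<in> carrier S"
    and "Z (g$1$1 - h$1$1)" "Z (g$1$2 - h$1$2)"
      "Z (g$2$1 - h$2$1)" "Z (g$2$2 - h$2$2)"
  shows "g = h"
  using assms carrier_bounds[OF assms(1)] carrier_bounds[OF assms(2)]
  by (auto simp: vec_eq_iff forall_2 intro!: Z_small)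

lemma mult_entry: "Z ((g \<cdot> h) $ i $ j - (g $ i $ 1 * h $ 1 $ j + g $ i $ 2 * h $ 2 $ j))"
  by (simp add: SL2_def matrix_matrix_mult_def sum_2)
    (metis dvd_minus_mod dvd_diff_commute)

lemma one_entry: "\<one>\<^bsub>S\<^esub> $ i $ j = (if i = j then 1 else 0)"
  by (simp add: SL2_def mat_def)

lemma inv_entries:
  assumes g: "g \<in> carrier S"
  shows "Z ((\<iota> g)$1$1 - g$2$2)" "Z ((\<iota> g)$1$2 + g$1$2)"
    "Z ((\<iota> g)$2$1 + g$2$1)" "Z ((\<iota> g)$2$2 - g$1$1)"
proof -
  let ?h = "\<iota> g"
  have e: "?h \<cdot> g = \<one>\<^bsub>S\<^esub>" using g by simp
  note m = mult_entry[of ?h g, unfolded e one_entry]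
  have m': "Z (1 - (?h$1$1 * g$1$1 + ?h$1$2 * g$2$1))"
    "Z (0 - (?h$1$1 * g$1$2 + ?h$1$2 * g$2$2))"
    "Z (0 - (?h$2$1 * g$1$1 + ?h$2$2 * g$2$1))"
    "Z (1 - (?h$2$1 * g$1$2 + ?h$2$2 * g$2$2))"
    using m[of 1 1] m[of 1 2] m[of 2 1] m[of 2 2] by simp_all
  note d = carrier_det[OF g]
  show "Z (?h$1$1 - g$2$2)" using m'(1,2) d by Groebner_Basis.algebra
  show "Z (?h$1$2 + g$1$2)" using m'(1,2) d by Groebner_Basis.algebra
  show "Z (?h$2$1 + g$2$1)" using m'(3,4) d by Groebner_Basis.algebra
  show "Z (?h$2$2 - g$1$1)" using m'(3,4) d by Groebner_Basis.algebra
qed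

lemma tr_inv:
  assumes "g \<in> carrier S"
  shows "Z (tr (\<iota> g) - tr g)"
  using inv_entries(1,4)[OF assms] unfolding tr_def by Groebner_Basis.algebra

lemma tr_mult: "Z (tr (g \<cdot> h) -
    (g$1$1 * h$1$1 + g$1$2 * h$2$1 + g$2$1 * h$1$2 + g$2$2 * h$2$2))"
  using mult_entry[of g h 1 1] mult_entry[of g h 2 2] unfolding tr_def by Groebner_Basis.algebra

lemma tr_mult_commute: "Z (tr (g \<cdot> h) - tr (h \<cdot> g))"
  using tr_mult[of g h] tr_mult[of h g] by Groebner_Basis.algebra

lemma tr_conj:
  assumes "g \<in> carrier S" "h \<in> carrier S"
  shows "Z (tr (g \<cdot> h \<cdot> \<iota> g) - tr h)"
proof -
  have "\<iota> g \<cdot> (g \<cdot> h) = h" using assms by (simp add: SL.m_assoc[symmetric])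
  then show ?thesis using tr_mult_commute[of "g \<cdot> h" "\<iota> g"] by simp
qed

section \<open>The action on the projective line\<close>

lemma par_refl: "par e e"
  by (simp add: par_def cross_def)

lemma par_sym: "par e f \<Longrightarrow> par f e"
  unfolding par_def cross_def by Groebner_Basis.algebra

text \<open>The zero vector is \<open>par\<close> to everything, so the middle vector has to be
  nonzero; a nonzero coordinate of it is then cancelled.\<close>

lemma par_trans:
  assumes "par e f" "par f h" "nz f"
  shows "par e h"
proof -
  have "Z (fst f * cross e h)" "Z (snd f * cross e h)"
    using assms(1,2) unfolding par_def cross_def by Groebner_Basis.algebra+
  then show ?thesis using assms(3) by (auto simp: par_def nz_def Z_mult)
qed

lemma cross_app:
  assumes "g \<in> carrier S"
  shows "Z (cross (app g e) (app g f) - cross e f)"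
  using carrier_det[OF assms] unfolding cross_def app_def fst_conv snd_conv
  by Groebner_Basis.algebra

lemma par_app_iff:
  assumes "g \<in> carrier S"
  shows "par (app g e) (app g f) \<longleftrightarrow> par e f"
  unfolding par_def by (rule Z_sum_cancel[OF cross_app[OF assms]])

lemma nz_app:
  assumes "g \<in> carrier S" "nz e"
  shows "nz (app g e)"
proof (rule ccontr)
  assume "\<not> nz (app g e)"
  then have "Z (g$1$1 * fst e + g$1$2 * snd e)" "Z (g$2$1 * fst e + g$2$2 * snd e)"
    by (auto simp: nz_def app_def)
  then have "Z (fst e)" "Z (snd e)"
    using carrier_det[OF assms(1)] by Groebner_Basis.algebra+
  then show False using assms(2) by (simp add: nz_def)
qed

lemma app_mult:
  "Z (fst (app (g \<cdot> h) e) - fst (app g (app h e)))"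
  "Z (snd (app (g \<cdot> h) e) - snd (app g (app h e)))"
  using mult_entry[of g h 1 1] mult_entry[of g h 1 2] mult_entry[of g h 2 1] mult_entry[of g h 2 2]
  unfolding app_def fst_conv snd_conv by Groebner_Basis.algebra+

lemma par_app_mult: "par (app (g \<cdot> h) e) f \<longleftrightarrow> par (app g (app h e)) f"
proof -
  have "Z (cross (app (g \<cdot> h) e) f - cross (app g (app h e)) f)"
    using app_mult[of g h e] unfolding cross_def by Groebner_Basis.algebra
  then show ?thesis unfolding par_def by (rule Z_sum_cancel)
qed

lemma maps_mult:
  assumes "g \<in> carrier S" "maps h e f" "maps g f k" "nz f"
  shows "maps (g \<cdot> h) e k"
  unfolding maps_def par_app_mult
  using assms par_trans[of "app g (app h e)" "app g f" k] nz_app par_app_iff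
  by (simp add: maps_def)

lemma maps_one: "maps \<one>\<^bsub>S\<^esub> e e"
  by (simp add: maps_def app_def one_entry par_def cross_def)

lemma maps_app: "maps g e (app g e)"
  by (simp add: maps_def par_refl)

lemma maps_inv:
  assumes "g \<in> carrier S" "maps g e f"
  shows "maps (\<iota> g) f e"
proof -
  have "par (app (\<iota> g) f) (app (\<iota> g) (app g e))"
    using assms by (simp add: maps_def par_app_iff par_sym)
  then have "par (app (\<iota> g) (app g e)) (app (\<iota> g) f)" by (rule par_sym)
  then have "par (app (\<iota> g \<cdot> g) e) (app (\<iota> g) f)"
    unfolding par_app_mult .
  then have "par e (app (\<iota> g) f)"
    using assms(1) by (simp add: app_def one_entry)
  then show ?thesis unfolding maps_def by (rule par_sym)
qed

lemma maps_par_right: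
  assumes "maps g e f" "par f k" "nz f"
  shows "maps g e k"
  using assms par_trans unfolding maps_def by blast

lemma maps_par_left:
  assumes "g \<in> carrier S" "maps g e f" "par e k" "nz e"
  shows "maps g k f"
  using assms par_trans[of "app g k" "app g e" f] nz_app par_app_iff par_sym
  unfolding maps_def by blast

lemma maps_unique:
  assumes "g \<in> carrier S" "maps g e f" "maps g e k" "nz e"
  shows "par f k"
  using assms par_trans[of f "app g e" k] nz_app par_sym unfolding maps_def by blast

lemma scal_cases:
  assumes g: "g \<in> carrier S" "scal g"
  shows "g = \<one>\<^bsub>S\<^esub> \<or> Z (g$1$1 + 1)"
proof -
  note s = assms(2)[unfolded scal_def]
  have "Z ((g$1$1 - 1) * (g$1$1 + 1))"
    using carrier_det[OF g(1)] s by Groebner_Basis.algebra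
  then consider "Z (g$1$1 - 1)" | "Z (g$1$1 + 1)" by (auto simp: Z_mult)
  then show ?thesis
  proof cases
    case 1
    have "Z (g$2$2 - 1)" using 1 s by Groebner_Basis.algebra
    then have "g = \<one>\<^bsub>S\<^esub>" using s 1 by (intro SL2_eqI g SL.one_closed) (simp_all add: one_entry)
    then show ?thesis by simp
  qed simp
qed

lemma scal_eqI:
  assumes "g \<in> carrier S" "h \<in> carrier S" "scal g" "scal h" "Z (g$1$1 - h$1$1)"
  shows "g = h"
proof (rule SL2_eqI[OF assms(1,2,5)])
  show "Z (g$1$2 - h$1$2)" "Z (g$2$1 - h$2$1)" "Z (g$2$2 - h$2$2)"
    using assms(3-5) unfolding scal_def by Groebner_Basis.algebra+
qed

lemma card_scal: "card {g \<in> carrier S. scal g} \<le> 2"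
proof (rule card_le_2I)
  have *: "x = y" if "x \<in> carrier S" "scal x" "y \<in> carrier S" "scal y" "Z (x$1$1 + 1)" "Z (y$1$1 + 1)" for x y
  proof (rule scal_eqI)
    show "Z (x$1$1 - y$1$1)" using that(5,6) by Groebner_Basis.algebra
  qed (fact that)+
  fix x y z
  assume "x \<in> {g \<in> carrier S. scal g}" "y \<in> {g \<in> carrier S. scal g}" "z \<in> {g \<in> carrier S. scal g}"
  then show "x = y \<or> y = z \<or> x = z"
    using scal_cases[of x] scal_cases[of y] scal_cases[of z] *[of x y] *[of y z] *[of x z] by auto
qed

text \<open>Cramer's rule: A, B, C solve a homogeneous linear system whose determinant is, up to
  sign, the displayed product of three cross products. A binary quadratic form with three pairwise
  non-proportional zeros therefore vanishes.\<close>

lemma three_zeros: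
  fixes A B C a1 a2 b1 b2 c1 c2 :: int
  assumes "Z (A * a1\<^sup>2 + B * a1 * a2 + C * a2\<^sup>2)" "Z (A * b1\<^sup>2 + B * b1 * b2 + C * b2\<^sup>2)"
    "Z (A * c1\<^sup>2 + B * c1 * c2 + C * c2\<^sup>2)"
  shows "Z (A * ((a1 * b2 - a2 * b1) * (a1 * c2 - a2 * c1) * (b1 * c2 - b2 * c1)))"
    "Z (B * ((a1 * b2 - a2 * b1) * (a1 * c2 - a2 * c1) * (b1 * c2 - b2 * c1)))"
    "Z (C * ((a1 * b2 - a2 * b1) * (a1 * c2 - a2 * c1) * (b1 * c2 - b2 * c1)))"
  using assms by Groebner_Basis.algebra+

text \<open>Fixed lines of g are the zeros of the quadratic form cross (g e) e, whose coefficients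
  vanish exactly when g is scalar.\<close>

lemma three_lines_scal:
  assumes "maps g e e" "maps g f f" "maps g h h" "\<not> par e f" "\<not> par e h" "\<not> par f h"
  shows "scal g"
proof -
  have q: "Z ((- g$2$1) * (fst e)\<^sup>2 + (g$1$1 - g$2$2) * fst e * snd e + g$1$2 * (snd e)\<^sup>2)"
    if "maps g e e" for e
    using that unfolding maps_def par_def cross_def app_def fst_conv snd_conv by Groebner_Basis.algebra
  have n: "\<not> Z (fst e * snd f - snd e * fst f)" "\<not> Z (fst e * snd h - snd e * fst h)"
    "\<not> Z (fst f * snd h - snd f * fst h)"
    using assms(4-6) by (simp_all add: par_def cross_def)
  show ?thesis
    using three_zeros[OF q[OF assms(1)] q[OF assms(2)] q[OF assms(3)]] n
    by (simp add: Z_mult scal_def)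
qed

text \<open>Two elements with the same three images differ by one that fixes three lines, hence by a
  scalar, and there are at most two scalars of determinant one.\<close>

lemma card_maps_three_lines:
  assumes "\<not> par e1 e2" "\<not> par e1 e3" "\<not> par e2 e3" "nz f1" "nz f2" "nz f3"
  shows "card {g \<in> carrier S. maps g e1 f1 \<and> maps g e2 f2 \<and> maps g e3 f3} \<le> 2" (is "card ?W \<le> 2")
proof (cases "?W = {}")
  case False
  then obtain g0 where g0: "g0 \<in> ?W" by auto
  have "card ?W \<le> card {g \<in> carrier S. scal g}"
  proof (rule card_inj_on_le[where f = "\<lambda>g. \<iota> g0 \<cdot> g"])
    show "inj_on (\<lambda>g. \<iota> g0 \<cdot> g) ?W" using g0 by (auto simp: inj_on_def)
    show "(\<lambda>g. \<iota> g0 \<cdot> g) ` ?W \<subseteq> {g \<in> carrier S. scal g}"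
    proof safe
      fix g assume g: "g \<in> carrier S" "maps g e1 f1" "maps g e2 f2" "maps g e3 f3"
      show "\<iota> g0 \<cdot> g \<in> carrier S" using g0 g by simp
      have "maps (\<iota> g0 \<cdot> g) e e" if "maps g0 e f" "maps g e f" "nz f" for e f
        using g0 that by (intro maps_mult[OF _ that(2) maps_inv]) auto
      then show "scal (\<iota> g0 \<cdot> g)"
        using g0 g assms(4-6) by (intro three_lines_scal[OF _ _ _ assms(1-3)]) blast+
    qed
  qed (simp add: finite_carrier)
  then show ?thesis using card_scal by linarith
next
  case True
  then show ?thesis by (simp only: card.empty)
qed

lemma par_factor:
  assumes "par e f" "nz f"
  obtains l where "Z (fst e - l * fst f)" "Z (snd e - l * snd f)"
proof -
  have c: "Z (fst e * snd f - snd e * fst f)" using assms(1) by (simp add: par_def cross_def)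
  consider "\<not> Z (fst f)" | "\<not> Z (snd f)" using assms(2) by (auto simp: nz_def)
  then show thesis
  proof cases
    case 1
    then obtain b where b: "Z (fst f * b - 1)" by (rule Z_inverse)
    have "Z (fst e - fst e * b * fst f)" "Z (snd e - fst e * b * snd f)"
      using b c by Groebner_Basis.algebra+
    then show thesis by (rule that)
  next
    case 2
    then obtain b where b: "Z (snd f * b - 1)" by (rule Z_inverse)
    have "Z (fst e - snd e * b * fst f)" "Z (snd e - snd e * b * snd f)"
      using b c by Groebner_Basis.algebra+
    then show thesis by (rule that)
  qed
qed


lemma matrix_eq_on_lines:
  assumes "g \<in> carrier S" "h \<in> carrier S" "\<not> par e f"
    and "Z (fst (app g e) - fst (app h e))" "Z (snd (app g e) - snd (app h e))"
    and "Z (fst (app g f) - fst (app h f))" "Z (snd (app g f) - snd (app h f))"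
  shows "g = h"
proof -
  have n: "\<not> Z (fst e * snd f - snd e * fst f)" using assms(3) by (simp add: par_def cross_def)
  have "Z ((fst e * snd f - snd e * fst f) * (g$1$1 - h$1$1))"
    "Z ((fst e * snd f - snd e * fst f) * (g$1$2 - h$1$2))"
    "Z ((fst e * snd f - snd e * fst f) * (g$2$1 - h$2$1))"
    "Z ((fst e * snd f - snd e * fst f) * (g$2$2 - h$2$2))"
    using assms(4-7) unfolding app_def fst_conv snd_conv by Groebner_Basis.algebra+
  then show ?thesis using n by (intro SL2_eqI assms) (simp_all add: Z_mult)
qed

lemma maps_same_factor:
  assumes g: "g \<in> carrier S" "h \<in> carrier S" and e: "nz e" "nz e'" and m: "maps g e e'" "maps h e e'"
  obtains l where "Z (fst (app g e) - l * fst (app h e))" "Z (snd (app g e) - l * snd (app h e))"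
proof -
  have "par (app g e) (app h e)"
    using m e par_trans[of "app g e" e' "app h e"] par_sym unfolding maps_def by blast
  then show thesis using par_factor nz_app[OF g(2) e(1)] that by blast
qed

text \<open>
  Two such elements differ by an element of the torus fixing \<open>e\<close> and \<open>m\<close>, and the trace gives a
  quadratic equation for its eigenvalue, nondegenerate because \<open>e'\<close> is not \<open>m\<close>.
\<close>

lemma card_trace_two_lines:
  assumes e: "nz e" "nz m" "nz e'" "nz m'" "\<not> par e m" "\<not> par e' m"
  shows "card {g \<in> carrier S. Z (tr g - t) \<and> maps g e e' \<and> maps g m m'} \<le> 2"
proof (rule card_le_2I)
  let ?W = "{g \<in> carrier S. Z (tr g - t) \<and> maps g e e' \<and> maps g m m'}"
  fix x y z assume xyz: "x \<in> ?W" "y \<in> ?W" "z \<in> ?W"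
  define D where "D = cross e m"
  define A where "A = cross (app x e) m"
  define B where "B = cross e (app x m)"
  have D0: "\<not> Z D" using e by (simp add: D_def par_def)
  have xG: "x \<in> carrier S" using xyz by simp
  have A0: "\<not> Z A"
  proof
    assume "Z A"
    then have "par (app x e) m" by (simp add: A_def par_def)
    moreover have "par e' (app x e)" using xyz by (simp add: maps_def par_sym)
    ultimately have "par e' m" using par_trans nz_app[OF xG e(1)] by blast
    with e show False by simp
  qed
  have factor: "\<exists>l k. Z (fst (app w e) - l * fst (app x e)) \<and> Z (snd (app w e) - l * snd (app x e)) \<and>
      Z (fst (app w m) - k * fst (app x m)) \<and> Z (snd (app w m) - k * snd (app x m)) \<and>
      Z (l * k - 1) \<and> (Z (l - 1) \<or> Z (A * l - B))" if w: "w \<in> ?W" for w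
  proof -
    have wG: "w \<in> carrier S" using w by simp
    obtain l where l: "Z (fst (app w e) - l * fst (app x e))" "Z (snd (app w e) - l * snd (app x e))"
      using maps_same_factor[of w x e e'] w xyz e by auto
    obtain k where k: "Z (fst (app w m) - k * fst (app x m))" "Z (snd (app w m) - k * snd (app x m))"
      using maps_same_factor[of w x m m'] w xyz e by auto
    have cw: "Z (cross (app w e) (app w m) - D)" and cx: "Z (cross (app x e) (app x m) - D)"
      using cross_app wG xG by (simp_all add: D_def)
    have "Z (D * (l * k - 1))"
      using l k cw cx unfolding cross_def[of "app w e" "app w m"] cross_def[of "app x e" "app x m"]
      by Groebner_Basis.algebra
    then have lk: "Z (l * k - 1)" using D0 by (simp add: Z_mult)
    \<comment> \<open>A polarization of the determinant: the trace is read off from the action on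
      two independent vectors.\<close>
    have trace: "D * tr g = cross (app g e) m + cross e (app g m)" for g
      by (simp add: D_def tr_def cross_def app_def algebra_simps)
    have "Z (tr w - tr x)" using w xyz by simp Groebner_Basis.algebra
    then have "Z (D * tr w - D * tr x)" by Groebner_Basis.algebra
    moreover have "Z (cross (app w e) m - l * A)" "Z (cross e (app w m) - k * B)"
      using l k unfolding A_def B_def cross_def[of _ m] cross_def[of e] by Groebner_Basis.algebra+
    ultimately have "Z (l * A + k * B - (A + B))"
      unfolding trace A_def[symmetric] B_def[symmetric] by Groebner_Basis.algebra
    \<comment> \<open>The trace condition reads l A + k B = A + B with k = 1 / l; multiplied by l it
      factors. The root l = 1 is x itself, and \<open>A0\<close> makes the other root
      unique.\<close>
    then have "Z ((l - 1) * (A * l - B))" using lk by Groebner_Basis.algebra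
    then show ?thesis using l k lk by (auto simp: Z_mult)
  qed
  have same: "w = v" if wv: "w \<in> carrier S" "v \<in> carrier S"
    and w: "Z (fst (app w e) - l * fst (app x e))" "Z (snd (app w e) - l * snd (app x e))"
      "Z (fst (app w m) - k * fst (app x m))" "Z (snd (app w m) - k * snd (app x m))" "Z (l * k - 1)"
    and v: "Z (fst (app v e) - l' * fst (app x e))" "Z (snd (app v e) - l' * snd (app x e))"
      "Z (fst (app v m) - k' * fst (app x m))" "Z (snd (app v m) - k' * snd (app x m))" "Z (l' * k' - 1)"
    and ll: "Z (l - l')" for w v l k l' k'
  proof (rule matrix_eq_on_lines[OF wv e(5)])
    have kk: "Z (k - k')" using w(5) v(5) ll by Groebner_Basis.algebra
    show "Z (fst (app w e) - fst (app v e))" using w(1) v(1) ll by Groebner_Basis.algebra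
    show "Z (snd (app w e) - snd (app v e))" using w(2) v(2) ll by Groebner_Basis.algebra
    show "Z (fst (app w m) - fst (app v m))" using w(3) v(3) kk by Groebner_Basis.algebra
    show "Z (snd (app w m) - snd (app v m))" using w(4) v(4) kk by Groebner_Basis.algebra
  qed
  obtain l k where y: "Z (fst (app y e) - l * fst (app x e))" "Z (snd (app y e) - l * snd (app x e))"
      "Z (fst (app y m) - k * fst (app x m))" "Z (snd (app y m) - k * snd (app x m))" "Z (l * k - 1)"
      and ly: "Z (l - 1) \<or> Z (A * l - B)" using factor[OF xyz(2)] by blast
  obtain l' k' where z: "Z (fst (app z e) - l' * fst (app x e))" "Z (snd (app z e) - l' * snd (app x e))"
      "Z (fst (app z m) - k' * fst (app x m))" "Z (snd (app z m) - k' * snd (app x m))" "Z (l' * k' - 1)"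
      and lz: "Z (l' - 1) \<or> Z (A * l' - B)" using factor[OF xyz(3)] by blast
  have x1: "Z (fst (app x e) - 1 * fst (app x e))" "Z (snd (app x e) - 1 * snd (app x e))"
      "Z (fst (app x m) - 1 * fst (app x m))" "Z (snd (app x m) - 1 * snd (app x m))" "Z (1 * 1 - 1)"
    by simp_all
  consider "Z (l - 1)" | "Z (l' - 1)" | "Z (A * l - B)" "Z (A * l' - B)" using ly lz by blast
  then show "x = y \<or> y = z \<or> x = z"
  proof cases
    case 1
    then show ?thesis using same[OF _ xG y x1] xyz by auto
  next
    case 2
    then show ?thesis using same[OF _ xG z x1] xyz by auto
  next
    case 3
    then have "Z (A * (l - l'))" by Groebner_Basis.algebra
    then have "Z (l - l')" using A0 by (simp add: Z_mult)
    then show ?thesis using same[OF _ _ y z] xyz by auto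
  qed
qed

section \<open>Trace form, commutators and centralizers\<close>

lemma trace_orthogonal:
  fixes z11 z12 z21 z22 :: int
  assumes "Z (z11 + z22)"
    and "Z (u$1$1 * z11 + u$1$2 * z21 + u$2$1 * z12 + u$2$2 * z22)"
    and "Z (v$1$1 * z11 + v$1$2 * z21 + v$2$1 * z12 + v$2$2 * z22)"
  shows "Z (z11 * brb u v - z12 * bra u v)" "Z (z11 * brc u v - z21 * bra u v)"
    "Z (z12 * brc u v - z21 * brb u v)"
  using assms unfolding bra_def brb_def brc_def by Groebner_Basis.algebra+

text \<open>
  The commutator of \<open>u\<close> and \<open>v\<close> spans the orthogonal complement of \<open>1, u, v\<close> for the trace form,
  so \<open>w\<close> varies on a line, which meets the quadric \<open>det w = 1\<close> in at most two points.
\<close>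

lemma card_three_traces:
  assumes d: "\<not> Z (disc u v)"
  shows "card {w \<in> carrier S. Z (tr w - a) \<and> Z (tr (u \<cdot> w) - b) \<and> Z (tr (v \<cdot> w) - c)} \<le> 2"
    (is "card ?W \<le> 2")
proof (rule card_le_2I)
  fix x y z assume xyz: "x \<in> ?W" "y \<in> ?W" "z \<in> ?W"
  define L where "L = (x$2$2 - x$1$1) * bra u v - x$1$2 * brc u v - x$2$1 * brb u v"
  define D where "D = disc u v"
  have param: "\<exists>s. Z (2 * D * (w$1$1 - x$1$1) - s * bra u v) \<and>
      Z (2 * D * (w$1$2 - x$1$2) - s * brb u v) \<and> Z (2 * D * (w$2$1 - x$2$1) - s * brc u v) \<and>
      Z (2 * D * (w$2$2 - x$2$2) + s * bra u v) \<and> (Z s \<or> Z (s - 2 * L))" if w: "w \<in> ?W" for w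
  proof -
    define z11 z12 z21 z22 where z_def: "z11 = w$1$1 - x$1$1" "z12 = w$1$2 - x$1$2"
      "z21 = w$2$1 - x$2$1" "z22 = w$2$2 - x$2$2"
    have tx: "Z (tr x - a)" "Z (tr (u \<cdot> x) - b)" "Z (tr (v \<cdot> x) - c)"
      "Z (tr w - a)" "Z (tr (u \<cdot> w) - b)" "Z (tr (v \<cdot> w) - c)" using xyz w by auto
    have z: "Z (z11 + z22)" using tx(1,4) unfolding z_def tr_def by Groebner_Basis.algebra
    have zu: "Z (u$1$1 * z11 + u$1$2 * z21 + u$2$1 * z12 + u$2$2 * z22)"
      using tx(2,5) tr_mult[of u x] tr_mult[of u w] unfolding z_def by Groebner_Basis.algebra
    have zv: "Z (v$1$1 * z11 + v$1$2 * z21 + v$2$1 * z12 + v$2$2 * z22)"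
      using tx(3,6) tr_mult[of v x] tr_mult[of v w] unfolding z_def by Groebner_Basis.algebra
    note o = trace_orthogonal[OF z zu zv]
    \<comment> \<open>With C the commutator and z = w - x, \<open>s\<close> is tr (C z) modulo p,
      and 2 \<open>D\<close> = tr (C^2). As z is proportional to C, this gives 2 D z = s C without
      dividing.\<close>
    define s where "s = 2 * bra u v * z11 + brb u v * z21 + brc u v * z12"
    have e: "Z (2 * D * z11 - s * bra u v)" "Z (2 * D * z12 - s * brb u v)" "Z (2 * D * z21 - s * brc u v)"
      using o unfolding D_def disc_def s_def by Groebner_Basis.algebra+
    have e4: "Z (2 * D * z22 + s * bra u v)" using e(1) z by Groebner_Basis.algebra
    \<comment> \<open>This is det (x + z) = det x. On the line along the commutator it becomes a
      quadratic equation for s with the roots 0, which is w = x, and 2 L.\<close>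
    have "Z (x$1$1 * z22 + x$2$2 * z11 - x$1$2 * z21 - x$2$1 * z12 + z11 * z22 - z12 * z21)"
      using carrier_det[of x] carrier_det[of w] xyz w unfolding z_def by simp Groebner_Basis.algebra
    then have "Z ((x$2$2 - x$1$1) * z11 - x$1$2 * z21 - x$2$1 * z12 - (z11\<^sup>2 + z12 * z21))"
      using z by Groebner_Basis.algebra
    then have "Z ((2 * D) * ((x$2$2 - x$1$1) * (2 * D * z11) - x$1$2 * (2 * D * z21)
        - x$2$1 * (2 * D * z12)) - ((2 * D * z11)\<^sup>2 + (2 * D * z12) * (2 * D * z21)))"
      by Groebner_Basis.algebra
    then have "Z (2 * D * (s * L) - s\<^sup>2 * D)"
      using e unfolding L_def D_def[unfolded disc_def] by Groebner_Basis.algebra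
    then have "Z (D * (s * (s - 2 * L)))" by Groebner_Basis.algebra
    then have "Z s \<or> Z (s - 2 * L)" using d by (simp add: Z_mult D_def)
    then show ?thesis using e e4 unfolding z_def by blast
  qed
  have same: "w = w'" if w: "w \<in> carrier S" "w' \<in> carrier S"
    and s: "Z (2 * D * (w$1$1 - x$1$1) - s * bra u v)" "Z (2 * D * (w$1$2 - x$1$2) - s * brb u v)"
      "Z (2 * D * (w$2$1 - x$2$1) - s * brc u v)" "Z (2 * D * (w$2$2 - x$2$2) + s * bra u v)"
    and s': "Z (2 * D * (w'$1$1 - x$1$1) - s' * bra u v)" "Z (2 * D * (w'$1$2 - x$1$2) - s' * brb u v)"
      "Z (2 * D * (w'$2$1 - x$2$1) - s' * brc u v)" "Z (2 * D * (w'$2$2 - x$2$2) + s' * bra u v)"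
    and ss: "Z (s - s')" for w w' s s'
  proof -
    have "Z (2 * D * (w$1$1 - w'$1$1))" using s(1) s'(1) ss by Groebner_Basis.algebra
    moreover have "Z (2 * D * (w$1$2 - w'$1$2))" using s(2) s'(2) ss by Groebner_Basis.algebra
    moreover have "Z (2 * D * (w$2$1 - w'$2$1))" using s(3) s'(3) ss by Groebner_Basis.algebra
    moreover have "Z (2 * D * (w$2$2 - w'$2$2))" using s(4) s'(4) ss by Groebner_Basis.algebra
    ultimately show ?thesis using d Z_2 by (intro SL2_eqI w) (simp_all add: Z_mult D_def)
  qed
  obtain s where s: "Z (2 * D * (y$1$1 - x$1$1) - s * bra u v)" "Z (2 * D * (y$1$2 - x$1$2) - s * brb u v)"
      "Z (2 * D * (y$2$1 - x$2$1) - s * brc u v)" "Z (2 * D * (y$2$2 - x$2$2) + s * bra u v)"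
    and sL: "Z s \<or> Z (s - 2 * L)" using param[OF xyz(2)] by blast
  obtain s' where s': "Z (2 * D * (z$1$1 - x$1$1) - s' * bra u v)" "Z (2 * D * (z$1$2 - x$1$2) - s' * brb u v)"
      "Z (2 * D * (z$2$1 - x$2$1) - s' * brc u v)" "Z (2 * D * (z$2$2 - x$2$2) + s' * bra u v)"
    and s'L: "Z s' \<or> Z (s' - 2 * L)" using param[OF xyz(3)] by blast
  have x0: "Z (2 * D * (x$1$1 - x$1$1) - 0 * bra u v)" "Z (2 * D * (x$1$2 - x$1$2) - 0 * brb u v)"
      "Z (2 * D * (x$2$1 - x$2$1) - 0 * brc u v)" "Z (2 * D * (x$2$2 - x$2$2) + 0 * bra u v)"
    by simp_all
  consider "Z s" | "Z s'" | "Z (s - 2 * L)" "Z (s' - 2 * L)" using sL s'L by blast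
  then show "x = y \<or> y = z \<or> x = z"
  proof cases
    case 1
    then show ?thesis using same[OF _ _ s x0] xyz by auto
  next
    case 2
    then show ?thesis using same[OF _ _ s' x0] xyz by auto
  next
    case 3
    then have "Z (s - s')" by Groebner_Basis.algebra
    then show ?thesis using same[OF _ _ s s'] xyz by auto
  qed
qed

text \<open>A traceless matrix with determinant zero is nilpotent. If the commutator is nonzero, its
  image is a line invariant under u and v; the two witnesses are its columns.\<close>

lemma disc_zero_cases:
  assumes "Z (disc u v)"
  shows "commutes u v \<or> (\<exists>f. nz f \<and> maps u f f \<and> maps v f f)"
proof (rule disjCI)
  assume no: "\<not> (\<exists>f. nz f \<and> maps u f f \<and> maps v f f)"
  have d: "Z ((bra u v)\<^sup>2 + brb u v * brc u v)" using assms by (simp add: disc_def)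
  have ac: "maps u (bra u v, brc u v) (bra u v, brc u v)" "maps v (bra u v, brc u v) (bra u v, brc u v)"
    using d unfolding maps_def par_def cross_def app_def fst_conv snd_conv bra_def brb_def brc_def
    by Groebner_Basis.algebra+
  have ba: "maps u (brb u v, - bra u v) (brb u v, - bra u v)" "maps v (brb u v, - bra u v) (brb u v, - bra u v)"
    using d unfolding maps_def par_def cross_def app_def fst_conv snd_conv bra_def brb_def brc_def
    by Groebner_Basis.algebra+
  show "commutes u v" using no ac ba unfolding commutes_def nz_def by auto
qed

text \<open>The centralizer of a non-scalar matrix is spanned by 1 and the matrix itself. \<beta> is
  obtained by dividing by whichever of the three quantities in \<open>scal\<close> is
  nonzero.\<close>

lemma commutes_param:
  assumes "commutes u v" "\<not> scal u"
  obtains \<alpha> \<beta> where "Z (v$1$1 - (\<alpha> + \<beta> * u$1$1))" "Z (v$1$2 - \<beta> * u$1$2)"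
    "Z (v$2$1 - \<beta> * u$2$1)" "Z (v$2$2 - (\<alpha> + \<beta> * u$2$2))"
proof -
  note c = assms(1)[unfolded commutes_def bra_def brb_def brc_def]
  have "\<exists>\<beta>. Z (v$1$2 - \<beta> * u$1$2) \<and> Z (v$2$1 - \<beta> * u$2$1) \<and>
      Z (v$1$1 - v$2$2 - \<beta> * (u$1$1 - u$2$2))"
  proof -
    consider "\<not> Z (u$1$2)" | "\<not> Z (u$2$1)" | "\<not> Z (u$1$1 - u$2$2)"
      using assms(2) by (auto simp: scal_def)
    then show ?thesis
    proof cases
      case 1
      then obtain b where b: "Z (u$1$2 * b - 1)" by (rule Z_inverse)
      show ?thesis
        by (rule exI[of _ "v$1$2 * b"]) (use b c in \<open>intro conjI; Groebner_Basis.algebra\<close>)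
    next
      case 2
      then obtain b where b: "Z (u$2$1 * b - 1)" by (rule Z_inverse)
      show ?thesis
        by (rule exI[of _ "v$2$1 * b"]) (use b c in \<open>intro conjI; Groebner_Basis.algebra\<close>)
    next
      case 3
      then obtain b where b: "Z ((u$1$1 - u$2$2) * b - 1)" by (rule Z_inverse)
      show ?thesis
        by (rule exI[of _ "(v$1$1 - v$2$2) * b"]) (use b c in \<open>intro conjI; Groebner_Basis.algebra\<close>)
    qed
  qed
  then obtain \<beta> where b: "Z (v$1$2 - \<beta> * u$1$2)" "Z (v$2$1 - \<beta> * u$2$1)"
    "Z (v$1$1 - v$2$2 - \<beta> * (u$1$1 - u$2$2))" by blast
  show thesis
  proof (rule that[of "v$1$1 - \<beta> * u$1$1" \<beta>])
    show "Z (v$2$2 - (v$1$1 - \<beta> * u$1$1 + \<beta> * u$2$2))" using b(3) by Groebner_Basis.algebra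
  qed (use b in simp_all)
qed

lemma commutes_sym: "commutes u v \<Longrightarrow> commutes v u"
  unfolding commutes_def bra_def brb_def brc_def by (intro conjI; Groebner_Basis.algebra)

text \<open>The centralizer of a non-scalar h is commutative, being spanned by 1 and h.\<close>

lemma commutes_trans:
  assumes "commutes h a" "commutes h b" "\<not> scal h"
  shows "commutes a b"
proof -
  obtain \<alpha> \<beta> where a: "Z (a$1$1 - (\<alpha> + \<beta> * h$1$1))" "Z (a$1$2 - \<beta> * h$1$2)"
    "Z (a$2$1 - \<beta> * h$2$1)" "Z (a$2$2 - (\<alpha> + \<beta> * h$2$2))"
    using commutes_param[OF assms(1,3)] by blast
  have aa: "Z (a$1$1 - a$2$2 - \<beta> * (h$1$1 - h$2$2))" using a(1,4) by Groebner_Basis.algebra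
  note c = assms(2)[unfolded commutes_def bra_def brb_def brc_def]
  show ?thesis
    unfolding commutes_def bra_def brb_def brc_def using a(2,3) aa c
    by (intro conjI; Groebner_Basis.algebra)
qed

lemma commutes_iff_mult:
  assumes "u \<in> carrier S" "v \<in> carrier S"
  shows "commutes u v \<longleftrightarrow> u \<cdot> v = v \<cdot> u"
proof
  assume c: "commutes u v"
  show "u \<cdot> v = v \<cdot> u"
  proof (rule SL2_eqI)
    show "Z ((u \<cdot> v)$1$1 - (v \<cdot> u)$1$1)"
      using c mult_entry[of u v 1 1] mult_entry[of v u 1 1]
      unfolding commutes_def bra_def by Groebner_Basis.algebra
    show "Z ((u \<cdot> v)$1$2 - (v \<cdot> u)$1$2)"
      using c mult_entry[of u v 1 2] mult_entry[of v u 1 2]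
      unfolding commutes_def brb_def by Groebner_Basis.algebra
    show "Z ((u \<cdot> v)$2$1 - (v \<cdot> u)$2$1)"
      using c mult_entry[of u v 2 1] mult_entry[of v u 2 1]
      unfolding commutes_def brc_def by Groebner_Basis.algebra
    show "Z ((u \<cdot> v)$2$2 - (v \<cdot> u)$2$2)"
      using c mult_entry[of u v 2 2] mult_entry[of v u 2 2]
      unfolding commutes_def bra_def by Groebner_Basis.algebra
  qed (use assms in auto)
next
  assume e: "u \<cdot> v = v \<cdot> u"
  show "commutes u v"
    unfolding commutes_def bra_def brb_def brc_def
    using mult_entry[of u v 1 1] mult_entry[of v u 1 1, folded e]
      mult_entry[of u v 1 2] mult_entry[of v u 1 2, folded e]
      mult_entry[of u v 2 1] mult_entry[of v u 2 1, folded e]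
    by (intro conjI; Groebner_Basis.algebra)
qed

lemma commutes_eigen:
  assumes "commutes u v" "\<not> scal u" "maps u f f"
  shows "maps v f f"
proof -
  obtain \<alpha> \<beta> where a: "Z (v$1$1 - (\<alpha> + \<beta> * u$1$1))" "Z (v$1$2 - \<beta> * u$1$2)"
    "Z (v$2$1 - \<beta> * u$2$1)" "Z (v$2$2 - (\<alpha> + \<beta> * u$2$2))"
    using commutes_param[OF assms(1,2)] by blast
  show ?thesis using a assms(3)
    unfolding maps_def par_def cross_def app_def fst_conv snd_conv by Groebner_Basis.algebra
qed

lemma eigenlines:
  assumes "\<not> scal u"
  obtains F where "finite F" "card F \<le> 2" "\<And>f. f \<in> F \<Longrightarrow> nz f"
    "\<And>f. nz f \<Longrightarrow> maps u f f \<Longrightarrow> \<exists>f'\<in>F. par f f'"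
proof (cases "\<exists>f1 f2. nz f1 \<and> nz f2 \<and> maps u f1 f1 \<and> maps u f2 f2 \<and> \<not> par f1 f2")
  case True
  then obtain f1 f2 where f: "nz f1" "nz f2" "maps u f1 f1" "maps u f2 f2" "\<not> par f1 f2" by blast
  show thesis
  proof (rule that[of "{f1, f2}"])
    show "\<exists>f'\<in>{f1, f2}. par g f'" if "nz g" "maps u g g" for g
      using three_lines_scal[of u f1 f2 g] f that assms par_sym by blast
  qed (use f in \<open>auto simp: card_insert_if\<close>)
next
  case no: False
  show thesis
  proof (cases "\<exists>f1. nz f1 \<and> maps u f1 f1")
    case True
    then obtain f1 where f1: "nz f1" "maps u f1 f1" by blast
    show thesis
    proof (rule that[of "{f1}"])
      show "\<exists>f'\<in>{f1}. par f f'" if "nz f" "maps u f f" for f using no f1 that by blast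
    qed (use f1 in auto)
  next
    case False
    show thesis by (rule that[of "{}"]) (use False in auto)
  qed
qed

text \<open>Trace 2 and determinant 1 give (u - 1)^2 = 0, so every nonzero column of u - 1 is an
  eigenvector. This finds an eigenvector without solving a quadratic equation.\<close>

lemma trace_two_eigen:
  assumes u: "u \<in> carrier S" "\<not> scal u" "Z (tr u - 2)"
  obtains f where "nz f" "maps u f f"
proof -
  have t: "Z (u$1$1 + u$2$2 - 2)" using u(3) by (simp add: tr_def)
  note d = carrier_det[OF u(1)]
  let ?f = "(u$1$1 - 1, u$2$1)" and ?g = "(u$1$2, u$2$2 - 1)"
  have "maps u ?f ?f" "maps u ?g ?g"
    using t d unfolding maps_def par_def cross_def app_def fst_conv snd_conv by Groebner_Basis.algebra+
  moreover have "nz ?f \<or> nz ?g"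
  proof (rule ccontr)
    assume "\<not> (nz ?f \<or> nz ?g)"
    then have *: "Z (u$1$1 - 1)" "Z (u$2$1)" "Z (u$1$2)" "Z (u$2$2 - 1)"
      by (auto simp: nz_def)
    then have "Z (u$1$1 - u$2$2)" by Groebner_Basis.algebra
    then show False using * u(2) by (simp add: scal_def)
  qed
  ultimately show thesis using that by blast
qed

text \<open>Put u = x y and v = y z. If u and v share an eigenline f, then z sends f to y^-1 f; u
  has at most two eigenlines, each costing M. If they commute, v = \<alpha> + \<beta> u. The
  elements y^-1, y^-1 u = y^-1 x y and y^-1 v = z all have trace t, so t (\<alpha> + \<beta> - 1) =
  0; this is where t must be nonzero. The determinant then leaves v = 1, v = u, or tr u = 2, and in
  the last case there is again a common eigenline.\<close>

lemma card_disc_zero: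
  fixes M :: real
  assumes X: "X \<subseteq> {x \<in> carrier S. Z (tr x - t)}" and t: "\<not> Z t"
    and x: "x \<in> carrier S" "Z (tr x - t)" and y: "y \<in> carrier S" "Z (tr y - t)"
    and ns: "\<not> scal (x \<cdot> y)"
    and M: "\<And>e e'. nz e \<Longrightarrow> nz e' \<Longrightarrow> real (card {z \<in> X. maps z e e'}) \<le> M"
  shows "real (card {z \<in> X. Z (disc (x \<cdot> y) (y \<cdot> z))}) \<le> 2 + 2 * M"
proof -
  define u where "u = x \<cdot> y"
  have uG: "u \<in> carrier S" using x y by (simp add: u_def)
  have nsu: "\<not> scal u" using ns by (simp add: u_def)
  obtain F where F: "finite F" "card F \<le> 2" "\<And>f. f \<in> F \<Longrightarrow> nz f"
    "\<And>f. nz f \<Longrightarrow> maps u f f \<Longrightarrow> \<exists>f'\<in>F. par f f'"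
    using eigenlines[OF nsu] by blast
  let ?y = "\<iota> y"
  have finX: "finite X" using X finite_carrier finite_subset by fastforce
  have incl: "{z \<in> X. Z (disc u (y \<cdot> z))} \<subseteq>
      {?y, ?y \<cdot> u} \<union> (\<Union>f\<in>F. {z \<in> X. maps z f (app ?y f)})"
  proof
    fix z assume z: "z \<in> {z \<in> X. Z (disc u (y \<cdot> z))}"
    have zG: "z \<in> carrier S" "Z (tr z - t)" using z X by auto
    define v where "v = y \<cdot> z"
    have vG: "v \<in> carrier S" using y zG by (simp add: v_def)
    have zv: "z = ?y \<cdot> v" using y zG by (simp add: v_def SL.m_assoc[symmetric])
    have eig: "z \<in> (\<Union>f\<in>F. {z \<in> X. maps z f (app ?y f)})" if f: "nz f" "maps u f f" "maps v f f" for f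
    proof -
      obtain f' where f': "f' \<in> F" "par f f'" using F(4) f by blast
      have "maps v f' f'" using f f' vG maps_par_left maps_par_right by blast
      then have "maps z f' (app ?y f')"
        unfolding zv using y F(3)[OF f'(1)] by (intro maps_mult[of _ _ _ f'] maps_app) auto
      then show ?thesis using f' z by auto
    qed
    have "Z (disc u v)" using z by (simp add: v_def)
    then consider "commutes u v" | f where "nz f" "maps u f f" "maps v f f"
      using disc_zero_cases by blast
    then show "z \<in> {?y, ?y \<cdot> u} \<union> (\<Union>f\<in>F. {z \<in> X. maps z f (app ?y f)})"
    proof cases
      case 1
      obtain \<alpha> \<beta> where ab: "Z (v$1$1 - (\<alpha> + \<beta> * u$1$1))" "Z (v$1$2 - \<beta> * u$1$2)"
        "Z (v$2$1 - \<beta> * u$2$1)" "Z (v$2$2 - (\<alpha> + \<beta> * u$2$2))"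
        using commutes_param[OF 1 nsu] by blast
      have "Z (tr (?y \<cdot> u) - t)"
      proof -
        have "?y \<cdot> u = ?y \<cdot> x \<cdot> \<iota> ?y" using x y by (simp add: u_def SL.m_assoc)
        then have "Z (tr (?y \<cdot> u) - tr x)" using tr_conj[of ?y x] x y by simp
        then show ?thesis using x(2) by Groebner_Basis.algebra
      qed
      moreover have "Z (tr ?y - t)" using tr_inv[OF y(1)] y(2) by Groebner_Basis.algebra
      moreover have "Z (tr (?y \<cdot> v) - t)" using zG(2) by (simp add: zv[symmetric])
      ultimately have "Z (t * (\<alpha> + \<beta> - 1))"
        using ab tr_mult[of ?y u] tr_mult[of ?y v] unfolding tr_def[of ?y] by Groebner_Basis.algebra
      then have sum: "Z (\<alpha> + \<beta> - 1)" using t by (simp add: Z_mult)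
      \<comment> \<open>Compare det v = \<alpha>^2 + \<alpha> \<beta> tr u + \<beta>^2 = 1 with
        (\<alpha> + \<beta>)^2 = 1.\<close>
      have "Z (\<alpha> * (\<beta> * (tr u - 2)))"
        using ab sum carrier_det[OF uG] carrier_det[OF vG] unfolding tr_def by Groebner_Basis.algebra
      then consider "Z \<alpha>" | "Z \<beta>" | "Z (tr u - 2)" by (auto simp: Z_mult)
      then show ?thesis
      proof cases
        case 1
        have b: "Z (\<beta> - 1)" using 1 sum by Groebner_Basis.algebra
        have "v = u"
        proof (rule SL2_eqI[OF vG uG])
          show "Z (v$1$1 - u$1$1)" using ab(1) b 1 by Groebner_Basis.algebra
          show "Z (v$1$2 - u$1$2)" using ab(2) b by Groebner_Basis.algebra
          show "Z (v$2$1 - u$2$1)" using ab(3) b by Groebner_Basis.algebra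
          show "Z (v$2$2 - u$2$2)" using ab(4) b 1 by Groebner_Basis.algebra
        qed
        then show ?thesis using zv by simp
      next
        case 2
        have a: "Z (\<alpha> - 1)" using 2 sum by Groebner_Basis.algebra
        have "v = \<one>\<^bsub>S\<^esub>"
        proof (rule SL2_eqI[OF vG SL.one_closed])
          have "Z (v$1$1 - 1)" using ab(1) a 2 by Groebner_Basis.algebra
          then show "Z (v$1$1 - \<one>\<^bsub>S\<^esub>$1$1)" by (simp add: one_entry)
          have "Z (v$1$2)" using ab(2) 2 by Groebner_Basis.algebra
          then show "Z (v$1$2 - \<one>\<^bsub>S\<^esub>$1$2)" by (simp add: one_entry)
          have "Z (v$2$1)" using ab(3) 2 by Groebner_Basis.algebra
          then show "Z (v$2$1 - \<one>\<^bsub>S\<^esub>$2$1)" by (simp add: one_entry)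
          have "Z (v$2$2 - 1)" using ab(4) a 2 by Groebner_Basis.algebra
          then show "Z (v$2$2 - \<one>\<^bsub>S\<^esub>$2$2)" by (simp add: one_entry)
        qed
        then show ?thesis using zv y by simp
      next
        case 3
        then obtain f where "nz f" "maps u f f" using trace_two_eigen[OF uG nsu] by blast
        then show ?thesis using eig commutes_eigen[OF \<open>commutes u v\<close> nsu] by blast
      qed
    next
      case 2
      then show ?thesis using eig by blast
    qed
  qed
  have "card {z \<in> X. Z (disc u (y \<cdot> z))} \<le>
      card ({?y, ?y \<cdot> u} \<union> (\<Union>f\<in>F. {z \<in> X. maps z f (app ?y f)}))"
    using finX F(1) by (intro card_mono incl) auto
  also have "\<dots> \<le> card {?y, ?y \<cdot> u} + card (\<Union>f\<in>F. {z \<in> X. maps z f (app ?y f)})"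
    by (rule card_Un_le)
  also have "\<dots> \<le> 2 + (\<Sum>f\<in>F. card {z \<in> X. maps z f (app ?y f)})"
    using F(1) by (intro add_mono card_UN_le) (auto simp: card_insert_if)
  finally have "real (card {z \<in> X. Z (disc u (y \<cdot> z))}) \<le>
      2 + (\<Sum>f\<in>F. real (card {z \<in> X. maps z f (app ?y f)}))"
    by (simp only: of_nat_le_iff[symmetric, where 'a = real] of_nat_add of_nat_numeral of_nat_sum)
  also have "(\<Sum>f\<in>F. real (card {z \<in> X. maps z f (app ?y f)})) \<le> (\<Sum>f\<in>F. M)"
    using F(3) y by (intro sum_mono M nz_app) auto
  also have "\<dots> = real (card F) * M" by simp
  also have "\<dots> \<le> 2 * M"
  proof (rule mult_right_mono)
    have "nz (1, 0)" using Z_1 by (simp add: nz_def)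
    then show "0 \<le> M" using M[of "(1, 0)" "(1, 0)"] by linarith
  qed (use F(2) in simp)
  finally show ?thesis by (simp add: u_def)
qed

text \<open>For g = \<alpha> + \<beta> u of trace s, the determinant gives \<beta>^2 ((tr u)^2 - 4)
  = s^2 - 4, so \<beta> is known up to sign, and the trace then determines \<alpha>.\<close>

lemma card_commutes_trace:
  assumes u: "u \<in> carrier S" "\<not> scal u" and ss: "\<not> Z ((tr u)\<^sup>2 - 4)"
  shows "card {g \<in> carrier S. commutes u g \<and> Z (tr g - s)} \<le> 2" (is "card ?W \<le> 2")
proof (rule card_le_2I)
  have param: "\<exists>\<alpha> \<beta>. Z (v$1$1 - (\<alpha> + \<beta> * u$1$1)) \<and> Z (v$1$2 - \<beta> * u$1$2) \<and>
      Z (v$2$1 - \<beta> * u$2$1) \<and> Z (v$2$2 - (\<alpha> + \<beta> * u$2$2)) \<and>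
      Z (2 * \<alpha> + \<beta> * tr u - s) \<and> Z (\<beta>\<^sup>2 * ((tr u)\<^sup>2 - 4) - (s\<^sup>2 - 4))" if v: "v \<in> ?W" for v
  proof -
    have vG: "v \<in> carrier S" "Z (v$1$1 + v$2$2 - s)" using v by (simp_all add: tr_def)
    obtain \<alpha> \<beta> where ab: "Z (v$1$1 - (\<alpha> + \<beta> * u$1$1))" "Z (v$1$2 - \<beta> * u$1$2)"
      "Z (v$2$1 - \<beta> * u$2$1)" "Z (v$2$2 - (\<alpha> + \<beta> * u$2$2))"
      using commutes_param[OF _ u(2), of v] v by blast
    have 1: "Z (2 * \<alpha> + \<beta> * tr u - s)" using ab(1,4) vG(2) unfolding tr_def by Groebner_Basis.algebra
    have "Z (\<alpha>\<^sup>2 + \<alpha> * \<beta> * tr u + \<beta>\<^sup>2 - 1)"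
      using ab carrier_det[OF vG(1)] carrier_det[OF u(1)] unfolding tr_def by Groebner_Basis.algebra
    then have "Z (\<beta>\<^sup>2 * ((tr u)\<^sup>2 - 4) - (s\<^sup>2 - 4))" using 1 by Groebner_Basis.algebra
    then show ?thesis using ab 1 by blast
  qed
  fix x y z assume xyz: "x \<in> ?W" "y \<in> ?W" "z \<in> ?W"
  obtain ax bx where x: "Z (x$1$1 - (ax + bx * u$1$1))" "Z (x$1$2 - bx * u$1$2)"
      "Z (x$2$1 - bx * u$2$1)" "Z (x$2$2 - (ax + bx * u$2$2))"
      "Z (2 * ax + bx * tr u - s)" "Z (bx\<^sup>2 * ((tr u)\<^sup>2 - 4) - (s\<^sup>2 - 4))"
    using param[OF xyz(1)] by blast
  obtain ay "by" where y: "Z (y$1$1 - (ay + by * u$1$1))" "Z (y$1$2 - by * u$1$2)"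
      "Z (y$2$1 - by * u$2$1)" "Z (y$2$2 - (ay + by * u$2$2))"
      "Z (2 * ay + by * tr u - s)" "Z (by\<^sup>2 * ((tr u)\<^sup>2 - 4) - (s\<^sup>2 - 4))"
    using param[OF xyz(2)] by blast
  obtain az bz where z: "Z (z$1$1 - (az + bz * u$1$1))" "Z (z$1$2 - bz * u$1$2)"
      "Z (z$2$1 - bz * u$2$1)" "Z (z$2$2 - (az + bz * u$2$2))"
      "Z (2 * az + bz * tr u - s)" "Z (bz\<^sup>2 * ((tr u)\<^sup>2 - 4) - (s\<^sup>2 - 4))"
    using param[OF xyz(3)] by blast
  have same: "v = w" if vw: "v \<in> carrier S" "w \<in> carrier S"
    and v: "Z (v$1$1 - (a + b * u$1$1))" "Z (v$1$2 - b * u$1$2)"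
      "Z (v$2$1 - b * u$2$1)" "Z (v$2$2 - (a + b * u$2$2))" "Z (2 * a + b * tr u - s)"
    and w: "Z (w$1$1 - (a' + b' * u$1$1))" "Z (w$1$2 - b' * u$1$2)"
      "Z (w$2$1 - b' * u$2$1)" "Z (w$2$2 - (a' + b' * u$2$2))" "Z (2 * a' + b' * tr u - s)"
    and bb: "Z (b - b')" for v w a b a' b'
  proof (rule SL2_eqI[OF vw])
    have "Z (2 * (a - a'))" using v(5) w(5) bb by Groebner_Basis.algebra
    then have aa: "Z (a - a')" using Z_2 Z_mult[of 2 "a - a'"] by blast
    show "Z (v$1$1 - w$1$1)" using v(1) w(1) aa bb by Groebner_Basis.algebra
    show "Z (v$1$2 - w$1$2)" using v(2) w(2) bb by Groebner_Basis.algebra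
    show "Z (v$2$1 - w$2$1)" using v(3) w(3) bb by Groebner_Basis.algebra
    show "Z (v$2$2 - w$2$2)" using v(4) w(4) aa bb by Groebner_Basis.algebra
  qed
  have pm: "Z (b - c) \<or> Z (b + c)" if "Z (b\<^sup>2 * ((tr u)\<^sup>2 - 4) - (s\<^sup>2 - 4))" "Z (c\<^sup>2 * ((tr u)\<^sup>2 - 4) - (s\<^sup>2 - 4))" for b c
  proof -
    have "Z (((tr u)\<^sup>2 - 4) * ((b - c) * (b + c)))" using that by Groebner_Basis.algebra
    then show ?thesis using ss by (simp add: Z_mult)
  qed
  consider "Z (bx - by)" | "Z (by - bz)" | "Z (bx + by)" "Z (by + bz)" using pm x(6) y(6) z(6) by blast
  then show "x = y \<or> y = z \<or> x = z"
  proof cases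
    case 1
    then show ?thesis using same[OF _ _ x(1-5) y(1-5)] xyz by simp
  next
    case 2
    then show ?thesis using same[OF _ _ y(1-5) z(1-5)] xyz by simp
  next
    case 3
    then have "Z (bx - bz)" by Groebner_Basis.algebra
    then show ?thesis using same[OF _ _ x(1-5) z(1-5)] xyz by simp
  qed
qed

lemma scal_trace:
  assumes "g \<in> carrier S" "scal g"
  shows "Z ((tr g)\<^sup>2 - 4)"
  using carrier_det[OF assms(1)] assms(2) unfolding scal_def tr_def by Groebner_Basis.algebra

text \<open>In a torus, trace 2 or -2 forces \<beta>^2 = 0 in v = \<alpha> + \<beta> u. Thus
  distinct tori, even after removing the scalars, consist of regular elements.\<close>

lemma commutes_trace_scal:
  assumes u: "u \<in> carrier S" "\<not> scal u" "\<not> Z ((tr u)\<^sup>2 - 4)"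
    and v: "v \<in> carrier S" "commutes u v" "Z ((tr v)\<^sup>2 - 4)"
  shows "scal v"
proof -
  obtain \<alpha> \<beta> where ab: "Z (v$1$1 - (\<alpha> + \<beta> * u$1$1))" "Z (v$1$2 - \<beta> * u$1$2)"
    "Z (v$2$1 - \<beta> * u$2$1)" "Z (v$2$2 - (\<alpha> + \<beta> * u$2$2))"
    using commutes_param[OF v(2) u(2)] by blast
  have 1: "Z (2 * \<alpha> + \<beta> * tr u - tr v)" using ab(1,4) unfolding tr_def by Groebner_Basis.algebra
  have "Z (\<alpha>\<^sup>2 + \<alpha> * \<beta> * tr u + \<beta>\<^sup>2 - 1)"
    using ab carrier_det[OF v(1)] carrier_det[OF u(1)] unfolding tr_def by Groebner_Basis.algebra
  then have "Z (((tr u)\<^sup>2 - 4) * (\<beta> * \<beta>))" using 1 v(3) by Groebner_Basis.algebra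
  then have "Z \<beta>" using u(3) by (simp add: Z_mult)
  then show ?thesis unfolding scal_def using ab by (intro conjI; Groebner_Basis.algebra)
qed

lemma card_centralizer:
  assumes "u \<in> carrier S" "\<not> scal u" "\<not> Z ((tr u)\<^sup>2 - 4)"
  shows "card {g \<in> carrier S. commutes u g} \<le> 2 * p"
proof -
  have "card {g \<in> carrier S. commutes u g} \<le> 2 * card {0..<int p}"
  proof (rule card_le_fibres[where f = "\<lambda>g. tr g mod int p"])
    fix s assume "s \<in> {0..<int p}"
    have "{g \<in> {g \<in> carrier S. commutes u g}. tr g mod int p = s} \<subseteq>
        {g \<in> carrier S. commutes u g \<and> Z (tr g - s)}"
      by (auto simp: dvd_minus_mod dvd_diff_commute)
    then have "card {g \<in> {g \<in> carrier S. commutes u g}. tr g mod int p = s} \<le>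
        card {g \<in> carrier S. commutes u g \<and> Z (tr g - s)}"
      by (intro card_mono) (auto simp: finite_carrier)
    also have "\<dots> \<le> 2" by (rule card_commutes_trace[OF assms])
    finally show "card {g \<in> {g \<in> carrier S. commutes u g}. tr g mod int p = s} \<le> 2" .
  qed (use p_gt_3 finite_carrier in auto)
  then show ?thesis by simp
qed

definition mk :: "int \<Rightarrow> int \<Rightarrow> int \<Rightarrow> int \<Rightarrow> int^2^2" where
  "mk a b c d = mat_mod p (vector [vector [a, b], vector [c, d]])"

lemma mk_entries [simp]: "mk a b c d$1$1 = a mod int p" "mk a b c d$1$2 = b mod int p"
  "mk a b c d$2$1 = c mod int p" "mk a b c d$2$2 = d mod int p"
  by (simp_all add: mk_def)

lemma mk_carrier:
  assumes "Z (a * d - b * c - 1)"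
  shows "mk a b c d \<in> carrier S"
  unfolding mk_def
  by (rule mat_mod_SL2) (use assms p_gt_3 in \<open>auto simp: det_2 cong_iff_dvd_diff\<close>)

text \<open>Only matrices with invertible upper left entry are counted: three entries are then free
  and the fourth is determined.\<close>

lemma card_SL2: "real p ^ 3 / 2 \<le> real (card (carrier S))"
proof -
  define i where "i a = (SOME b. Z (a * b - 1))" for a
  have i: "Z (a * i a - 1)" if "a \<in> {1..<int p}" for a
  proof -
    have "\<not> Z a" using that by (auto dest: zdvd_imp_le)
    then show ?thesis unfolding i_def by (metis Z_inverse someI_ex)
  qed
  have "card ({1..<int p} \<times> {0..<int p} \<times> {0..<int p}) \<le> card (carrier S)"
  proof (rule card_inj_on_le[where f = "\<lambda>(a, b, c). mk a b c ((1 + b * c) * i a)"])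
    show "inj_on (\<lambda>(a, b, c). mk a b c ((1 + b * c) * i a)) ({1..<int p} \<times> {0..<int p} \<times> {0..<int p})"
      by (rule inj_on_inverseI[where g = "\<lambda>g. (g$1$1, g$1$2, g$2$1)"]) auto
    show "(\<lambda>(a, b, c). mk a b c ((1 + b * c) * i a)) ` ({1..<int p} \<times> {0..<int p} \<times> {0..<int p}) \<subseteq> carrier S"
    proof safe
      fix a b c assume "a \<in> {1..<int p}"
      then have "Z (a * i a - 1)" by (rule i)
      then have "Z (a * ((1 + b * c) * i a) - b * c - 1)" by Groebner_Basis.algebra
      then show "mk a b c ((1 + b * c) * i a) \<in> carrier S" by (rule mk_carrier)
    qed
  qed (rule finite_carrier)
  then have "(p - 1) * (p * p) \<le> card (carrier S)" using p_gt_3 by (simp add: nat_diff_distrib)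
  then have "real ((p - 1) * (p * p)) \<le> real (card (carrier S))" by (rule of_nat_mono)
  moreover have "real p ^ 3 / 2 \<le> real ((p - 1) * (p * p))"
  proof -
    have "real p / 2 * (real p * real p) \<le> real (p - 1) * (real p * real p)"
      using p_gt_3 by (intro mult_right_mono) auto
    then show ?thesis by (simp add: power3_eq_cube)
  qed
  ultimately show ?thesis by linarith
qed

text \<open>Unipotent matrices with off-diagonal entry 1 and 2, upper or lower triangular so that
  they move e, give three distinct lines. No set of one or two lines is therefore invariant under
  the whole group.\<close>

lemma three_images:
  assumes "nz e"
  obtains g h where "g \<in> carrier S" "h \<in> carrier S" "\<not> par e (app g e)" "\<not> par e (app h e)"
    "\<not> par (app g e) (app h e)"
proof (cases "Z (snd e)")
  case False
  let ?g = "mk 1 1 0 1" and ?h = "mk 1 2 0 1"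
  have gh: "?g \<in> carrier S" "?h \<in> carrier S" by (rule mk_carrier; simp)+
  have m: "1 mod int p = 1" "2 mod int p = 2" using p_gt_3 by auto
  have "cross e (app ?g e) = - (snd e * snd e)" "cross e (app ?h e) = - (2 * (snd e * snd e))"
    "cross (app ?g e) (app ?h e) = - (snd e * snd e)"
    unfolding cross_def app_def mk_entries m mod_0 by (simp_all add: algebra_simps)
  then show thesis using that[OF gh] False Z_2 by (simp add: par_def Z_mult)
next
  case True
  then have f: "\<not> Z (fst e)" using assms by (simp add: nz_def)
  let ?g = "mk 1 0 1 1" and ?h = "mk 1 0 2 1"
  have gh: "?g \<in> carrier S" "?h \<in> carrier S" by (rule mk_carrier; simp)+
  have m: "1 mod int p = 1" "2 mod int p = 2" using p_gt_3 by auto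
  have "cross e (app ?g e) = fst e * fst e" "cross e (app ?h e) = 2 * (fst e * fst e)"
    "cross (app ?g e) (app ?h e) = fst e * fst e"
    unfolding cross_def app_def mk_entries m mod_0 by (simp_all add: algebra_simps)
  then show thesis using that[OF gh] f Z_2 by (simp add: par_def Z_mult)
qed

end

section \<open>Helfgott's growth theorem\<close>

locale SL2_generating = SL2_prime +
  fixes H :: "(int^2^2) set"
  assumes H_carrier: "H \<subseteq> carrier (SL2 p)" and one_in_H: "\<one>\<^bsub>SL2 p\<^esub> \<in> H"
    and inv_in_H: "\<And>h. h \<in> H \<Longrightarrow> inv\<^bsub>SL2 p\<^esub> h \<in> H"
    and generates: "\<And>L. subgroup L (SL2 p) \<Longrightarrow> H \<subseteq> L \<Longrightarrow> L = carrier (SL2 p)"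
begin

section \<open>Short words that move lines\<close>

abbreviation Q :: "nat \<Rightarrow> (int^2^2) set" where
  "Q n \<equiv> SL.setpow H n"

lemma Q_carrier: "Q n \<subseteq> carrier S"
  by (rule SL.setpow_carrier[OF H_carrier])

lemma finite_Q: "finite (Q n)"
  using Q_carrier finite_carrier finite_subset by blast

lemma Q_1: "Q 1 = H"
  using SL.setpow_one[OF H_carrier] by simp

lemma Q_mult: "a \<in> Q m \<Longrightarrow> b \<in> Q n \<Longrightarrow> m + n = k \<Longrightarrow> a \<cdot> b \<in> Q k"
  using SL.setpow_add[OF H_carrier] by blast

lemma Q_inv: "a \<in> Q n \<Longrightarrow> \<iota> a \<in> Q n"
  by (rule SL.setpow_inv[OF H_carrier inv_in_H])

lemma Q_mono: "m \<le> n \<Longrightarrow> Q m \<subseteq> Q n"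
  by (rule SL.setpow_mono[OF H_carrier one_in_H])

lemma H_Q: "h \<in> H \<Longrightarrow> h \<in> Q 1"
  by (simp only: Q_1)

lemma card_Q_pos: "card (Q n) > 0"
proof -
  have "\<one>\<^bsub>S\<^esub> \<in> Q n" using Q_mono[of 0 n] by auto
  then show ?thesis using finite_Q by (auto simp: card_gt_0_iff)
qed

lemma H_induct [consumes 1, case_names one step]:
  assumes "g \<in> carrier S" "P \<one>\<^bsub>S\<^esub>"
    and "\<And>h g. h \<in> H \<Longrightarrow> g \<in> carrier S \<Longrightarrow> P g \<Longrightarrow> P (h \<cdot> g)"
  shows "P g"
  using SL.generating_induct[OF H_carrier inv_in_H generates assms(1), of P] assms(2,3) by blast

lemma moves_line:
  assumes "nz e"
  shows "\<exists>h\<in>H. \<not> maps h e e"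
proof (rule ccontr)
  assume no: "\<not> (\<exists>h\<in>H. \<not> maps h e e)"
  have all: "maps g e e" if "g \<in> carrier S" for g
    using that
  proof (induction rule: H_induct)
    case one
    show ?case by (rule maps_one)
  next
    case (step h g)
    then show ?case using no H_carrier assms maps_mult[of h g e e e] by blast
  qed
  obtain g where "g \<in> carrier S" "\<not> par e (app g e)" using three_images[OF assms] by blast
  then show False using all[of g] by (simp add: maps_def par_sym)
qed

text \<open>Otherwise some h1 in H takes e to e', and since h e' is the image of e under h h1, every
  h in H preserves the pair of lines e, e'. By generation the whole group would preserve it, against
  \<open>three_images\<close>.\<close>

lemma moves_line_off_two:
  assumes e: "nz e" "nz e'"
  obtains g where "g \<in> Q 2" "\<not> maps g e e" "\<not> maps g e e'"
proof -
  have "\<exists>g\<in>Q 2. \<not> maps g e e \<and> \<not> maps g e e'"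
  proof (rule ccontr)
    assume "\<not> ?thesis"
    then have no: "maps g e e \<or> maps g e e'" if "g \<in> Q 2" for g using that by blast
    obtain h1 where h1: "h1 \<in> H" "\<not> maps h1 e e" using moves_line[OF e(1)] by blast
    have H2: "H \<subseteq> Q 2" using Q_mono[of 1 2] Q_1 by auto
    have h1': "maps h1 e e'" using no h1 H2 by blast
    have all: "maps g e e \<or> maps g e e'" if "g \<in> carrier S" for g
      using that
    proof (induction rule: H_induct)
      case one
      show ?case using maps_one by blast
    next
      case (step h g)
      have hG: "h \<in> carrier S" "h1 \<in> carrier S" using step h1 H_carrier by auto
      show ?case
      proof (cases "maps g e e")
        case True
        have "maps h e e \<or> maps h e e'" using no step H2 by blast
        then show ?thesis using maps_mult[OF hG(1) True] e by blast
      next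
        case False
        then have g: "maps g e e'" using step by blast
        have "h \<cdot> h1 \<in> Q 2" using step h1 by (intro Q_mult[of _ 1 _ 1] H_Q) auto
        then have hh: "maps (h \<cdot> h1) e e \<or> maps (h \<cdot> h1) e e'" by (rule no)
        have "maps h e' k" if "maps (h \<cdot> h1) e k" for k
        proof -
          have "maps (h \<cdot> h1 \<cdot> \<iota> h1) e' k"
            by (rule maps_mult[OF _ maps_inv[OF hG(2) h1'] that e(1)]) (use hG in simp)
          then show ?thesis using hG by (simp add: SL.m_assoc)
        qed
        then show ?thesis using hh maps_mult[OF hG(1) g] e by blast
      qed
    qed
    obtain g h where gh: "g \<in> carrier S" "h \<in> carrier S" "\<not> par e (app g e)" "\<not> par e (app h e)"
      "\<not> par (app g e) (app h e)" using three_images[OF e(1)] by blast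
    have "par (app g e) e'" "par (app h e) e'"
      using all[OF gh(1)] all[OF gh(2)] gh par_sym unfolding maps_def by blast+
    then show False using gh(5) par_trans par_sym e(2) by blast
  qed
  then show thesis using that by blast
qed

text \<open>Take a moving f and b moving f'. If a fixes f' and b fixes f, then the product a b moves
  both.\<close>

lemma moves_two_lines:
  assumes f: "nz f" "nz f'"
  obtains v where "v \<in> Q 2" "\<not> maps v f f" "\<not> maps v f' f'"
proof -
  obtain a where a: "a \<in> H" "\<not> maps a f f" using moves_line[OF f(1)] by blast
  obtain b where b: "b \<in> H" "\<not> maps b f' f'" using moves_line[OF f(2)] by blast
  have H2: "H \<subseteq> Q 2" using Q_mono[of 1 2] Q_1 by auto
  have ab: "a \<in> carrier S" "b \<in> carrier S" using a b H_carrier by auto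
  consider "\<not> maps a f' f'" | "\<not> maps b f f" | "maps a f' f'" "maps b f f" by blast
  then show thesis
  proof cases
    case 1
    then show thesis using that[of a] a H2 by blast
  next
    case 2
    then show thesis using that[of b] b H2 by blast
  next
    case 3
    show thesis
    proof (rule that[of "a \<cdot> b"])
      show "a \<cdot> b \<in> Q 2" using a b by (intro Q_mult[of _ 1 _ 1] H_Q) auto
      show "\<not> maps (a \<cdot> b) f f"
      proof
        assume m: "maps (a \<cdot> b) f f"
        have "maps (a \<cdot> b \<cdot> \<iota> b) f f"
          using ab by (intro maps_mult[OF _ maps_inv[OF ab(2) 3(2)] m f(1)]) auto
        then show False using a ab by (simp add: SL.m_assoc)
      qed
      show "\<not> maps (a \<cdot> b) f' f'"
      proof
        assume m: "maps (a \<cdot> b) f' f'"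
        have "maps (\<iota> a \<cdot> (a \<cdot> b)) f' f'"
          using ab by (intro maps_mult[OF _ m maps_inv[OF ab(1) 3(1)] f(2)]) auto
        then show False using b ab by (simp add: SL.m_assoc[symmetric])
      qed
    qed
  qed
qed

text \<open>
  If \<open>g\<close> moves \<open>e\<close> away from \<open>e\<close> and \<open>e'\<close>, then the map \<open>(x, y) \<mapsto> x g x\<^sub>0\<^sup>-\<^sup>1 y\<close> has small fibres on the
  square of the slice: the product sends \<open>e\<close> to \<open>x g e\<close>, so it determines the image of a second line
  under \<open>x\<close>.
\<close>

lemma card_trace_line_slice:
  assumes e: "nz e" "nz e'"
  shows "real (card {x \<in> {x \<in> Q 6. Z (tr x - t)}. maps x e e'}) \<le> sqrt (2 * real (card (Q 20)))"
    (is "real (card ?X) \<le> _")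
proof (cases "?X = {}")
  case True
  have "0 \<le> sqrt (2 * real (card (Q 20)))" by simp
  then show ?thesis unfolding True by (simp only: card.empty of_nat_0)
next
  case False
  then obtain x0 where x0: "x0 \<in> ?X" by blast
  obtain g where g: "g \<in> Q 2" "\<not> maps g e e" "\<not> maps g e e'"
    using moves_line_off_two[OF e] by blast
  have gG: "g \<in> carrier S" "x0 \<in> carrier S" using g x0 Q_carrier by auto
  have finX: "finite ?X" using finite_Q by simp
  define m where "m = app g e"
  have nzm: "nz m" using nz_app[OF gG(1) e(1)] by (simp add: m_def)
  \<comment> \<open>Here y takes e to e' and \<open>x0\<close> inverse returns it to e. The word
    length 6 + 2 + 6 + 6 is the origin of the 20.\<close>
  let ?f = "\<lambda>(x, y). x \<cdot> g \<cdot> \<iota> x0 \<cdot> y"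
  have "card (?X \<times> ?X) \<le> 2 * card (Q 20)"
  proof (rule card_le_fibres[where f = ?f])
    have "x \<cdot> g \<cdot> \<iota> x0 \<cdot> y \<in> Q 20" if "x \<in> Q 6" "y \<in> Q 6" for x y
    proof -
      have "x \<cdot> g \<in> Q 8" using that g by (intro Q_mult[of _ 6 _ 2]) auto
      moreover have "\<iota> x0 \<in> Q 6" using x0 by (intro Q_inv) simp
      ultimately have "x \<cdot> g \<cdot> \<iota> x0 \<in> Q 14" by (rule Q_mult) simp
      then show ?thesis using that(2) by (rule Q_mult) simp
    qed
    then show "?f ` (?X \<times> ?X) \<subseteq> Q 20" by auto
    fix z assume z: "z \<in> Q 20"
    have zG: "z \<in> carrier S" using z Q_carrier by auto
    have "card {t \<in> ?X \<times> ?X. ?f t = z} \<le>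
        card {x \<in> carrier S. Z (tr x - t) \<and> maps x e e' \<and> maps x m (app z e)}"
    proof (rule card_inj_on_le[where f = fst])
      show "inj_on fst {t \<in> ?X \<times> ?X. ?f t = z}"
      proof (rule inj_onI)
        fix s t assume st: "s \<in> {t \<in> ?X \<times> ?X. ?f t = z}" "t \<in> {t \<in> ?X \<times> ?X. ?f t = z}" "fst s = fst t"
        obtain x y y' where s: "s = (x, y)" "t = (x, y')" using st(3) by (metis prod.collapse)
        have c: "x \<in> carrier S" "y \<in> carrier S" "y' \<in> carrier S" using st s Q_carrier by auto
        have "x \<cdot> g \<cdot> \<iota> x0 \<cdot> y = x \<cdot> g \<cdot> \<iota> x0 \<cdot> y'" using st s by simp
        then show "s = t" using s c gG by simp
      qed
      show "fst ` {t \<in> ?X \<times> ?X. ?f t = z} \<subseteq> {x \<in> carrier S. Z (tr x - t) \<and> maps x e e' \<and> maps x m (app z e)}"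
      proof
        fix x' assume "x' \<in> fst ` {t \<in> ?X \<times> ?X. ?f t = z}"
        then obtain x y where x': "x' = x" and x: "x \<in> Q 6" "Z (tr x - t)" "maps x e e'"
          and y: "y \<in> Q 6" "maps y e e'"
          and z: "z = x \<cdot> g \<cdot> \<iota> x0 \<cdot> y" by fastforce
        have c: "x \<in> carrier S" "y \<in> carrier S" using x y Q_carrier by auto
        have i: "maps (\<iota> x0) e' e" using x0 gG by (intro maps_inv) auto
        have xg: "maps (x \<cdot> g) e (app x m)"
          unfolding m_def using c(1) gG(1) e(1) by (intro maps_mult[OF _ maps_app maps_app] nz_app)
        have "maps (x \<cdot> g \<cdot> \<iota> x0) e' (app x m)"
          using c gG by (intro maps_mult[OF _ i xg e(1)]) auto
        then have "maps (x \<cdot> g \<cdot> \<iota> x0 \<cdot> y) e (app x m)"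
          using c gG by (intro maps_mult[OF _ y(2) _ e(2)]) auto
        then have "par (app z e) (app x m)" by (simp only: maps_def z)
        then show "x' \<in> {x \<in> carrier S. Z (tr x - t) \<and> maps x e e' \<and> maps x m (app z e)}"
          using x c par_sym[OF \<open>par (app z e) (app x m)\<close>] unfolding x' maps_def by blast
      qed
    qed (simp add: finite_carrier)
    also have "\<dots> \<le> 2"
    proof (rule card_trace_two_lines)
      show "nz (app z e)" using nz_app[OF zG e(1)] .
      show "\<not> par e m" "\<not> par e' m" using g par_sym unfolding maps_def m_def by blast+
    qed (use e nzm in auto)
    finally show "card {t \<in> ?X \<times> ?X. ?f t = z} \<le> 2" .
  qed (use finX finite_Q in auto)
  then have "card ?X * card ?X \<le> 2 * card (Q 20)" by (simp only: card_cartesian_product)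
  then have "real (card ?X * card ?X) \<le> real (2 * card (Q 20))" by (rule of_nat_mono)
  then have "real (card ?X) * real (card ?X) \<le> 2 * real (card (Q 20))"
    by (simp only: of_nat_mult of_nat_numeral)
  then show ?thesis by (intro real_le_rsqrt) (simp only: power2_eq_square)
qed

text \<open>
  A Larsen--Pink inequality for the two-dimensional variety of given trace: by \<open>card_three_traces\<close>, applied to
  \<open>y\<^sup>-\<^sup>1\<close>, the map \<open>(x, y, z) \<mapsto> (x y, y z)\<close> has fibres of size at most two where \<open>disc\<close> does not vanish.
\<close>

lemma card_trace_class:
  assumes t: "\<not> Z t"
  shows "real (card {x \<in> Q 6. Z (tr x - t)}) ^ 3 \<le> 2744 * real (card (Q 20)) ^ 2"
proof -
  define X where "X = {x \<in> Q 6. Z (tr x - t)}"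
  define n where "n = real (card (Q 20))"
  define M where "M = sqrt (2 * n)"
  define k where "k = real (card X)"
  have finX: "finite X" using finite_Q by (simp add: X_def)
  have XG: "X \<subseteq> carrier S" using Q_carrier by (auto simp: X_def)
  have n1: "n \<ge> 1" using card_Q_pos[of 20] by (simp add: n_def)
  have M: "real (card {z \<in> X. maps z e e'}) \<le> M" if "nz e" "nz e'" for e e'
    unfolding X_def M_def n_def by (rule card_trace_line_slice[OF that])
  have M0: "M \<ge> 0" using n1 by (simp add: M_def)
  define T where "T = {((x, y), z) \<in> (X \<times> X) \<times> X. \<not> Z (disc (x \<cdot> y) (y \<cdot> z))}"
  define B where "B = {((x, y), z) \<in> (X \<times> X) \<times> X. Z (disc (x \<cdot> y) (y \<cdot> z))}"
  have finTB: "finite T" "finite B"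
    using finX by (auto simp: T_def B_def intro: finite_subset[of _ "(X \<times> X) \<times> X"])
  have T_le: "real (card T) \<le> 2 * n\<^sup>2"
  proof -
    let ?f = "\<lambda>((x, y), z). (x \<cdot> y, y \<cdot> z)"
    have "card T \<le> 2 * card (Q 20 \<times> Q 20)"
    proof (rule card_le_fibres[where f = ?f])
      have "x \<cdot> y \<in> Q 20" if "x \<in> X" "y \<in> X" for x y
        using that Q_mult[of x 6 y 6 12] Q_mono[of 12 20] by (auto simp: X_def)
      then show "?f ` T \<subseteq> Q 20 \<times> Q 20" by (auto simp: T_def)
      fix w assume "w \<in> Q 20 \<times> Q 20"
      obtain u v where w: "w = (u, v)" by (cases w)
      show "card {s \<in> T. ?f s = w} \<le> 2"
      proof (cases "Z (disc u v)")
        case True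
        then have "{s \<in> T. ?f s = w} = {}" by (auto simp: T_def w)
        then show ?thesis by (simp only: card.empty)
      next
        case False
        have "card {s \<in> T. ?f s = w} \<le> card {w \<in> carrier S. Z (tr w - t) \<and> Z (tr (u \<cdot> w) - t) \<and> Z (tr (v \<cdot> w) - t)}"
        proof (rule card_inj_on_le[where f = "\<lambda>((x, y), z). \<iota> y"])
          show "inj_on (\<lambda>((x, y), z). \<iota> y) {s \<in> T. ?f s = w}"
          proof (rule inj_onI)
            fix s s' assume ss: "s \<in> {s \<in> T. ?f s = w}" "s' \<in> {s \<in> T. ?f s = w}"
              "(\<lambda>((x, y), z). \<iota> y) s = (\<lambda>((x, y), z). \<iota> y) s'"
            obtain x y z x' y' z' where s: "s = ((x, y), z)" "s' = ((x', y'), z')" by (metis surj_pair)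
            have 1: "((x, y), z) \<in> T" "?f ((x, y), z) = w" and 2: "((x', y'), z') \<in> T" "?f ((x', y'), z') = w"
              and y: "\<iota> y = \<iota> y'" using ss s by auto
            have c: "x \<in> carrier S" "y \<in> carrier S" "z \<in> carrier S" "x' \<in> carrier S" "y' \<in> carrier S" "z' \<in> carrier S"
              using 1 2 XG by (auto simp: T_def)
            have yy: "y = y'" using y c by (metis SL.inv_inv)
            have "x \<cdot> y = x' \<cdot> y" "y \<cdot> z = y \<cdot> z'" using 1 2 yy by (simp_all add: w)
            then show "s = s'" using c yy s by simp
          qed
          show "(\<lambda>((x, y), z). \<iota> y) ` {s \<in> T. ?f s = w} \<subseteq>
              {w \<in> carrier S. Z (tr w - t) \<and> Z (tr (u \<cdot> w) - t) \<and> Z (tr (v \<cdot> w) - t)}"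
          proof
            fix k assume "k \<in> (\<lambda>((x, y), z). \<iota> y) ` {s \<in> T. ?f s = w}"
            then obtain x y z where k: "k = \<iota> y" and xyz: "((x, y), z) \<in> T" and f: "?f ((x, y), z) = w"
              by auto
            have c: "x \<in> carrier S" "y \<in> carrier S" "z \<in> carrier S"
              and tr: "Z (tr x - t)" "Z (tr y - t)" "Z (tr z - t)"
              using xyz XG by (auto simp: T_def X_def)
            have uv: "u = x \<cdot> y" "v = y \<cdot> z" using f w by auto
            have "u \<cdot> \<iota> y = x" using c by (simp add: uv SL.m_assoc)
            moreover have "Z (tr (v \<cdot> \<iota> y) - tr z)"
              unfolding uv using tr_conj c by simp
            then have "Z (tr (v \<cdot> \<iota> y) - t)" using tr(3) by Groebner_Basis.algebra
            moreover have "Z (tr (\<iota> y) - t)" using tr_inv[OF c(2)] tr(2) by Groebner_Basis.algebra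
            ultimately show "k \<in> {w \<in> carrier S. Z (tr w - t) \<and> Z (tr (u \<cdot> w) - t) \<and> Z (tr (v \<cdot> w) - t)}"
              using c tr by (simp add: k)
          qed
        qed (simp add: finite_carrier)
        also have "\<dots> \<le> 2" by (rule card_three_traces[OF False])
        finally show ?thesis .
      qed
    qed (use finTB finite_Q in auto)
    then have "real (card T) \<le> real (2 * card (Q 20 \<times> Q 20))" by (rule of_nat_mono)
    then show ?thesis by (simp add: card_cartesian_product n_def power2_eq_square)
  qed
  \<comment> \<open>For a given y at most two x make x y scalar, and for these all z are allowed: 2
    k triples. Every other x allows at most 2 + 2 M elements z by
    \<open>card_disc_zero\<close>.\<close>
  have B_le: "real (card B) \<le> k\<^sup>2 * (2 * M + 4)"
  proof -
    define b where "b x y = card {z \<in> X. Z (disc (x \<cdot> y) (y \<cdot> z))}" for x y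
    have "card B = (\<Sum>t\<in>X \<times> X. b (fst t) (snd t))"
    proof -
      have "B = {(t, z) \<in> (X \<times> X) \<times> X. Z (disc (fst t \<cdot> snd t) (snd t \<cdot> z))}"
        by (auto simp: B_def)
      then show ?thesis unfolding b_def using finX by (simp only: card_pairs_sum finite_cartesian_product)
    qed
    also have "\<dots> = (\<Sum>x\<in>X. \<Sum>y\<in>X. b x y)" by (simp add: sum.cartesian_product split_def)
    also have "\<dots> = (\<Sum>y\<in>X. \<Sum>x\<in>X. b x y)" by (rule sum.swap)
    finally have "real (card B) = (\<Sum>y\<in>X. \<Sum>x\<in>X. real (b x y))" by simp
    also have "\<dots> \<le> (\<Sum>y\<in>X. k * (2 * M + 4))"
    proof (rule sum_mono)
      fix y assume y: "y \<in> X"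
      have yG: "y \<in> carrier S" "Z (tr y - t)" using y XG by (auto simp: X_def)
      have "(\<Sum>x\<in>X. real (b x y)) \<le> (\<Sum>x\<in>X. (2 + 2 * M) + (if scal (x \<cdot> y) then k else 0))"
      proof (rule sum_mono)
        fix x assume x: "x \<in> X"
        have xG: "x \<in> carrier S" "Z (tr x - t)" using x XG by (auto simp: X_def)
        show "real (b x y) \<le> (2 + 2 * M) + (if scal (x \<cdot> y) then k else 0)"
        proof (cases "scal (x \<cdot> y)")
          case True
          have "b x y \<le> card X" unfolding b_def using finX by (intro card_mono) auto
          then show ?thesis using True M0 by (simp add: k_def)
        next
          case False
          have "X \<subseteq> {x \<in> carrier S. Z (tr x - t)}" using XG by (auto simp: X_def)
          then show ?thesis using card_disc_zero[OF _ t xG yG False M] False by (simp add: b_def)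
        qed
      qed
      also have "\<dots> = k * (2 + 2 * M) + real (card {x \<in> X. scal (x \<cdot> y)}) * k"
        using finX by (simp add: sum.distrib sum.If_cases k_def Int_def)
      also have "\<dots> \<le> k * (2 + 2 * M) + 2 * k"
      proof -
        have "card {x \<in> X. scal (x \<cdot> y)} \<le> card {g \<in> carrier S. scal g}"
          by (rule card_inj_on_le[where f = "\<lambda>x. x \<cdot> y"])
            (use XG yG finite_carrier in \<open>auto simp: inj_on_def subset_iff\<close>)
        then have "real (card {x \<in> X. scal (x \<cdot> y)}) \<le> 2" using card_scal by linarith
        then show ?thesis by (intro add_left_mono mult_right_mono) (auto simp: k_def)
      qed
      also have "\<dots> = k * (2 * M + 4)" by (simp add: algebra_simps)
      finally show "(\<Sum>x\<in>X. real (b x y)) \<le> k * (2 * M + 4)" .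
    qed
    also have "\<dots> = k\<^sup>2 * (2 * M + 4)" by (simp add: k_def power2_eq_square)
    finally show ?thesis .
  qed
  have "card ((X \<times> X) \<times> X) = card T + card B"
  proof -
    have "(X \<times> X) \<times> X = T \<union> B" "T \<inter> B = {}" by (auto simp: T_def B_def)
    then show ?thesis using finTB by (simp add: card_Un_disjoint)
  qed
  then have "card X * card X * card X = card T + card B" by (simp only: card_cartesian_product)
  then have "real (card X * card X * card X) = real (card T + card B)" by (rule arg_cong)
  then have "k ^ 3 = real (card T) + real (card B)" by (simp add: k_def power3_eq_cube)
  then have main: "k ^ 3 \<le> 2 * n\<^sup>2 + k\<^sup>2 * (2 * M + 4)" using T_le B_le by linarith
  have k0: "k \<ge> 0" by (simp add: k_def)
  have "k ^ 3 \<le> 2744 * n\<^sup>2"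
  \<comment> \<open>Either the degenerate term is at most half of k^3, or k is at most a multiple of
    sqrt n: with M at most 3/2 sqrt n the multiple is 14, and 2744 = 14^3.\<close>
  proof (cases "k \<le> 2 * (2 * M + 4)")
    case True
    have sn: "sqrt n \<ge> 1" using n1 by simp
    have "M \<le> 3 / 2 * sqrt n"
    proof -
      have "sqrt 2 \<le> 3 / 2" by (rule real_le_lsqrt) (auto simp: power2_eq_square)
      then have "sqrt 2 * sqrt n \<le> 3 / 2 * sqrt n" using sn by (intro mult_right_mono) auto
      then show ?thesis by (simp add: M_def real_sqrt_mult)
    qed
    then have "2 * (2 * M + 4) \<le> 2 * (2 * (3 / 2 * sqrt n) + 4 * sqrt n)"
      using sn by (intro mult_left_mono add_mono) auto
    with True have "k \<le> 14 * sqrt n" by simp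
    then have "k ^ 3 \<le> (14 * sqrt n) ^ 3" using k0 by (intro power_mono)
    also have "\<dots> = 2744 * (n * sqrt n)"
      using n1 by (simp add: power3_eq_cube)
    also have "\<dots> \<le> 2744 * (n * n)"
    proof -
      have "sqrt n \<le> sqrt (n * n)" using n1 by (intro real_sqrt_le_mono) (simp add: mult_le_cancel_left1)
      then have "sqrt n \<le> n" using n1 by simp
      then show ?thesis using n1 by (intro mult_left_mono) auto
    qed
    finally show ?thesis by (simp add: power2_eq_square)
  next
    case False
    then have "k\<^sup>2 * (2 * M + 4) \<le> k\<^sup>2 * (k / 2)" by (intro mult_left_mono) auto
    then have "k ^ 3 \<le> 2 * n\<^sup>2 + k ^ 3 / 2" using main by (simp add: power2_eq_square power3_eq_cube)
    then have "k ^ 3 \<le> 4 * n\<^sup>2" by simp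
    also have "\<dots> \<le> 2744 * n\<^sup>2" by (intro mult_right_mono) auto
    finally show ?thesis .
  qed
  then show ?thesis by (simp add: k_def X_def n_def)
qed


text \<open>By \<open>disc_zero_cases\<close> it suffices that u and v neither commute nor share an
  eigenline. If u has no eigenline, any v in H not commuting with u will do; otherwise v is chosen
  to move all eigenlines of u, which may take a product of two elements.\<close>

lemma noncommuting_pair:
  obtains u v where "u \<in> H" "v \<in> Q 2" "\<not> Z (disc u v)"
proof -
  have "\<exists>u\<in>H. \<not> scal u"
  proof (rule ccontr)
    assume no: "\<not> (\<exists>u\<in>H. \<not> scal u)"
    obtain h where h: "h \<in> H" "\<not> maps h (1, 0) (1, 0)"
      using moves_line[of "(1, 0)"] Z_1 by (auto simp: nz_def)
    then have "scal h" using no by blast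
    then have "maps h (1, 0) (1, 0)" by (simp add: scal_def maps_def par_def cross_def app_def)
    then show False using h by simp
  qed
  then obtain u where u: "u \<in> H" "\<not> scal u" by blast
  have uG: "u \<in> carrier S" using u H_carrier by auto
  show thesis
  proof (cases "\<exists>f. nz f \<and> maps u f f")
    case False
    have "\<exists>v\<in>H. \<not> commutes u v"
    proof (rule ccontr)
      assume no: "\<not> (\<exists>v\<in>H. \<not> commutes u v)"
      have all: "commutes u g" if "g \<in> carrier S" for g
        using that
      proof (induction rule: H_induct)
        case one
        show ?case using uG by (simp add: commutes_iff_mult)
      next
        case (step h g)
        have hG: "h \<in> carrier S" using step H_carrier by auto
        have "u \<cdot> h = h \<cdot> u" "u \<cdot> g = g \<cdot> u"
          using no step uG hG commutes_iff_mult by blast+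
        then have "u \<cdot> (h \<cdot> g) = h \<cdot> g \<cdot> u"
          using uG hG step(2) by (metis SL.m_assoc)
        then show ?case using uG hG step(2) by (simp add: commutes_iff_mult)
      qed
      \<comment> \<open>If u were central, it would commute with a unipotent matrix and hence
        inherit its eigenline (1, 0).\<close>
      have m: "1 mod int p = 1" using p_gt_3 by simp
      have "mk 1 1 0 1 \<in> carrier S" by (rule mk_carrier) simp
      then have "commutes u (mk 1 1 0 1)" by (rule all)
      moreover have "maps (mk 1 1 0 1) (1, 0) (1, 0)"
        unfolding maps_def par_def cross_def app_def mk_entries m mod_0 by simp
      moreover have "\<not> scal (mk 1 1 0 1)" unfolding scal_def mk_entries m using Z_1 by simp
      ultimately have "maps u (1, 0) (1, 0)" using commutes_eigen commutes_sym by blast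
      moreover have "nz (1, 0)" using Z_1 by (simp add: nz_def)
      ultimately show False using False by blast
    qed
    then obtain v where v: "v \<in> H" "\<not> commutes u v" by blast
    then have "\<not> Z (disc u v)" using disc_zero_cases False by blast
    moreover have "v \<in> Q 2" using v Q_mono[of 1 2] Q_1 by auto
    ultimately show thesis using that u by blast
  next
    case True
    then obtain f where f: "nz f" "maps u f f" by blast
    \<comment> \<open>If u has a single eigenline, f' is f itself.\<close>
    obtain f' where f': "nz f'" "maps u f' f'" "\<And>k. nz k \<Longrightarrow> maps u k k \<Longrightarrow> par k f \<or> par k f'"
    proof (cases "\<exists>f'. nz f' \<and> maps u f' f' \<and> \<not> par f' f")
      case True
      then obtain f' where f': "nz f'" "maps u f' f'" "\<not> par f' f" by blast
      have "par k f \<or> par k f'" if "nz k" "maps u k k" for k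
        using three_lines_scal[of u f f' k] f f' that u par_sym by blast
      then show thesis using that f' by blast
    next
      case False
      then show thesis using that[OF f] by blast
    qed
    obtain v where v: "v \<in> Q 2" "\<not> maps v f f" "\<not> maps v f' f'"
      using moves_two_lines[OF f(1) f'(1)] by blast
    have vG: "v \<in> carrier S" using v Q_carrier by auto
    have "\<not> Z (disc u v)"
    proof
      assume "Z (disc u v)"
      then consider "commutes u v" | k where "nz k" "maps u k k" "maps v k k"
        using disc_zero_cases by blast
      then show False
      proof cases
        case 1
        then show False using commutes_eigen u f v by blast
      next
        case 2
        have "maps v h h" if "par k h" "nz h" for h
          using maps_par_right[OF maps_par_left[OF vG 2(3) that(1) 2(1)] that(1) 2(1)] .
        then show False using f'(3)[OF 2(1,2)] f(1) f'(1) v by blast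
      qed
    qed
    then show thesis using that u v by blast
  qed
qed

text \<open>If \<open>Q 3\<close> had only the traces 0, 2 and -2, then the traces of y, u y and v y
  for y in H would take at most 27 values, each for at most two y; hence the bound 54 = 2 * 27. The
  factor v in \<open>Q 2\<close> accounts for \<open>Q 3\<close>.\<close>

lemma regular_element:
  assumes "card H > 54"
  obtains h where "h \<in> Q 3" "\<not> Z (tr h)" "\<not> Z ((tr h)\<^sup>2 - 4)"
proof -
  have "\<exists>h\<in>Q 3. \<not> Z (tr h) \<and> \<not> Z ((tr h)\<^sup>2 - 4)"
  proof (rule ccontr)
    assume no: "\<not> ?thesis"
    define R where "R = {0, 2 mod int p, (- 2) mod int p}"
    have tr_R: "tr h mod int p \<in> R" if "h \<in> Q 3" for h
    proof -
      have "Z (tr h) \<or> Z ((tr h)\<^sup>2 - 4)" using no that by blast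
      moreover have "(tr h)\<^sup>2 - 4 = (tr h - 2) * (tr h + 2)" by (simp add: power2_eq_square algebra_simps)
      ultimately have "Z (tr h) \<or> Z (tr h - 2) \<or> Z (tr h - - 2)" by (auto simp: Z_mult)
      then show ?thesis by (auto simp: R_def mod_eq_dvd_iff)
    qed
    obtain u v where uv: "u \<in> H" "v \<in> Q 2" "\<not> Z (disc u v)" using noncommuting_pair by blast
    let ?f = "\<lambda>y. (tr y mod int p, tr (u \<cdot> y) mod int p, tr (v \<cdot> y) mod int p)"
    have finR: "finite R" "card R \<le> 3" by (auto simp: R_def card_insert_if)
    have "card H \<le> 2 * card (R \<times> R \<times> R)"
    proof (rule card_le_fibres[where f = ?f])
      show "finite H" using H_carrier finite_carrier finite_subset by blast
      have "y \<in> Q 3" "u \<cdot> y \<in> Q 3" "v \<cdot> y \<in> Q 3" if "y \<in> H" for y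
      proof -
        have y: "y \<in> Q 1" by (rule H_Q[OF that])
        then show "y \<in> Q 3" using Q_mono[of 1 3] by auto
        have "u \<cdot> y \<in> Q 2" using y H_Q[OF uv(1)] by (intro Q_mult[of _ 1 _ 1]) auto
        then show "u \<cdot> y \<in> Q 3" using Q_mono[of 2 3] by auto
        show "v \<cdot> y \<in> Q 3" using y uv by (intro Q_mult[of _ 2 _ 1]) auto
      qed
      then show "?f ` H \<subseteq> R \<times> R \<times> R" using tr_R by auto
      fix z assume "z \<in> R \<times> R \<times> R"
      obtain a b c where z: "z = (a, b, c)" by (cases z)
      have "{t \<in> H. ?f t = z} \<subseteq> {w \<in> carrier S. Z (tr w - a) \<and> Z (tr (u \<cdot> w) - b) \<and> Z (tr (v \<cdot> w) - c)}"
        using H_carrier by (auto simp: z dvd_minus_mod dvd_diff_commute)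
      then have "card {t \<in> H. ?f t = z} \<le>
          card {w \<in> carrier S. Z (tr w - a) \<and> Z (tr (u \<cdot> w) - b) \<and> Z (tr (v \<cdot> w) - c)}"
        by (intro card_mono) (simp_all add: finite_carrier)
      also have "\<dots> \<le> 2" by (rule card_three_traces[OF uv(3)])
      finally show "card {t \<in> H. ?f t = z} \<le> 2" .
    qed (use finR in simp)
    also have "card (R \<times> R \<times> R) \<le> 3 * (3 * 3)"
      unfolding card_cartesian_product using finR by (intro mult_mono) auto
    finally show False using assms by simp
  qed
  then show thesis using that by blast
qed


section \<open>Tori and the pivot argument\<close>

definition centr :: "int^2^2 \<Rightarrow> (int^2^2) set" where
  "centr u = {g \<in> carrier S. commutes u g}"

text \<open>Orbit and stabilizer for H acting on h by conjugation: the orbit lies in the slice of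
  \<open>Q 6\<close> with the trace of h (word length 1 + 4 + 1), which has at most |H| / l
  elements, and each fibre translates into the centralizer of h inside \<open>Q 2\<close>.\<close>

lemma card_torus_lower:
  fixes l :: real
  assumes l: "\<And>t. \<not> Z t \<Longrightarrow> l * real (card {x \<in> Q 6. Z (tr x - t)}) \<le> real (card H)"
    and h: "h \<in> Q 4" "\<not> Z (tr h)"
  shows "l \<le> real (card (Q 2 \<inter> centr h))"
proof (rule ccontr)
  assume less: "\<not> l \<le> real (card (Q 2 \<inter> centr h))"
  have hG: "h \<in> carrier S" using h Q_carrier by auto
  define X where "X = {x \<in> Q 6. Z (tr x - tr h)}"
  let ?f = "\<lambda>a. a \<cdot> h \<cdot> \<iota> a"
  have finX: "finite X" using finite_Q by (simp add: X_def)
  have finH: "finite H" using H_carrier finite_carrier finite_subset by blast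
  have fX: "?f ` H \<subseteq> X"
  proof
    fix z assume "z \<in> ?f ` H"
    then obtain a where a: "a \<in> H" "z = ?f a" by blast
    have aG: "a \<in> carrier S" using a H_carrier by auto
    have "a \<cdot> h \<in> Q 5" using H_Q[OF a(1)] h(1) by (rule Q_mult) simp
    then have "z \<in> Q 6" unfolding a(2) using Q_inv[OF H_Q[OF a(1)]] by (rule Q_mult) simp
    then show "z \<in> X" using tr_conj[OF aG hG] by (simp add: X_def a)
  qed
  have fib: "card {a \<in> H. ?f a = z} \<le> card (Q 2 \<inter> centr h)" for z
  proof (cases "{a \<in> H. ?f a = z} = {}")
    case True
    then show ?thesis by (simp only: card.empty)
  next
    case False
    then obtain a0 where a0: "a0 \<in> H" "?f a0 = z" by blast
    have a0G: "a0 \<in> carrier S" using a0 H_carrier by auto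
    show ?thesis
    proof (rule card_inj_on_le[where f = "\<lambda>a. \<iota> a0 \<cdot> a"])
      show "inj_on (\<lambda>a. \<iota> a0 \<cdot> a) {a \<in> H. ?f a = z}"
        using a0G H_carrier by (auto simp: inj_on_def subset_iff)
      show "(\<lambda>a. \<iota> a0 \<cdot> a) ` {a \<in> H. ?f a = z} \<subseteq> Q 2 \<inter> centr h"
      proof
        fix k assume "k \<in> (\<lambda>a. \<iota> a0 \<cdot> a) ` {a \<in> H. ?f a = z}"
        then obtain a where a: "a \<in> H" "?f a = z" "k = \<iota> a0 \<cdot> a" by blast
        have aG: "a \<in> carrier S" using a H_carrier by auto
        have "k \<in> Q 2" unfolding a(3) using Q_inv[OF H_Q[OF a0(1)]] H_Q[OF a(1)] by (rule Q_mult) simp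
        moreover have "h \<cdot> k = k \<cdot> h"
        proof -
          have "\<iota> a0 \<cdot> (a0 \<cdot> h \<cdot> \<iota> a0) \<cdot> a = \<iota> a0 \<cdot> (a \<cdot> h \<cdot> \<iota> a) \<cdot> a"
            using a0(2) a(2) by simp
          moreover have "\<iota> a0 \<cdot> (a0 \<cdot> h \<cdot> \<iota> a0) \<cdot> a = h \<cdot> k"
            using a0G aG hG by (simp add: a(3) SL.m_assoc[symmetric])
          moreover have "\<iota> a0 \<cdot> (a \<cdot> h \<cdot> \<iota> a) \<cdot> a = k \<cdot> h"
            using a0G aG hG by (simp add: a(3) SL.m_assoc)
          ultimately show ?thesis by simp
        qed
        ultimately show "k \<in> Q 2 \<inter> centr h"
          using hG Q_carrier[of 2] by (auto simp: centr_def commutes_iff_mult subset_iff)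
      qed
    qed (simp add: finite_Q)
  qed
  have "card H \<le> card (Q 2 \<inter> centr h) * card X"
    by (rule card_le_fibres[where f = ?f]) (use finH finX fX fib in auto)
  then have "real (card H) \<le> real (card (Q 2 \<inter> centr h)) * real (card X)"
    by (simp only: of_nat_le_iff of_nat_mult[symmetric])
  moreover have "real (card (Q 2 \<inter> centr h)) * real (card X) < l * real (card X)"
  proof (rule mult_strict_right_mono)
    have "?f \<one>\<^bsub>S\<^esub> \<in> X" using fX one_in_H by blast
    then show "0 < real (card X)" using finX by (auto simp: card_gt_0_iff)
  qed (use less in simp)
  ultimately show False using l[OF h(2)] by (simp add: X_def)
qed

text \<open>
  The pivot argument: a maximal torus meeting \<open>Q 4\<close> in a regular element of nonzero trace meets \<open>Q 2\<close>
  in so many elements that this property passes to its conjugates by \<open>H\<close>, hence to all conjugates.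
\<close>

lemma card_all_tori_lower:
  fixes l :: real
  assumes l: "\<And>t. \<not> Z t \<Longrightarrow> l * real (card {x \<in> Q 6. Z (tr x - t)}) \<le> real (card H)"
    and l6: "l > 6" and h: "h \<in> Q 3" "\<not> Z (tr h)" "\<not> Z ((tr h)\<^sup>2 - 4)" and g: "g \<in> carrier S"
  shows "l \<le> real (card (Q 2 \<inter> centr (g \<cdot> h \<cdot> \<iota> g)))"
  using g
proof (induction rule: H_induct)
  case one
  have "h \<in> Q 4" "h \<in> carrier S" using h Q_mono[of 3 4] Q_carrier by auto
  then show ?case using card_torus_lower[OF l _ h(2)] by simp
next
  case (step k g)
  have hG: "h \<in> carrier S" "k \<in> carrier S" using h step H_carrier Q_carrier by auto
  define u where "u = g \<cdot> h \<cdot> \<iota> g"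
  have uG: "u \<in> carrier S" using hG step by (simp add: u_def)
  have tu: "Z (tr u - tr h)" unfolding u_def using tr_conj step(2) hG(1) by simp
  have ut: "\<not> Z ((tr u)\<^sup>2 - 4)"
  proof
    assume "Z ((tr u)\<^sup>2 - 4)"
    then have "Z ((tr h)\<^sup>2 - 4)" using tu by Groebner_Basis.algebra
    then show False using h by simp
  qed
  have nsu: "\<not> scal u" using scal_trace[OF uG] ut by blast
  \<comment> \<open>The torus of u has more than six elements in \<open>Q 2\<close>, and each of the
    traces 0, 2 and -2 accounts for at most two of them.\<close>
  have "\<exists>v \<in> Q 2 \<inter> centr u. \<not> Z (tr v) \<and> \<not> Z ((tr v)\<^sup>2 - 4)"
  proof (rule ccontr)
    assume no: "\<not> ?thesis"
    have "Q 2 \<inter> centr u \<subseteq> (\<Union>s\<in>{0, 2, -2}. {v \<in> carrier S. commutes u v \<and> Z (tr v - s)})"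
    proof
      fix v assume v: "v \<in> Q 2 \<inter> centr u"
      then have "Z (tr v) \<or> Z ((tr v)\<^sup>2 - 4)" using no by blast
      moreover have "(tr v)\<^sup>2 - 4 = (tr v - 2) * (tr v - - 2)" by (simp add: power2_eq_square algebra_simps)
      ultimately have "Z (tr v - 0) \<or> Z (tr v - 2) \<or> Z (tr v - - 2)" by (auto simp: Z_mult)
      then show "v \<in> (\<Union>s\<in>{0, 2, -2}. {v \<in> carrier S. commutes u v \<and> Z (tr v - s)})"
        using v by (auto simp: centr_def)
    qed
    then have "card (Q 2 \<inter> centr u) \<le> card (\<Union>s\<in>{0, 2, -2}. {v \<in> carrier S. commutes u v \<and> Z (tr v - s)})"
      by (intro card_mono) (auto simp: finite_carrier)
    also have "\<dots> \<le> (\<Sum>s\<in>{0, 2, -2}. card {v \<in> carrier S. commutes u v \<and> Z (tr v - s)})"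
      by (intro card_UN_le) auto
    also have "\<dots> \<le> (\<Sum>s\<in>{0, 2, -2::int}. 2)"
      by (intro sum_mono card_commutes_trace uG nsu ut)
    also have "\<dots> = 6" by simp
    finally show False using step.IH l6 by (simp add: u_def)
  qed
  then obtain v where v: "v \<in> Q 2" "v \<in> centr u" "\<not> Z (tr v)" "\<not> Z ((tr v)\<^sup>2 - 4)" by blast
  have vG: "v \<in> carrier S" using v Q_carrier by auto
  have nsv: "\<not> scal v" using scal_trace[OF vG] v(4) by blast
  \<comment> \<open>\<open>w\<close> is in \<open>Q 4\<close>, since 4 = 1 + 2 + 1, and its
    centralizer lies in that of k u k^-1. \<open>card_torus_lower\<close> applies to
    \<open>w\<close> afresh, so l does not deteriorate along the induction.\<close>
  define w where "w = k \<cdot> v \<cdot> \<iota> k"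
  have wG: "w \<in> carrier S" using vG hG by (simp add: w_def)
  have "k \<cdot> v \<in> Q 3" using H_Q[OF step(1)] v(1) by (rule Q_mult) simp
  then have w4: "w \<in> Q 4" unfolding w_def using Q_inv[OF H_Q[OF step(1)]] by (rule Q_mult) simp
  have tw: "Z (tr w - tr v)" unfolding w_def using tr_conj hG vG by simp
  have "\<not> Z (tr w)" using v(3) Z_sum_cancel[OF tw] by simp
  then have lw: "l \<le> real (card (Q 2 \<inter> centr w))" using card_torus_lower[OF l w4] by blast
  have nsw: "\<not> scal w"
  proof
    assume "scal w"
    then have "Z ((tr w)\<^sup>2 - 4)" by (rule scal_trace[OF wG])
    then have "Z ((tr v)\<^sup>2 - 4)" using tw by Groebner_Basis.algebra
    then show False using v by simp
  qed
  define u' where "u' = k \<cdot> g \<cdot> h \<cdot> \<iota> (k \<cdot> g)"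
  have u': "u' = k \<cdot> u \<cdot> \<iota> k"
    using hG step by (simp add: u'_def u_def SL.m_assoc SL.inv_mult_group)
  have u'G: "u' \<in> carrier S" using hG uG by (simp add: u')
  have uv: "u \<cdot> v = v \<cdot> u" using v(2) uG vG by (simp add: centr_def commutes_iff_mult)
  have conj: "k \<cdot> a \<cdot> \<iota> k \<cdot> (k \<cdot> b \<cdot> \<iota> k) = k \<cdot> (a \<cdot> b) \<cdot> \<iota> k"
    if "a \<in> carrier S" "b \<in> carrier S" for a b
  proof -
    have "\<iota> k \<cdot> (k \<cdot> (b \<cdot> \<iota> k)) = b \<cdot> \<iota> k"
      using that hG by (simp add: SL.m_assoc[symmetric])
    then show ?thesis using that hG by (simp add: SL.m_assoc)
  qed
  have "commutes w u'"
    using conj[OF uG vG] conj[OF vG uG] uv wG u'G by (simp add: commutes_iff_mult w_def u')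
  then have "centr w \<subseteq> centr u'" using commutes_trans[OF _ _ nsw] by (auto simp: centr_def)
  then have "card (Q 2 \<inter> centr w) \<le> card (Q 2 \<inter> centr u')" by (intro card_mono) (auto simp: finite_Q)
  then show ?case using lw unfolding u'_def by simp
qed

text \<open>Double counting of pairs (g, z) with z in \<open>Q 2\<close> non-scalar and in the torus
  of g h g^-1. Each g has at least l - 2 such z, the 2 allowing for the scalars. For given z, the
  conjugate g^-1 z g commutes with h and has the trace of z, which leaves two possibilities; each of
  these determines g up to the centralizer of z, of size at most 2 p.\<close>

lemma card_SL2_le_tori:
  fixes l :: real
  assumes lower: "\<And>g. g \<in> carrier S \<Longrightarrow> l \<le> real (card (Q 2 \<inter> centr (g \<cdot> h \<cdot> \<iota> g)))"
    and h: "h \<in> carrier S" "\<not> Z ((tr h)\<^sup>2 - 4)"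
  shows "real (card (carrier S)) * (l - 2) \<le> 4 * real p * real (card (Q 2))"
proof -
  let ?G = "carrier S"
  let ?c = "\<lambda>g. g \<cdot> h \<cdot> \<iota> g"
  define R where "R g z \<longleftrightarrow> commutes (?c g) z \<and> \<not> scal z" for g z
  have nsh: "\<not> scal h" using scal_trace h by blast
  have 1: "l - 2 \<le> real (card {z \<in> Q 2. R g z})" if g: "g \<in> ?G" for g
  proof -
    have "card (Q 2 \<inter> centr (?c g)) \<le> card ({z \<in> Q 2. R g z} \<union> {z \<in> ?G. scal z})"
      using finite_Q finite_carrier by (intro card_mono) (auto simp: R_def centr_def)
    also have "\<dots> \<le> card {z \<in> Q 2. R g z} + 2"
      using card_Un_le[of "{z \<in> Q 2. R g z}" "{z \<in> ?G. scal z}"] card_scal by linarith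
    finally show ?thesis using lower[OF g] by linarith
  qed
  have 2: "card {g \<in> ?G. R g z} \<le> 4 * p" if z: "z \<in> Q 2" for z
  proof (cases "scal z")
    case True
    then have "{g \<in> ?G. R g z} = {}" by (simp add: R_def)
    then show ?thesis by (simp only: card.empty)
  next
    case ns: False
    have zG: "z \<in> ?G" using z Q_carrier by auto
    let ?d = "\<lambda>g. \<iota> g \<cdot> z \<cdot> g"
    have d: "?d g \<in> {v \<in> ?G. commutes h v \<and> Z (tr v - tr z)} \<and> \<not> Z ((tr z)\<^sup>2 - 4)"
      if g: "g \<in> ?G" "R g z" for g
    proof -
      have cG: "?c g \<in> ?G" "?d g \<in> ?G" using g h zG by auto
      have tz: "Z (tr (?d g) - tr z)" using tr_conj[of "\<iota> g" z] g zG by simp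
      have eq: "?c g \<cdot> z = z \<cdot> ?c g" using g cG zG by (simp add: R_def commutes_iff_mult)
      have l: "\<iota> g \<cdot> (?c g \<cdot> z) \<cdot> g = h \<cdot> ?d g"
        using g h zG by (simp add: SL.m_assoc[symmetric])
      have r: "\<iota> g \<cdot> (z \<cdot> ?c g) \<cdot> g = ?d g \<cdot> h"
        using g h zG by (simp add: SL.m_assoc)
      have "commutes h (?d g)" using l r eq h cG by (simp add: commutes_iff_mult)
      moreover have "\<not> Z ((tr z)\<^sup>2 - 4)"
      proof
        assume "Z ((tr z)\<^sup>2 - 4)"
        moreover have tc: "Z (tr (?c g) - tr h)" using tr_conj g h by simp
        have "\<not> Z ((tr (?c g))\<^sup>2 - 4)"
        proof
          assume "Z ((tr (?c g))\<^sup>2 - 4)"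
          then have "Z ((tr h)\<^sup>2 - 4)" using tc by Groebner_Basis.algebra
          then show False using h by simp
        qed
        ultimately have "scal z"
          using commutes_trace_scal[OF cG(1) _ _ zG] scal_trace[OF cG(1)] g by (auto simp: R_def)
        then show False using ns by simp
      qed
      ultimately show ?thesis using cG tz by simp
    qed
    show ?thesis
    proof (cases "{g \<in> ?G. R g z} = {}")
      case True
      then show ?thesis by (simp only: card.empty)
    next
      case False
      then have tz: "\<not> Z ((tr z)\<^sup>2 - 4)" using d by blast
      define V where "V = {v \<in> ?G. commutes h v \<and> Z (tr v - tr z)}"
      have "card {g \<in> ?G. R g z} \<le> (2 * p) * card V"
      proof (rule card_le_fibres[where f = ?d])
        show "?d ` {g \<in> ?G. R g z} \<subseteq> V" using d unfolding V_def by blast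
        fix v assume "v \<in> V"
        show "card {g \<in> {g \<in> ?G. R g z}. ?d g = v} \<le> 2 * p"
        proof (cases "{g \<in> {g \<in> ?G. R g z}. ?d g = v} = {}")
          case True
          then show ?thesis by (simp only: card.empty)
        next
          case False
          then obtain g0 where g0: "g0 \<in> ?G" "?d g0 = v" by blast
          have "card {g \<in> {g \<in> ?G. R g z}. ?d g = v} \<le> card {g \<in> ?G. commutes z g}"
          proof (rule card_inj_on_le[where f = "\<lambda>g. g \<cdot> \<iota> g0"])
            show "inj_on (\<lambda>g. g \<cdot> \<iota> g0) {g \<in> {g \<in> ?G. R g z}. ?d g = v}"
              using g0 by (auto simp: inj_on_def)
            show "(\<lambda>g. g \<cdot> \<iota> g0) ` {g \<in> {g \<in> ?G. R g z}. ?d g = v} \<subseteq> {g \<in> ?G. commutes z g}"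
            proof
              fix k assume "k \<in> (\<lambda>g. g \<cdot> \<iota> g0) ` {g \<in> {g \<in> ?G. R g z}. ?d g = v}"
              then obtain g where g: "g \<in> ?G" "?d g = v" "k = g \<cdot> \<iota> g0" by blast
              have "g \<cdot> ?d g \<cdot> \<iota> g0 = g \<cdot> ?d g0 \<cdot> \<iota> g0" using g g0 by simp
              moreover have "g \<cdot> ?d g \<cdot> \<iota> g0 = z \<cdot> k"
                using g(1,3) g0(1) zG by (simp add: SL.m_assoc[symmetric])
              moreover have "g \<cdot> ?d g0 \<cdot> \<iota> g0 = k \<cdot> z"
                using g(1,3) g0(1) zG by (simp add: SL.m_assoc)
              ultimately show "k \<in> {g \<in> ?G. commutes z g}" using g g0 zG by (simp add: commutes_iff_mult)
            qed
          qed (simp add: finite_carrier)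
          also have "\<dots> \<le> 2 * p" by (rule card_centralizer[OF zG ns tz])
          finally show ?thesis .
        qed
      qed (auto simp: finite_carrier V_def)
      also have "card V \<le> 2" unfolding V_def by (rule card_commutes_trace[OF h(1) nsh h(2)])
      finally show ?thesis by simp
    qed
  qed
  have "real (card ?G) * (l - 2) = (\<Sum>g\<in>?G. l - 2)" by simp
  also have "\<dots> \<le> (\<Sum>g\<in>?G. real (card {z \<in> Q 2. R g z}))" by (intro sum_mono 1)
  also have "\<dots> = real (\<Sum>g\<in>?G. card {z \<in> Q 2. R g z})" by simp
  also have "(\<Sum>g\<in>?G. card {z \<in> Q 2. R g z}) = (\<Sum>z\<in>Q 2. card {g \<in> ?G. R g z})"
    by (rule card_pairs_swap[OF finite_carrier finite_Q])
  also have "\<dots> \<le> (\<Sum>z\<in>Q 2. 4 * p)" by (intro sum_mono 2)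
  finally show ?thesis by (simp add: mult_ac)
qed

text \<open>With l about |H|^(1/3), the count over all tori reads p^3 l <= const p K |H|, hence p^2
  <= const |H|^(2/3) up to powers of K. Cubing removes the root.\<close>

theorem helfgott_growth:
  fixes K :: real
  assumes K: "K \<ge> 1" and small: "\<And>n. n \<le> 20 \<Longrightarrow> real (card (Q n)) \<le> K * real (card H)"
    and large: "2 ^ 23 * K\<^sup>2 \<le> real (card H)"
  shows "real p ^ 6 \<le> 2 ^ 24 * K ^ 5 * real (card H) ^ 2"
proof -
  define n where "n = real (card H)"
  \<comment> \<open>This is what \<open>card_trace_class\<close> yields when |\<open>Q 20\<close>|
    is at most K n: every slice has at most n / l elements.\<close>
  define l where "l = root 3 (n / (2744 * K\<^sup>2))"
  have K2: "K\<^sup>2 \<ge> 1" using K by simp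
  have n1: "n \<ge> 2 ^ 23" using large mult_left_mono[OF K2, of "2 ^ 23"] by (simp add: n_def)
  have l3: "l ^ 3 = n / (2744 * K\<^sup>2)" unfolding l_def using n1 K by (intro real_root_pow_pos2) auto
  have l0: "l \<ge> 0" using n1 K by (simp add: l_def)
  \<comment> \<open>12 exceeds the 6 of the pivot argument and makes l - 2 at least l / 2. The
    hypothesis \<open>large\<close> provides it because 12^3 * 2744 < 2^23.\<close>
  have l12: "l \<ge> 12"
  proof (rule ccontr)
    assume "\<not> l \<ge> 12"
    then have "l ^ 3 \<le> 12 ^ 3" using l0 by (intro power_mono) auto
    then have "n \<le> 12 ^ 3 * (2744 * K\<^sup>2)" using l3 K by (simp add: field_simps)
    also have "\<dots> < 2 ^ 23 * K\<^sup>2" using K by simp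
    finally show False using large by (simp add: n_def)
  qed
  have l: "l * real (card {x \<in> Q 6. Z (tr x - t)}) \<le> real (card H)" if "\<not> Z t" for t
  proof -
    define k where "k = real (card {x \<in> Q 6. Z (tr x - t)})"
    have "(l * k) ^ 3 = l ^ 3 * k ^ 3" by (rule power_mult_distrib)
    also have "k ^ 3 \<le> 2744 * real (card (Q 20)) ^ 2" unfolding k_def by (rule card_trace_class[OF that])
    also have "real (card (Q 20)) ^ 2 \<le> (K * n) ^ 2" using small[of 20] by (intro power_mono) (auto simp: n_def)
    also have "l ^ 3 * (2744 * (K * n) ^ 2) = n ^ 3"
      unfolding l3 using K by (simp add: field_simps power2_eq_square power3_eq_cube)
    finally have "(l * k) ^ 3 \<le> n ^ 3" using l0 by (simp add: mult_left_mono)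
    then have "l * k \<le> n" by (rule power_mono_iff[THEN iffD1, rotated 3]) (use l0 n1 in \<open>auto simp: k_def\<close>)
    then show ?thesis by (simp add: k_def n_def)
  qed
  have "card H > 54" using n1 by (simp add: n_def)
  then obtain h where h: "h \<in> Q 3" "\<not> Z (tr h)" "\<not> Z ((tr h)\<^sup>2 - 4)" using regular_element by blast
  have hG: "h \<in> carrier S" using h Q_carrier by auto
  have "l > 6" using l12 by simp
  note lower = card_all_tori_lower[OF l this h]
  have "real p ^ 3 / 2 * (l / 2) \<le> real (card (carrier S)) * (l - 2)"
    using card_SL2 l12 by (intro mult_mono) auto
  also have "\<dots> \<le> 4 * real p * real (card (Q 2))" by (rule card_SL2_le_tori[OF lower hG h(3)])
  also have "\<dots> \<le> 4 * real p * (K * n)" using small[of 2] by (intro mult_left_mono) (auto simp: n_def)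
  finally have "real p * (real p ^ 2 * l) \<le> real p * (16 * K * n)"
    by (simp add: power2_eq_square power3_eq_cube mult_ac)
  then have "real p ^ 2 * l \<le> 16 * K * n" using p_gt_3 by simp
  then have "(real p ^ 2 * l) ^ 3 \<le> (16 * K * n) ^ 3" using l0 by (intro power_mono) auto
  then have "real p ^ 6 * (n / (2744 * K\<^sup>2)) \<le> 4096 * K ^ 3 * n ^ 3"
    by (simp add: power_mult_distrib l3 flip: power_mult)
  then have "real p ^ 6 * n \<le> 4096 * K ^ 3 * n ^ 3 * (2744 * K\<^sup>2)"
    using K by (simp add: pos_divide_le_eq)
  also have "\<dots> = 4096 * 2744 * (K ^ 3 * K\<^sup>2) * n\<^sup>2 * n" by (simp add: power2_eq_square power3_eq_cube)
  also have "K ^ 3 * K\<^sup>2 = K ^ 5" by (simp flip: power_add)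
  finally have "real p ^ 6 \<le> 4096 * 2744 * K ^ 5 * n\<^sup>2" using n1 by simp
  also have "\<dots> \<le> 2 ^ 24 * K ^ 5 * n\<^sup>2" using K by (intro mult_right_mono) auto
  finally show ?thesis by (simp add: n_def)
qed

end

section \<open>Incidences\<close>

context SL2_prime
begin

abbreviation pt :: "int \<Rightarrow> int \<times> int" where
  "pt x \<equiv> (x, 1)"

lemma nz_pt: "nz (pt x)"
  using Z_1 by (simp add: nz_def)

lemma par_pt_iff:
  assumes "x \<in> {0..<int p}" "y \<in> {0..<int p}"
  shows "par (pt x) (pt y) \<longleftrightarrow> x = y"
  using assms Z_small[of x y] by (auto simp: par_def cross_def)

definition hits :: "int set \<Rightarrow> int^2^2 \<Rightarrow> nat" where
  "hits A g = card {(x, y) \<in> A \<times> A. maps g (pt x) (pt y)}"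

definition preim :: "int set \<Rightarrow> int^2^2 \<Rightarrow> int \<Rightarrow> nat" where
  "preim A g a = card {x \<in> A. maps g (pt x) (pt a)}"

text \<open>The curve is the graph of the Moebius transformation y = (a x + b) / (c x + d) on affine
  points (x : 1). A point sent to infinity is on no pair, because \<open>pt y\<close> has second
  coordinate 1.\<close>

lemma hyperbola_iff:
  assumes "x \<in> {0..<int p}" "y \<in> {0..<int p}"
  shows "(x, y) \<in> hyperbola p g \<longleftrightarrow> maps g (pt x) (pt y)"
proof -
  have "(x, y) \<in> hyperbola p g \<longleftrightarrow> Z (g$2$1 * x * y - g$1$1 * x + g$2$2 * y - g$1$2)"
    using assms p_gt_3 by (simp add: hyperbola_def carrier_Fp cong_0_iff)
  also have "g$2$1 * x * y - g$1$1 * x + g$2$2 * y - g$1$2 = - cross (app g (pt x)) (pt y)"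
    by (simp add: cross_def app_def algebra_simps)
  finally show ?thesis by (simp add: maps_def par_def)
qed

lemma hits_eq_preim:
  assumes "finite A"
  shows "hits A g = (\<Sum>a\<in>A. preim A g a)"
  unfolding hits_def preim_def card_pairs_sum[OF assms assms] by (rule card_pairs_swap[OF assms assms])

text \<open>If h takes x to a and g takes a to y, then g h takes x to y; x determines a, so distinct
  intermediate points give distinct pairs.\<close>

lemma hits_mult:
  assumes A: "finite A" "A \<subseteq> {0..<int p}" and g: "g \<in> carrier S" "h \<in> carrier S"
  shows "(\<Sum>a\<in>A. preim A (\<iota> g) a * preim A h a) \<le> hits A (g \<cdot> h)"
proof -
  let ?B = "\<lambda>a. {x \<in> A. maps h (pt x) (pt a)} \<times> {y \<in> A. maps (\<iota> g) (pt y) (pt a)}"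
  have "(\<Sum>a\<in>A. preim A (\<iota> g) a * preim A h a) = (\<Sum>a\<in>A. card (?B a))"
    by (simp add: preim_def card_cartesian_product mult.commute)
  also have "\<dots> = card (\<Union>a\<in>A. ?B a)"
  proof (rule card_UN_disjoint[symmetric])
    have "a = b" if "a \<in> A" "b \<in> A" "maps h (pt x) (pt a)" "maps h (pt x) (pt b)" for a b x
      using maps_unique[OF g(2) that(3,4) nz_pt] par_pt_iff that(1,2) A(2) by blast
    then show "\<forall>i\<in>A. \<forall>j\<in>A. i \<noteq> j \<longrightarrow> ?B i \<inter> ?B j = {}" by blast
  qed (use A in auto)
  also have "\<dots> \<le> hits A (g \<cdot> h)"
    unfolding hits_def
  proof (rule card_mono)
    show "finite {(x, y) \<in> A \<times> A. maps (g \<cdot> h) (pt x) (pt y)}"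
      using A(1) by (auto intro: finite_subset[of _ "A \<times> A"])
    have "maps (g \<cdot> h) (pt x) (pt y)" if "maps h (pt x) (pt a)" "maps (\<iota> g) (pt y) (pt a)" for x y a
      using maps_mult[OF g(1) that(1) _ nz_pt] maps_inv[OF _ that(2)] g by simp
    then show "(\<Union>a\<in>A. ?B a) \<subseteq> {(x, y) \<in> A \<times> A. maps (g \<cdot> h) (pt x) (pt y)}" by blast
  qed
  finally show ?thesis .
qed

text \<open>Cauchy--Schwarz over the intermediate point a in A. Symmetry of f replaces one of the
  two preimage counts by that of the inverse, so that pairs with a common endpoint compose as in
  \<open>hits_mult\<close>.\<close>

lemma hits_conv:
  assumes A: "finite A" "A \<subseteq> {0..<int p}"
    and f: "\<And>g. g \<in> carrier S \<Longrightarrow> 0 \<le> f g" "\<And>g. g \<in> carrier S \<Longrightarrow> f (\<iota> g) = f g"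
  shows "(\<Sum>g\<in>carrier S. f g * real (hits A g)) ^ 2 \<le>
    real (card A) * (\<Sum>g\<in>carrier S. SL.conv f f g * real (hits A g))"
proof -
  define \<phi> where "\<phi> a = (\<Sum>g\<in>carrier S. f g * real (preim A g a))" for a
  have inv: "(\<Sum>g\<in>carrier S. f g * real (preim A (\<iota> g) a)) = \<phi> a" for a
    unfolding \<phi>_def SL.sum_inverse[of "\<lambda>g. f g * real (preim A g a)", symmetric]
    by (intro sum.cong refl) (simp add: f(2))
  have "(\<Sum>g\<in>carrier S. f g * real (hits A g)) = (\<Sum>a\<in>A. \<phi> a)"
    unfolding \<phi>_def hits_eq_preim[OF A(1)] of_nat_sum sum_distrib_left by (rule sum.swap)
  moreover have "(\<Sum>a\<in>A. \<phi> a) ^ 2 \<le> (\<Sum>a\<in>A. \<phi> a ^ 2) * real (card A)"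
    using Cauchy_Schwarz_ineq_sum[of \<phi> "\<lambda>_. 1" A] by simp
  moreover have "(\<Sum>a\<in>A. \<phi> a ^ 2) \<le> (\<Sum>g\<in>carrier S. SL.conv f f g * real (hits A g))"
  proof -
    have "(\<Sum>a\<in>A. \<phi> a ^ 2) = (\<Sum>a\<in>A. (\<Sum>g\<in>carrier S. f g * real (preim A (\<iota> g) a)) * (\<Sum>h\<in>carrier S. f h * real (preim A h a)))"
      unfolding inv by (simp add: power2_eq_square \<phi>_def)
    also have "\<dots> = (\<Sum>a\<in>A. \<Sum>g\<in>carrier S. \<Sum>h\<in>carrier S. f g * f h * real (preim A (\<iota> g) a * preim A h a))"
      unfolding sum_product by (intro sum.cong refl) (simp add: mult_ac)
    also have "\<dots> = (\<Sum>g\<in>carrier S. \<Sum>a\<in>A. \<Sum>h\<in>carrier S. f g * f h * real (preim A (\<iota> g) a * preim A h a))"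
      by (rule sum.swap)
    also have "\<dots> = (\<Sum>g\<in>carrier S. \<Sum>h\<in>carrier S. \<Sum>a\<in>A. f g * f h * real (preim A (\<iota> g) a * preim A h a))"
      by (rule sum.cong[OF refl], rule sum.swap)
    also have "\<dots> = (\<Sum>g\<in>carrier S. \<Sum>h\<in>carrier S. f g * f h * real (\<Sum>a\<in>A. preim A (\<iota> g) a * preim A h a))"
      unfolding of_nat_sum sum_distrib_left ..
    also have "\<dots> \<le> (\<Sum>g\<in>carrier S. \<Sum>h\<in>carrier S. f g * f h * real (hits A (g \<cdot> h)))"
      using f(1) by (intro sum_mono mult_left_mono of_nat_mono hits_mult A) auto
    also have "\<dots> = (\<Sum>g\<in>carrier S. SL.conv f f g * real (hits A g))"
      by (rule SL.sum_conv_mult[symmetric])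
    finally show ?thesis .
  qed
  ultimately show ?thesis
    using mult_right_mono[of _ _ "real (card A)"] by (fastforce simp: mult.commute)
qed

text \<open>The same Cauchy--Schwarz step for a set that need not be symmetric: two arrows ending at
  a compose to an arrow of g^-1 h, the law of which is \<open>sym_mean\<close>.\<close>

lemma hits_sym_mean:
  assumes A: "finite A" "A \<subseteq> {0..<int p}" and U: "U \<subseteq> carrier S"
  shows "(\<Sum>g\<in>U. real (hits A g)) ^ 2 \<le>
    real (card A) * (real (card U) ^ 2 * (\<Sum>g\<in>carrier S. SL.sym_mean U g * real (hits A g)))"
proof (cases "U = {}")
  case False
  have finU: "finite U" using U finite_carrier finite_subset by blast
  define \<phi> where "\<phi> a = (\<Sum>g\<in>U. real (preim A g a))" for a
  have "(\<Sum>g\<in>U. real (hits A g)) = (\<Sum>a\<in>A. \<phi> a)"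
    unfolding \<phi>_def hits_eq_preim[OF A(1)] of_nat_sum by (rule sum.swap)
  moreover have "(\<Sum>a\<in>A. \<phi> a) ^ 2 \<le> (\<Sum>a\<in>A. \<phi> a ^ 2) * real (card A)"
    using Cauchy_Schwarz_ineq_sum[of \<phi> "\<lambda>_. 1" A] by simp
  moreover have "(\<Sum>a\<in>A. \<phi> a ^ 2) \<le> real (card U) ^ 2 * (\<Sum>g\<in>carrier S. SL.sym_mean U g * real (hits A g))"
  proof -
    have "(\<Sum>a\<in>A. \<phi> a ^ 2) = (\<Sum>a\<in>A. \<Sum>g\<in>U. \<Sum>h\<in>U. real (preim A g a * preim A h a))"
      by (simp add: power2_eq_square \<phi>_def sum_product)
    also have "\<dots> = (\<Sum>g\<in>U. \<Sum>a\<in>A. \<Sum>h\<in>U. real (preim A g a * preim A h a))" by (rule sum.swap)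
    also have "\<dots> = (\<Sum>g\<in>U. \<Sum>h\<in>U. \<Sum>a\<in>A. real (preim A g a * preim A h a))"
      by (rule sum.cong[OF refl], rule sum.swap)
    also have "\<dots> = (\<Sum>g\<in>U. \<Sum>h\<in>U. real (\<Sum>a\<in>A. preim A g a * preim A h a))"
      unfolding of_nat_sum ..
    also have "\<dots> \<le> (\<Sum>g\<in>U. \<Sum>h\<in>U. real (hits A (\<iota> g \<cdot> h)))"
    proof (intro sum_mono of_nat_mono)
      fix g h assume "g \<in> U" "h \<in> U"
      then have gh: "g \<in> carrier S" "h \<in> carrier S" using U by auto
      show "(\<Sum>a\<in>A. preim A g a * preim A h a) \<le> hits A (\<iota> g \<cdot> h)"
        using hits_mult[OF A, of "\<iota> g" h] gh by simp
    qed
    also have "\<dots> = real (card U) ^ 2 * (\<Sum>g\<in>carrier S. SL.sym_mean U g * real (hits A g))"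
      using SL.sym_mean_sum[OF finite_carrier U, of "\<lambda>g. real (hits A g)"] False finU by simp
    finally show ?thesis .
  qed
  ultimately show ?thesis
    using mult_right_mono[of _ _ "real (card A)"] by (fastforce simp: mult.commute)
qed simp

text \<open>Count elements g together with ordered triples of hits. Of the m^3 triples of hits of g
  at most 3 m^2 repeat a point, which is at most half once m is 6 or more. A triple with distinct
  first coordinates determines g up to two choices, and there are at most |A|^6 triples.\<close>

lemma card_many_hits:
  fixes \<tau> :: real
  assumes A: "finite A" "A \<subseteq> {0..<int p}" and \<tau>: "\<tau> \<ge> 6"
  shows "\<tau> ^ 3 * real (card {g \<in> carrier S. \<tau> \<le> real (hits A g)}) \<le> 4 * real (card A) ^ 6"
proof -
  define T where "T = {g \<in> carrier S. \<tau> \<le> real (hits A g)}"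
  define M where "M g = {w \<in> A \<times> A. maps g (pt (fst w)) (pt (snd w))}" for g
  define W where "W = {(t1, t2, t3) \<in> (A \<times> A) \<times> (A \<times> A) \<times> (A \<times> A).
    fst t1 \<noteq> fst t2 \<and> fst t1 \<noteq> fst t3 \<and> fst t2 \<noteq> fst t3}"
  define R where "R g w \<longleftrightarrow> fst w \<in> M g \<and> fst (snd w) \<in> M g \<and> snd (snd w) \<in> M g" for g w
  have finT: "finite T" using finite_carrier by (simp add: T_def)
  have finM: "finite (M g)" for g using A by (simp add: M_def)
  have finW: "finite W" using A by (auto simp: W_def intro: finite_subset[of _ "(A \<times> A) \<times> (A \<times> A) \<times> (A \<times> A)"])
  have lower: "\<tau> ^ 3 / 2 \<le> real (card {w \<in> W. R g w})" if g: "g \<in> T" for g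
  proof -
    have gG: "g \<in> carrier S" using g by (simp add: T_def)
    define m where "m = card (M g)"
    have "hits A g = m" unfolding hits_def m_def M_def by (rule arg_cong[of _ _ card]) auto
    then have m: "\<tau> \<le> real m" using g by (simp add: T_def)
    have fst_eq: "s = t" if "s \<in> M g" "t \<in> M g" "fst s = fst t" for s t
    proof -
      have "par (pt (snd s)) (pt (snd t))"
        using maps_unique[OF gG _ _ nz_pt, of "fst s"] that by (simp add: M_def)
      then have "snd s = snd t" using that A(2) by (subst (asm) par_pt_iff) (auto simp: M_def)
      then show ?thesis using that(3) by (simp add: prod_eq_iff)
    qed
    have "M g \<times> M g \<times> M g \<subseteq> {w \<in> W. R g w} \<union> (\<lambda>(s, t). (s, s, t)) ` (M g \<times> M g) \<union>
        (\<lambda>(s, t). (s, t, s)) ` (M g \<times> M g) \<union> (\<lambda>(s, t). (s, t, t)) ` (M g \<times> M g)"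
    proof
      fix w assume w: "w \<in> M g \<times> M g \<times> M g"
      obtain t1 t2 t3 where t: "w = (t1, t2, t3)" by (cases w)
      have M: "t1 \<in> M g" "t2 \<in> M g" "t3 \<in> M g" using w t by auto
      consider "t1 = t2" | "t1 = t3" | "t2 = t3" | "fst t1 \<noteq> fst t2" "fst t1 \<noteq> fst t3" "fst t2 \<noteq> fst t3"
        using M fst_eq by blast
      then show "w \<in> {w \<in> W. R g w} \<union> (\<lambda>(s, t). (s, s, t)) ` (M g \<times> M g) \<union>
        (\<lambda>(s, t). (s, t, s)) ` (M g \<times> M g) \<union> (\<lambda>(s, t). (s, t, t)) ` (M g \<times> M g)"
      proof cases
        case 4
        then have "w \<in> {w \<in> W. R g w}" using M by (auto simp: W_def R_def M_def t)
        then show ?thesis by blast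
      qed (use M t in force)+
    qed
    then have "card (M g \<times> M g \<times> M g) \<le> card ({w \<in> W. R g w} \<union> (\<lambda>(s, t). (s, s, t)) ` (M g \<times> M g) \<union>
        (\<lambda>(s, t). (s, t, s)) ` (M g \<times> M g) \<union> (\<lambda>(s, t). (s, t, t)) ` (M g \<times> M g))"
      using finM finW by (intro card_mono) auto
    also have "\<dots> \<le> card {w \<in> W. R g w} + card ((\<lambda>(s, t). (s, s, t)) ` (M g \<times> M g)) +
        card ((\<lambda>(s, t). (s, t, s)) ` (M g \<times> M g)) + card ((\<lambda>(s, t). (s, t, t)) ` (M g \<times> M g))"
      by (intro order_trans[OF card_Un_le] add_mono order_refl)
    also have "\<dots> \<le> card {w \<in> W. R g w} + card (M g \<times> M g) + card (M g \<times> M g) + card (M g \<times> M g)"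
      using finM by (intro add_mono card_image_le order_refl) auto
    finally have "m * (m * m) \<le> card {w \<in> W. R g w} + 3 * (m * m)"
      by (simp add: card_cartesian_product m_def)
    then have "real (m * (m * m)) \<le> real (card {w \<in> W. R g w} + 3 * (m * m))" by (rule of_nat_mono)
    then have "real m ^ 3 - 3 * real m ^ 2 \<le> real (card {w \<in> W. R g w})"
      by (simp add: power2_eq_square power3_eq_cube)
    moreover have "3 * real m ^ 2 \<le> real m ^ 3 / 2"
    proof -
      have "6 * real m ^ 2 \<le> real m * real m ^ 2" using m \<tau> by (intro mult_right_mono) auto
      then show ?thesis by (simp add: power2_eq_square power3_eq_cube)
    qed
    moreover have "\<tau> ^ 3 \<le> real m ^ 3" using m \<tau> by (intro power_mono) auto
    ultimately show ?thesis by linarith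
  qed
  have upper: "card {g \<in> T. R g w} \<le> 2" if w: "w \<in> W" for w
  proof -
    obtain t1 t2 t3 where t: "w = (t1, t2, t3)" by (cases w)
    have f: "fst t1 \<noteq> fst t2" "fst t1 \<noteq> fst t3" "fst t2 \<noteq> fst t3" "fst t1 \<in> A" "fst t2 \<in> A" "fst t3 \<in> A"
      using w t by (auto simp: W_def)
    have "card {g \<in> T. R g w} \<le> card {g \<in> carrier S. maps g (pt (fst t1)) (pt (snd t1)) \<and>
        maps g (pt (fst t2)) (pt (snd t2)) \<and> maps g (pt (fst t3)) (pt (snd t3))}"
      by (rule card_mono) (auto simp: finite_carrier T_def R_def M_def t)
    also have "\<dots> \<le> 2"
    proof (rule card_maps_three_lines)
      have "\<not> par (pt x) (pt y)" if "x \<in> A" "y \<in> A" "x \<noteq> y" for x y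
        using par_pt_iff[of x y] that subsetD[OF A(2)] by blast
      then show "\<not> par (pt (fst t1)) (pt (fst t2))" "\<not> par (pt (fst t1)) (pt (fst t3))"
        "\<not> par (pt (fst t2)) (pt (fst t3))" using f by auto
    qed (rule nz_pt)+
    finally show ?thesis .
  qed
  have "\<tau> ^ 3 / 2 * real (card T) = (\<Sum>g\<in>T. \<tau> ^ 3 / 2)" by simp
  also have "\<dots> \<le> (\<Sum>g\<in>T. real (card {w \<in> W. R g w}))" by (intro sum_mono lower)
  also have "\<dots> = real (\<Sum>g\<in>T. card {w \<in> W. R g w})" by simp
  also have "(\<Sum>g\<in>T. card {w \<in> W. R g w}) = (\<Sum>w\<in>W. card {g \<in> T. R g w})"
    by (rule card_pairs_swap[OF finT finW])
  also have "\<dots> \<le> (\<Sum>w\<in>W. 2)" by (intro sum_mono upper)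
  also have "\<dots> = 2 * card W" by simp
  also have "card W \<le> card ((A \<times> A) \<times> (A \<times> A) \<times> (A \<times> A))"
    using A by (intro card_mono) (auto simp: W_def)
  also have "\<dots> = card A ^ 6" by (simp add: card_cartesian_product eval_nat_numeral)
  finally have "\<tau> ^ 3 / 2 * real (card T) \<le> real (2 * card A ^ 6)" by simp
  then show ?thesis by (simp add: T_def)
qed

text \<open>One element has at most N hits, so the elements with at least c / 2 hits carry mass at
  least c / (2 N). By \<open>card_many_hits\<close> they number at most 32 N^6 / c^3, and
  Cauchy--Schwarz bounds the L^2 norm below. The 12 is twice the threshold 6 there.\<close>

lemma L2_lower_bound:
  assumes A: "finite A" "A \<subseteq> {0..<int p}"
    and f: "\<And>g. g \<in> carrier S \<Longrightarrow> 0 \<le> f g" "(\<Sum>g\<in>carrier S. f g) = 1"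
    and c: "12 \<le> c" "c \<le> (\<Sum>g\<in>carrier S. f g * real (hits A g))"
  shows "c ^ 5 \<le> 128 * real (card A) ^ 8 * (\<Sum>g\<in>carrier S. f g ^ 2)"
proof -
  define N where "N = real (card A)"
  define q where "q = (\<Sum>g\<in>carrier S. f g ^ 2)"
  define T where "T = {g \<in> carrier S. c / 2 \<le> real (hits A g)}"
  have finT: "finite T" using finite_carrier by (simp add: T_def)
  have hits_le: "real (hits A g) \<le> N" if g: "g \<in> carrier S" for g
  proof -
    have "hits A g \<le> card A"
      unfolding hits_def
    proof (rule card_inj_on_le[where f = fst])
      have "y = z" if "y \<in> A" "z \<in> A" "maps g (pt x) (pt y)" "maps g (pt x) (pt z)" for x y z
        using maps_unique[OF g that(3,4) nz_pt] par_pt_iff that(1,2) A(2) by blast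
      then show "inj_on fst {(x, y) \<in> A \<times> A. maps g (pt x) (pt y)}" by (auto simp: inj_on_def)
    qed (use A in auto)
    then show ?thesis by (simp add: N_def)
  qed
  have "c \<le> (\<Sum>g\<in>carrier S. f g * real (hits A g))" by fact
  also have "\<dots> \<le> (\<Sum>g\<in>carrier S. c / 2 * f g + (if g \<in> T then N * f g else 0))"
  proof (rule sum_mono)
    fix g assume g: "g \<in> carrier S"
    show "f g * real (hits A g) \<le> c / 2 * f g + (if g \<in> T then N * f g else 0)"
    proof (cases "g \<in> T")
      case True
      have "f g * real (hits A g) \<le> f g * N" using f(1)[OF g] hits_le[OF g] by (intro mult_left_mono)
      moreover have "0 \<le> c / 2 * f g" using c f(1)[OF g] by simp
      ultimately show ?thesis using True by (simp add: mult.commute)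
    next
      case False
      then have "f g * real (hits A g) \<le> f g * (c / 2)"
        using f(1)[OF g] g by (intro mult_left_mono) (auto simp: T_def)
      then show ?thesis using False by (simp add: mult.commute)
    qed
  qed
  also have "\<dots> = c / 2 * (\<Sum>g\<in>carrier S. f g) + N * (\<Sum>g\<in>T. f g)"
    by (rule sum_linear_restrict[OF finite_carrier]) (auto simp: T_def)
  finally have "c \<le> 2 * N * (\<Sum>g\<in>T. f g)" by (simp add: f(2))
  then have "c ^ 2 \<le> (2 * N * (\<Sum>g\<in>T. f g)) ^ 2" using c by (intro power_mono) auto
  also have "\<dots> = 4 * N ^ 2 * (\<Sum>g\<in>T. f g) ^ 2" by (simp add: power_mult_distrib)
  also have "\<dots> \<le> 4 * N ^ 2 * (q * real (card T))"
  proof (rule mult_left_mono)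
    have "(\<Sum>g\<in>T. f g) ^ 2 \<le> (\<Sum>g\<in>T. f g ^ 2) * real (card T)"
      using Cauchy_Schwarz_ineq_sum[of f "\<lambda>_. 1" T] by simp
    also have "\<dots> \<le> q * real (card T)"
      unfolding q_def using finite_carrier by (intro mult_right_mono sum_mono2) (auto simp: T_def)
    finally show "(\<Sum>g\<in>T. f g) ^ 2 \<le> q * real (card T)" .
  qed simp
  finally have c2: "c ^ 2 \<le> 4 * N ^ 2 * (q * real (card T))" .
  have "(c / 2) ^ 3 * real (card T) \<le> 4 * N ^ 6"
    unfolding T_def N_def using c by (intro card_many_hits A) auto
  then have T3: "c ^ 3 * real (card T) \<le> 32 * N ^ 6" by (simp add: power_divide)
  have q0: "q \<ge> 0" unfolding q_def by (intro sum_nonneg) auto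
  have "c ^ 5 = c ^ 3 * c ^ 2" by (simp flip: power_add)
  also have "\<dots> \<le> c ^ 3 * (4 * N ^ 2 * (q * real (card T)))" using c2 c by (intro mult_left_mono) auto
  also have "\<dots> = 4 * N ^ 2 * q * (c ^ 3 * real (card T))" by (simp add: mult_ac)
  also have "\<dots> \<le> 4 * N ^ 2 * q * (32 * N ^ 6)" using T3 q0 by (intro mult_left_mono) auto
  also have "\<dots> = 128 * (N ^ 2 * N ^ 6) * q" by simp
  also have "N ^ 2 * N ^ 6 = N ^ 8" by (simp flip: power_add)
  finally show ?thesis by (simp add: N_def q_def)
qed


text \<open>
  The loss \<open>D\<close> in the number of incidences is squared by each convolution, which leads to \<open>E\<close>.
\<close>

theorem growth_dichotomy:
  fixes K D :: real and J :: nat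
  assumes A: "finite A" "A \<subseteq> {0..<int p}" and U: "U \<subseteq> carrier S" "U \<noteq> {}" and K: "K \<ge> 2" and D: "D \<ge> 1"
  defines "N \<equiv> real (card A)" and "u \<equiv> real (card U)" and "E \<equiv> D ^ (2 ^ Suc J)"
  assumes rich: "u * N / D \<le> (\<Sum>g\<in>U. real (hits A g))"
    and N: "12 * E \<le> N" and long: "128 * N ^ 3 * E ^ 5 < u * K ^ J" and u: "2 ^ 23 * K ^ 40500 \<le> u"
    and escape: "\<And>L x. subgroup L S \<Longrightarrow> L \<noteq> carrier S \<Longrightarrow> x \<in> carrier S \<Longrightarrow>
      K ^ 500 * real (card {s \<in> U. \<iota> x \<cdot> s \<in> L}) < u"
  shows "u \<le> 128 * N ^ 3 * E ^ 5 \<and> real p ^ 3 \<le> 2 ^ 19 * K ^ 52000 * (N ^ 3 * E ^ 5)"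
proof -
  define \<nu> where "\<nu> = SL.dyadic_conv (SL.sym_mean U)"
  define q where "q k = (\<Sum>g\<in>carrier S. \<nu> k g ^ 2)" for k
  define c where "c k = (\<Sum>g\<in>carrier S. \<nu> k g * real (hits A g))" for k
  have finU: "finite U" using U finite_carrier finite_subset by blast
  have u0: "u > 0" using U finU by (simp add: u_def card_gt_0_iff)
  have K0: "K > 0" and K1: "K \<ge> 1" using K by auto
  have E1: "E \<ge> 1" using D by (simp add: E_def)
  have N0: "N > 0" using N E1 by linarith
  have \<nu>: "0 \<le> \<nu> k g" "\<nu> k (\<iota> g) = \<nu> k g" if "g \<in> carrier S" for k g
    using SL.dyadic_conv_props[of "SL.sym_mean U" k] SL.sym_mean_props[OF finite_carrier U] that
    unfolding \<nu>_def by auto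
  have \<nu>1: "(\<Sum>g\<in>carrier S. \<nu> k g) = 1" for k
    using SL.dyadic_conv_props[of "SL.sym_mean U" k] SL.sym_mean_props[OF finite_carrier U]
    unfolding \<nu>_def by auto
  \<comment> \<open>The exponent is \<open>Suc k\<close> and not \<open>k\<close> because
    symmetrizing U already costs one Cauchy--Schwarz step.\<close>
  have c_lower: "N / D ^ (2 ^ Suc k) \<le> c k" for k
  proof (induction k)
    case 0
    have "(u * N / D) ^ 2 \<le> (\<Sum>g\<in>U. real (hits A g)) ^ 2"
      using rich u0 N0 D by (intro power_mono) auto
    also have "\<dots> \<le> N * (u ^ 2 * c 0)"
      using hits_sym_mean[OF A U(1)] by (simp add: N_def u_def c_def \<nu>_def)
    finally have "u\<^sup>2 * N * (N / D\<^sup>2) \<le> u\<^sup>2 * N * c 0"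
      by (simp add: power_mult_distrib power_divide power2_eq_square mult_ac)
    then have "N / D\<^sup>2 \<le> c 0" by (rule mult_left_le_imp_le) (use u0 N0 in simp)
    then show ?case by simp
  next
    case (Suc k)
    have "(N / D ^ (2 ^ Suc k)) ^ 2 \<le> c k ^ 2"
      using Suc.IH N0 D by (intro power_mono) auto
    also have "\<dots> \<le> N * c (Suc k)"
      using hits_conv[OF A, of "\<nu> k"] \<nu>[of _ k] by (simp add: N_def c_def \<nu>_def)
    finally have "N * (N / (D ^ (2 ^ Suc k)) ^ 2) \<le> N * c (Suc k)"
      by (simp only: power_divide power2_eq_square[of N] times_divide_eq_right)
    moreover have "(D ^ (2 ^ Suc k)) ^ 2 = D ^ (2 ^ Suc (Suc k))"
      unfolding power_mult[symmetric] by (rule arg_cong[of _ _ "power D"]) simp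
    ultimately have "N * (N / D ^ (2 ^ Suc (Suc k))) \<le> N * c (Suc k)" by (simp only:)
    then show ?case by (rule mult_left_le_imp_le) (rule N0)
  qed
  \<comment> \<open>The average number of hits is at least N / E for all these k at once, and (N /
    E)^5 / (128 N^8) is the bound of \<open>L2_lower_bound\<close>.\<close>
  have q_lower: "1 \<le> 128 * N ^ 3 * E ^ 5 * q k" if k: "k \<le> J" for k
  proof -
    have "D ^ (2 ^ Suc k) \<le> E" unfolding E_def using k D by (intro power_increasing) auto
    then have "N / E \<le> N / D ^ (2 ^ Suc k)" using N0 D E1 by (intro divide_left_mono) auto
    then have ck: "N / E \<le> c k" using c_lower[of k] by linarith
    have "12 \<le> N / E" using N E1 by (simp add: field_simps)
    then have "(N / E) ^ 5 \<le> 128 * N ^ 8 * q k"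
      using L2_lower_bound[OF A, of "\<nu> k" "N / E"] \<nu>(1)[of _ k] \<nu>1[of k] ck
      unfolding N_def q_def c_def by simp
    then have "N ^ 5 \<le> 128 * N ^ 8 * q k * E ^ 5" using E1 by (simp add: power_divide field_simps)
    moreover have "N ^ 8 = N ^ 5 * N ^ 3" by (simp flip: power_add)
    moreover have "128 * (N ^ 5 * N ^ 3) * q k * E ^ 5 = N ^ 5 * (128 * N ^ 3 * E ^ 5 * q k)"
      by (simp only: mult_ac)
    ultimately have "N ^ 5 * 1 \<le> N ^ 5 * (128 * N ^ 3 * E ^ 5 * q k)" by (simp only: mult_1_right)
    then show ?thesis by (rule mult_left_le_imp_le) (use N0 in simp)
  qed
  have q0_le: "q 0 \<le> 1 / u"
    using SL.sym_mean_props(4)[OF finite_carrier U] by (simp add: q_def \<nu>_def u_def)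
  have u_le: "u \<le> 128 * N ^ 3 * E ^ 5"
  proof -
    have "1 \<le> 128 * N ^ 3 * E ^ 5 * q 0" by (rule q_lower) simp
    also have "\<dots> \<le> 128 * N ^ 3 * E ^ 5 * (1 / u)" using q0_le N0 E1 by (intro mult_left_mono) auto
    finally show ?thesis using u0 by (simp add: field_simps)
  qed
  \<comment> \<open>If each of the \<open>J\<close> convolutions divided the squared norm by more
    than K, it would end below 1 / (u K^J), which \<open>long\<close> makes smaller than the lower
    bound allows.\<close>
  have "\<exists>k<J. q k / K \<le> q (Suc k)"
  proof (rule ccontr)
    assume no: "\<not> (\<exists>k<J. q k / K \<le> q (Suc k))"
    have "q k \<le> 1 / (u * K ^ k)" if "k \<le> J" for k
      using that
    proof (induction k)
      case (Suc k)
      then have "q (Suc k) < q k / K" using no by (meson Suc_le_eq not_le)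
      also have "\<dots> \<le> 1 / (u * K ^ k) / K" using Suc K0 by (intro divide_right_mono) auto
      finally show ?case by (simp add: mult_ac)
    qed (use q0_le in simp)
    then have "q J \<le> 1 / (u * K ^ J)" by simp
    then have "128 * N ^ 3 * E ^ 5 * q J \<le> 128 * N ^ 3 * E ^ 5 * (1 / (u * K ^ J))"
      using N0 E1 by (intro mult_left_mono) auto
    also have "\<dots> < 1" using long u0 K0 by (simp add: field_simps)
    finally show False using q_lower[of J] by simp
  qed
  then obtain k where k: "k < J" "q k / K \<le> q (Suc k)" by blast
  have flat: "(\<Sum>g\<in>carrier S. \<nu> k g ^ 2) / K \<le> (\<Sum>g\<in>carrier S. SL.conv (\<nu> k) (\<nu> k) g ^ 2)"
    using k(2) by (simp add: q_def \<nu>_def)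
  obtain P y where P: "P \<subseteq> carrier S" "\<one>\<^bsub>S\<^esub> \<in> P" "\<And>g. g \<in> P \<Longrightarrow> \<iota> g \<in> P" "y \<in> carrier S"
    and mass: "1 \<le> K ^ 500 * (\<Sum>g | g \<in> carrier S \<and> \<iota> y \<cdot> g \<in> P. \<nu> k g)"
    and cardP: "real (card P) \<le> K ^ 2000 / q k"
    and growth: "\<And>n. n \<le> 20 \<Longrightarrow> real (card (SL.setpow P n)) \<le> K ^ 20000 * real (card P)"
    using SL.approximate_subgroup_of_no_flattening[where \<nu> = "\<nu> k", OF finite_carrier \<nu>(1) \<nu>1 \<nu>(2) K flat]
    unfolding q_def by blast
  have finP: "finite P" using P(1) finite_carrier finite_subset by blast
  \<comment> \<open>The heavy coset of P is heavy for the k-th power. As the largest coset mass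
    \<open>B\<close> cannot grow under convolution or symmetrization, some coset is at least as
    heavy for the uniform measure on U.\<close>
  have "\<exists>x\<in>carrier S. u \<le> K ^ 500 * real (card {s \<in> U. \<iota> x \<cdot> s \<in> P})"
  proof (rule ccontr)
    assume no: "\<not> ?thesis"
    define B where "B = Max ((\<lambda>x. real (card {s \<in> U. \<iota> x \<cdot> s \<in> P}) / u) ` carrier S)"
    have finI: "finite ((\<lambda>x. real (card {s \<in> U. \<iota> x \<cdot> s \<in> P}) / u) ` carrier S)"
      using finite_carrier by simp
    have B: "real (card {s \<in> U. \<iota> x \<cdot> s \<in> P}) \<le> B * u" if "x \<in> carrier S" for x
    proof -
      have "real (card {s \<in> U. \<iota> x \<cdot> s \<in> P}) / u \<le> B"
        unfolding B_def using that by (intro Max_ge finI) auto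
      then show ?thesis using u0 by (simp add: field_simps)
    qed
    have "SL.coset_mass (\<nu> j) P x \<le> B" if "x \<in> carrier S" for j x
      using that
    proof (induction j arbitrary: x)
      case 0
      then show ?case unfolding \<nu>_def SL.dyadic_conv.simps
        using SL.coset_mass_sym_mean[OF finite_carrier U] B unfolding u_def by blast
    next
      case (Suc j)
      have "SL.coset_mass (SL.conv (\<nu> j) (\<nu> j)) P x \<le> B"
        by (rule SL.coset_mass_conv[where f = "\<nu> j" and h = "\<nu> j", OF finite_carrier \<nu>(1) \<nu>1 Suc.IH Suc.prems])
      then show ?case by (simp add: \<nu>_def)
    qed
    then have "SL.coset_mass (\<nu> k) P y \<le> B" using P(4) by blast
    then have "1 \<le> K ^ 500 * B"
      using mass mult_left_mono[of _ B "K ^ 500"] K0 unfolding SL.coset_mass_def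
      by (meson order_trans zero_le_power less_imp_le)
    moreover have "B \<in> (\<lambda>x. real (card {s \<in> U. \<iota> x \<cdot> s \<in> P}) / u) ` carrier S"
      unfolding B_def using SL.one_closed by (intro Max_in finI) blast
    then obtain x where "x \<in> carrier S" "B = real (card {s \<in> U. \<iota> x \<cdot> s \<in> P}) / u" by blast
    moreover from this have "K ^ 500 * real (card {s \<in> U. \<iota> x \<cdot> s \<in> P}) < u"
      using no by (meson not_le)
    ultimately have "K ^ 500 * B < 1" using u0 by (simp only: times_divide_eq_right divide_less_eq_1_pos)
    with \<open>1 \<le> K ^ 500 * B\<close> show False by linarith
  qed
  then obtain x where x: "x \<in> carrier S" "u \<le> K ^ 500 * real (card {s \<in> U. \<iota> x \<cdot> s \<in> P})" by blast
  \<comment> \<open>A proper subgroup containing P would have a coset with as much of U as x P has,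
    which \<open>escape\<close> forbids.\<close>
  interpret P: SL2_generating p P
  proof unfold_locales
    fix L assume L: "subgroup L S" "P \<subseteq> L"
    show "L = carrier S"
    proof (rule ccontr)
      assume "L \<noteq> carrier S"
      then have "K ^ 500 * real (card {s \<in> U. \<iota> x \<cdot> s \<in> L}) < u" using escape L x by blast
      moreover have "card {s \<in> U. \<iota> x \<cdot> s \<in> P} \<le> card {s \<in> U. \<iota> x \<cdot> s \<in> L}"
        using finU L by (intro card_mono) auto
      then have "K ^ 500 * real (card {s \<in> U. \<iota> x \<cdot> s \<in> P}) \<le>
          K ^ 500 * real (card {s \<in> U. \<iota> x \<cdot> s \<in> L})" using K0 by (intro mult_left_mono) auto
      ultimately show False using x(2) by linarith
    qed
  qed (use P in auto)
  have uP: "u \<le> K ^ 500 * real (card P)"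
  proof -
    have "card {s \<in> U. \<iota> x \<cdot> s \<in> P} \<le> card P"
      by (rule card_inj_on_le[where f = "\<lambda>s. \<iota> x \<cdot> s"])
        (use U x finP in \<open>auto simp: inj_on_def subset_iff\<close>)
    then have "K ^ 500 * real (card {s \<in> U. \<iota> x \<cdot> s \<in> P}) \<le> K ^ 500 * real (card P)"
      using K0 by (intro mult_left_mono) auto
    with x(2) show ?thesis by linarith
  qed
  \<comment> \<open>Helfgott's theorem is applied with K^20000 as its constant; 40500 = 500 + 2 *
    20000.\<close>
  have "2 ^ 23 * (K ^ 20000)\<^sup>2 \<le> real (card P)"
  proof -
    have "K ^ 500 * (2 ^ 23 * (K ^ 20000)\<^sup>2) = 2 ^ 23 * K ^ 40500"
      by (simp flip: power_mult power_add)
    then have "K ^ 500 * (2 ^ 23 * (K ^ 20000)\<^sup>2) \<le> K ^ 500 * real (card P)" using u uP by linarith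
    then show ?thesis using K0 by simp
  qed
  then have "real p ^ 6 \<le> 2 ^ 24 * (K ^ 20000) ^ 5 * real (card P) ^ 2"
    using K1 growth by (intro P.helfgott_growth) auto
  also have "\<dots> = 2 ^ 24 * K ^ 100000 * real (card P) ^ 2" by (simp flip: power_mult)
  also have "\<dots> \<le> 2 ^ 24 * K ^ 100000 * (K ^ 2000 * (128 * N ^ 3 * E ^ 5)) ^ 2"
  proof (intro mult_left_mono power_mono)
    have qk: "1 \<le> 128 * N ^ 3 * E ^ 5 * q k" using q_lower k(1) by simp
    then have "q k > 0" using N0 E1 by (smt (verit) mult_nonneg_nonpos mult_nonneg_nonneg zero_le_power)
    then have "K ^ 2000 / q k \<le> K ^ 2000 * (128 * N ^ 3 * E ^ 5)"
      using mult_left_mono[OF qk, of "K ^ 2000"] K0 by (simp add: field_simps)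
    then show "real (card P) \<le> K ^ 2000 * (128 * N ^ 3 * E ^ 5)" using cardP by linarith
  qed (use K0 in auto)
  also have "\<dots> = 2 ^ 38 * (K ^ 100000 * K ^ 4000) * (N ^ 3 * E ^ 5) ^ 2"
    by (simp add: power_mult_distrib flip: power_mult)
  also have "K ^ 100000 * K ^ 4000 = (K ^ 52000) ^ 2" by (simp flip: power_add power_mult)
  finally have "(real p ^ 3) ^ 2 \<le> (2 ^ 19 * K ^ 52000 * (N ^ 3 * E ^ 5)) ^ 2"
    by (simp add: power_mult_distrib flip: power_mult)
  then have "real p ^ 3 \<le> 2 ^ 19 * K ^ 52000 * (N ^ 3 * E ^ 5)"
    by (rule power2_le_imp_le) (use K0 N0 E1 in auto)
  with u_le show ?thesis by blast
qed

end

section \<open>The choice of parameters\<close>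

theorem proposition1:
  fixes \<epsilon> r :: real
  assumes "\<epsilon> > 0" and "r > 1"
  shows "\<exists>\<delta> C :: real. \<delta> > 0 \<and>
    (\<forall>(p :: nat) (A :: int set) (S :: (int^2^2) set).
       prime p \<longrightarrow> real p > C \<longrightarrow>
       A \<subseteq> carrier (Fp p) \<longrightarrow> S \<subseteq> carrier (SL2 p) \<longrightarrow>
       C < real (card A) \<longrightarrow> real (card A) < real p powr (1 - \<epsilon>) \<longrightarrow>
       ln (real (card A)) < r * ln (real (card S)) \<longrightarrow>
       (\<forall>H g. subgroup H (SL2 p) \<longrightarrow> H \<noteq> carrier (SL2 p) \<longrightarrow> g \<in> carrier (SL2 p) \<longrightarrow>
          real (card (S \<inter> (g <#\<^bsub>SL2 p\<^esub> H))) < real (card S) powr (1 - \<epsilon>)) \<longrightarrow>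
       real (card {(x, y, g). x \<in> A \<and> y \<in> A \<and> g \<in> S \<and> (x, y) \<in> hyperbola p g})
         < real (card A) powr (1 - \<delta>) * real (card S))"
proof -
  \<comment> \<open>\<epsilon> may exceed 1, while numerical estimates such as \<delta>1 a <= a / 10
    below use e <= 1.\<close>
  define e where "e = min \<epsilon> 1"
  \<comment> \<open>The factor \<open>K\<^sup>5\<^sup>2\<^sup>0\<^sup>0\<^sup>0\<close> of \<open>growth_dichotomy\<close>, where \<open>K = |S|\<^sup>\<eta>\<close> and \<open>|S| \<le> |A|\<^sup>4\<close>, has to stay below \<open>|A|\<^sup>e\<close>.\<close>
  define \<eta> where "\<eta> = e / 210000"
  \<comment> \<open>K^J is then at least |S|^(4 r), which exceeds |A|^4 by hypothesis (ii), whereas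
    flattening must stop near |A|^3.\<close>
  define J where "J = nat \<lceil>4 * r / \<eta>\<rceil>"
  \<comment> \<open>E = |A|^\<delta>1, so its fifth power costs |A|^(e / 2); \<delta> is \<delta>1
    divided by the exponent accumulated in J convolutions and one symmetrization.\<close>
  define \<delta>1 where "\<delta>1 = e / 10"
  define \<delta> where "\<delta> = \<delta>1 / 2 ^ Suc J"
  \<comment> \<open>Each term absorbs a numerical constant: 46 r gives 2^23 <= |S|^(1/2), r / \<eta>
    gives K >= 2, 19 / e gives 2^19 <= |A|^e, and 14 takes care of the factors 12 and 128.\<close>
  define M where "M = 46 * r + r / \<eta> + 19 / e + 14"
  have e: "0 < e" "e \<le> 1" "e \<le> \<epsilon>" using assms by (auto simp: e_def)
  have \<eta>: "0 < \<eta>" "\<eta> \<le> 1" using e by (auto simp: \<eta>_def)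
  have \<delta>: "0 < \<delta>" using e by (simp add: \<delta>_def \<delta>1_def)
  have J: "4 * r \<le> \<eta> * real J"
  proof -
    have "4 * r / \<eta> \<le> real J" unfolding J_def by (rule real_nat_ceiling_ge)
    then show ?thesis using \<eta> by (simp add: field_simps)
  qed
  show ?thesis
  proof (rule exI[of _ \<delta>], rule exI[of _ "2 powr M"], intro conjI allI impI \<delta>)
    fix p :: nat and A :: "int set" and U :: "(int^2^2) set"
    assume p: "prime p" "2 powr M < real p" and A: "A \<subseteq> carrier (Fp p)" and U: "U \<subseteq> carrier (SL2 p)"
      and N_large: "2 powr M < real (card A)" and N_small: "real (card A) < real p powr (1 - \<epsilon>)"
      and log: "ln (real (card A)) < r * ln (real (card U))"
      and esc: "\<forall>H g. subgroup H (SL2 p) \<longrightarrow> H \<noteq> carrier (SL2 p) \<longrightarrow> g \<in> carrier (SL2 p) \<longrightarrow>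
          real (card (U \<inter> (g <#\<^bsub>SL2 p\<^esub> H))) < real (card U) powr (1 - \<epsilon>)"
    define N u where "N = real (card A)" and "u = real (card U)"
    have Mpos: "M \<ge> 14" "46 * r \<le> M" "r / \<eta> \<le> M" "19 / e \<le> M"
      using assms e \<eta> by (auto simp: M_def)
    have "2 powr 2 \<le> 2 powr M" using Mpos by (intro powr_mono) auto
    then have p3: "p > 3" using p by simp
    interpret SL2_prime p by unfold_locales (use p p3 in auto)
    have A': "A \<subseteq> {0..<int p}" using A p3 by (simp add: carrier_Fp)
    then have finA: "finite A" using finite_subset by blast
    have finU: "finite U" using U finite_carrier finite_subset by blast
    have "0 < 2 powr M" by simp
    then have N0: "N > 0" using N_large unfolding N_def by (rule less_trans)
    have lnN: "M * ln 2 < ln N"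
    proof -
      have "ln (2 powr M) < ln N" using N_large N0 by (subst ln_less_cancel_iff) (auto simp: N_def)
      then show ?thesis by (simp add: ln_powr)
    qed
    have ln2: "ln 2 > (0::real)" by simp
    have "0 < ln N" using lnN Mpos ln2 by (smt (verit) mult_pos_pos)
    have b_lower: "ln N < r * ln u" using log by (simp add: N_def u_def)
    have b0: "ln u > 0" using b_lower \<open>0 < ln N\<close> assms by (smt (verit) zero_less_mult_iff)
    have u1: "u > 1"
    proof -
      have "u \<noteq> 0"
      proof
        assume "u = 0"
        then show False using b0 by simp
      qed
      moreover have "u \<ge> 0" by (simp add: u_def)
      ultimately have "u > 0" by linarith
      then show ?thesis using b0 by (simp add: ln_gt_zero_iff)
    qed
    have Une: "U \<noteq> {}" using u1 by (auto simp: u_def)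
    define a b where "a = ln N" and "b = ln u"
    have ab: "a < r * b" "a > 0" "b > 0" using b_lower b0 \<open>0 < ln N\<close> by (simp_all add: a_def b_def)
    have Ma: "M * ln 2 < a" using lnN by (simp add: a_def)
    define K where "K = u powr \<eta>"
    define D where "D = N powr \<delta>"
    define E where "E = D ^ (2 ^ Suc J)"
    have pos: "K > 0" "D > 0" "E > 0" "u > 0" using u1 N0 by (auto simp: K_def D_def E_def)
    have lnK: "ln K = \<eta> * b" using u1 by (simp add: K_def b_def ln_powr)
    have lnE: "ln E = \<delta>1 * a"
      using N0 pos by (simp add: E_def D_def ln_realpow ln_powr a_def \<delta>_def)
    have b_M: "46 * ln 2 \<le> b" "ln 2 \<le> \<eta> * b"
    proof -
      have "r * (46 * ln 2) \<le> M * ln 2" using mult_right_mono[OF Mpos(2), of "ln 2"] ln2 by (simp add: mult_ac)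
      then have "r * (46 * ln 2) \<le> r * b" using Ma ab by linarith
      then show "46 * ln 2 \<le> b" using assms by simp
      have "r / \<eta> * ln 2 \<le> M * ln 2" using mult_right_mono[OF Mpos(3), of "ln 2"] ln2 by simp
      then have "r * (ln 2 / \<eta>) \<le> r * b" using Ma ab by simp
      then have "ln 2 / \<eta> \<le> b" by (rule mult_left_le_imp_le) (use assms in simp)
      then show "ln 2 \<le> \<eta> * b" using \<eta> by (simp add: field_simps)
    qed
    have a_M: "14 * ln 2 \<le> a" "19 * ln 2 \<le> e * a"
    proof -
      show "14 * ln 2 \<le> a" using mult_right_mono[OF Mpos(1), of "ln 2"] ln2 Ma by linarith
      have "19 / e * ln 2 \<le> M * ln 2" using mult_right_mono[OF Mpos(4), of "ln 2"] ln2 by simp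
      then have "19 / e * ln 2 \<le> a" using Ma by linarith
      then show "19 * ln 2 \<le> e * a" using e by (simp add: field_simps)
    qed
    have le_lnI: "x \<le> y" if "x > 0" "y > 0" "ln x \<le> ln y" for x y :: real
      using that by simp
    have less_lnI: "x < y" if "x > 0" "y > 0" "ln x < ln y" for x y :: real
      using that by simp
    have \<delta>1a: "\<delta>1 * a \<le> a / 10" using e ab by (simp add: \<delta>1_def)
    have K2: "K \<ge> 2" by (rule le_lnI) (use pos lnK b_M in auto)
    have D1: "D \<ge> 1" using \<delta> N0 \<open>0 < ln N\<close> by (auto simp: D_def intro!: ge_one_powr_ge_zero)
    have lnNE: "ln (N ^ 3 * E ^ 5) = 3 * a + 5 * (\<delta>1 * a)"
      using N0 pos by (simp add: ln_mult ln_realpow lnE a_def)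
    have ln128: "ln (128::real) = 7 * ln 2" using ln_realpow[of 2 7] by simp
    have ln12: "ln (12::real) \<le> 4 * ln 2"
    proof -
      have "ln (12::real) \<le> ln (2 ^ 4)" by (subst ln_le_cancel_iff) auto
      then show ?thesis by (simp only: ln_realpow)
    qed
    show "real (card {(x, y, g). x \<in> A \<and> y \<in> A \<and> g \<in> U \<and> (x, y) \<in> hyperbola p g})
         < real (card A) powr (1 - \<delta>) * real (card U)"
    proof (rule ccontr)
      assume "\<not> ?thesis"
      then have "N powr (1 - \<delta>) * u \<le> real (card {(x, y, g). x \<in> A \<and> y \<in> A \<and> g \<in> U \<and> (x, y) \<in> hyperbola p g})"
        by (simp add: N_def u_def)
      also have "card {(x, y, g). x \<in> A \<and> y \<in> A \<and> g \<in> U \<and> (x, y) \<in> hyperbola p g} = (\<Sum>g\<in>U. hits A g)"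
      proof -
        have "card {(x, y, g). x \<in> A \<and> y \<in> A \<and> g \<in> U \<and> (x, y) \<in> hyperbola p g} =
            card (SIGMA g:U. {(x, y) \<in> A \<times> A. maps g (pt x) (pt y)})"
        proof (rule bij_betw_same_card[of "\<lambda>(x, y, g). (g, x, y)"],
            rule bij_betw_byWitness[where f' = "\<lambda>(g, x, y). (x, y, g)"])
          have *: "(x, y) \<in> hyperbola p g \<longleftrightarrow> maps g (pt x) (pt y)" if "x \<in> A" "y \<in> A" for x y g
            using hyperbola_iff subsetD[OF A'] that by blast
          show "(\<lambda>(x, y, g). (g, x, y)) ` {(x, y, g). x \<in> A \<and> y \<in> A \<and> g \<in> U \<and> (x, y) \<in> hyperbola p g}
              \<subseteq> (SIGMA g:U. {(x, y) \<in> A \<times> A. maps g (pt x) (pt y)})" using * by auto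
          show "(\<lambda>(g, x, y). (x, y, g)) ` (SIGMA g:U. {(x, y) \<in> A \<times> A. maps g (pt x) (pt y)})
              \<subseteq> {(x, y, g). x \<in> A \<and> y \<in> A \<and> g \<in> U \<and> (x, y) \<in> hyperbola p g}" using * by auto
        qed auto
        also have "\<dots> = (\<Sum>g\<in>U. hits A g)"
          unfolding hits_def using finU finA
          by (intro card_SigmaI ballI) (auto intro: finite_subset[of _ "A \<times> A"])
        finally show ?thesis .
      qed
      finally have rich: "u * N / D \<le> (\<Sum>g\<in>U. real (hits A g))"
        using N0 by (simp add: D_def powr_diff mult.commute)
      have cN: "12 * E \<le> N"
      proof (rule le_lnI)
        have "ln (12 * E) = ln 12 + \<delta>1 * a" using pos by (simp add: ln_mult lnE)
        also have "\<dots> \<le> a" using ln12 \<delta>1a a_M(1) ln2 by linarith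
        finally show "ln (12 * E) \<le> ln N" by (simp add: a_def)
      qed (use pos N0 in auto)
      have long: "128 * N ^ 3 * E ^ 5 < u * K ^ J"
      proof (rule less_lnI)
        have "ln (128 * N ^ 3 * E ^ 5) = 7 * ln 2 + (3 * a + 5 * (\<delta>1 * a))"
          using pos N0 lnNE by (simp add: ln_mult ln128 mult.assoc del: ln_mult_pos)
        also have "\<dots> \<le> 4 * a" using \<delta>1a a_M(1) by linarith
        also have "\<dots> < 4 * r * b" using ab by simp
        also have "\<dots> \<le> \<eta> * real J * b" using J ab by (intro mult_right_mono) auto
        also have "\<dots> < b + real J * (\<eta> * b)" using ab by (simp add: mult_ac)
        also have "\<dots> = ln (u * K ^ J)" using pos lnK by (simp add: ln_mult ln_realpow b_def)
        finally show "ln (128 * N ^ 3 * E ^ 5) < ln (u * K ^ J)" .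
      qed (use pos N0 in auto)
      have ub: "2 ^ 23 * K ^ 40500 \<le> u"
      proof (rule le_lnI)
        have "ln (2 ^ 23 * K ^ 40500) = 23 * ln 2 + 40500 * (\<eta> * b)"
          using pos lnK ln_realpow[of 2 23] by (simp add: ln_mult ln_realpow)
        also have "40500 * (\<eta> * b) \<le> b / 2"
          using mult_right_mono[OF e(2), of b] ab by (simp add: \<eta>_def)
        also have "23 * ln 2 + b / 2 \<le> b" using b_M(1) by linarith
        finally show "ln (2 ^ 23 * K ^ 40500) \<le> ln u" by (simp add: b_def)
      qed (use pos in auto)
      \<comment> \<open>500 \<eta> is less than \<epsilon>, so hypothesis (iii) survives the factor
        K^500.\<close>
      have escape: "K ^ 500 * real (card {s \<in> U. inv\<^bsub>SL2 p\<^esub> x \<otimes>\<^bsub>SL2 p\<^esub> s \<in> L}) < real (card U)"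
        if L: "subgroup L (SL2 p)" "L \<noteq> carrier (SL2 p)" and x: "x \<in> carrier (SL2 p)" for L x
      proof -
        have "{s \<in> U. inv\<^bsub>SL2 p\<^esub> x \<otimes>\<^bsub>SL2 p\<^esub> s \<in> L} \<subseteq> U \<inter> (x <#\<^bsub>SL2 p\<^esub> L)"
        proof
          fix s assume s: "s \<in> {s \<in> U. inv\<^bsub>SL2 p\<^esub> x \<otimes>\<^bsub>SL2 p\<^esub> s \<in> L}"
          then have "s = x \<otimes>\<^bsub>SL2 p\<^esub> (inv\<^bsub>SL2 p\<^esub> x \<otimes>\<^bsub>SL2 p\<^esub> s)"
            using x U by (auto simp: SL.m_assoc[symmetric])
          then show "s \<in> U \<inter> (x <#\<^bsub>SL2 p\<^esub> L)" using s by (auto simp: l_coset_def)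
        qed
        then have "card {s \<in> U. inv\<^bsub>SL2 p\<^esub> x \<otimes>\<^bsub>SL2 p\<^esub> s \<in> L} \<le> card (U \<inter> (x <#\<^bsub>SL2 p\<^esub> L))"
          using finU by (intro card_mono) auto
        then have "real (card {s \<in> U. inv\<^bsub>SL2 p\<^esub> x \<otimes>\<^bsub>SL2 p\<^esub> s \<in> L}) \<le> real (card (U \<inter> (x <#\<^bsub>SL2 p\<^esub> L)))"
          by (rule of_nat_mono)
        also have "\<dots> < u powr (1 - \<epsilon>)" using esc L x by (simp add: u_def)
        finally have "K ^ 500 * real (card {s \<in> U. inv\<^bsub>SL2 p\<^esub> x \<otimes>\<^bsub>SL2 p\<^esub> s \<in> L}) < K ^ 500 * u powr (1 - \<epsilon>)"
          using pos by simp
        also have "K ^ 500 * u powr (1 - \<epsilon>) = u powr (500 * \<eta> + (1 - \<epsilon>))"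
          using u1 by (simp add: K_def powr_power powr_add mult.commute)
        also have "\<dots> \<le> u powr 1" using u1 e by (intro powr_mono) (auto simp: \<eta>_def)
        finally show ?thesis using u1 by (simp add: u_def)
      qed
      have main: "u \<le> 128 * N ^ 3 * E ^ 5 \<and> real p ^ 3 \<le> 2 ^ 19 * K ^ 52000 * (N ^ 3 * E ^ 5)"
        unfolding N_def u_def E_def
        by (rule growth_dichotomy[OF finA A' U Une K2 D1])
          (use rich cN long ub escape in \<open>simp_all add: N_def u_def E_def\<close>)
      \<comment> \<open>The first half of the dichotomy bounds |S| by |A|^4, which is what makes
        powers of K comparable to powers of |A|.\<close>
      have b_upper: "b \<le> 4 * a"
      proof -
        have "b \<le> ln (128 * N ^ 3 * E ^ 5)" unfolding b_def using main pos N0 by simp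
        also have "\<dots> = 7 * ln 2 + (3 * a + 5 * (\<delta>1 * a))"
          using pos N0 lnNE by (simp add: ln_mult ln128 mult.assoc del: ln_mult_pos)
        also have "\<dots> \<le> 4 * a" using \<delta>1a a_M(1) by linarith
        finally show ?thesis .
      qed
      \<comment> \<open>From |A| < p^(1 - e), since (1 + e)(1 - e) is at most 1.\<close>
      have p_lower: "(1 + e) * a < ln (real p)"
      proof -
        have "ln N < ln (real p powr (1 - \<epsilon>))"
          using N_small N0 p3 by (subst ln_less_cancel_iff) (auto simp: N_def)
        then have 1: "a < (1 - \<epsilon>) * ln (real p)" using p3 by (simp add: ln_powr a_def)
        have lp: "ln (real p) > 0" using p3 by simp
        have "(1 - \<epsilon>) * ln (real p) \<le> (1 - e) * ln (real p)" using e lp by (intro mult_right_mono) auto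
        with 1 have "(1 + e) * a < (1 + e) * ((1 - e) * ln (real p))" using e by (intro mult_strict_left_mono) auto
        also have "\<dots> = (1 - e\<^sup>2) * ln (real p)" by (simp add: power2_eq_square algebra_simps)
        also have "\<dots> \<le> 1 * ln (real p)" using lp by (intro mult_right_mono) auto
        finally show ?thesis by simp
      qed
      have "3 * ln (real p) = ln (real p ^ 3)" using p3 by (simp add: ln_realpow)
      also have "\<dots> \<le> ln (2 ^ 19 * K ^ 52000 * (N ^ 3 * E ^ 5))"
        using main pos N0 p3 by (subst ln_le_cancel_iff) auto
      also have "\<dots> = ln (2 ^ 19 * K ^ 52000) + ln (N ^ 3 * E ^ 5)"
        using pos N0 by (intro ln_mult_pos) auto
      also have "\<dots> = 19 * ln 2 + 52000 * (\<eta> * b) + (3 * a + 5 * (\<delta>1 * a))"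
        unfolding lnNE using pos lnK ln_realpow[of 2 19] by (simp add: ln_mult ln_realpow)
      also have "52000 * (\<eta> * b) \<le> e * a"
      proof -
        have "\<eta> * b \<le> \<eta> * (4 * a)" using b_upper \<eta> by (intro mult_left_mono) auto
        moreover have "\<eta> * (4 * a) = 4 / 210000 * (e * a)" by (simp add: \<eta>_def)
        ultimately show ?thesis using mult_pos_pos[OF e(1) ab(2)] by linarith
      qed
      also have "5 * (\<delta>1 * a) = e * a / 2" by (simp add: \<delta>1_def)
      \<comment> \<open>The excess over 3 a is at most e a for 2^19, e a for K^52000 and e a / 2 for
        E^5, less than the 3 e a that \<open>p_lower\<close> demands.\<close>
      finally have "3 * ln (real p) \<le> 3 * a + 5 / 2 * (e * a)" using a_M(2) by linarith
      moreover have "3 * ((1 + e) * a) = 3 * a + 3 * (e * a)" by (simp add: algebra_simps)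
      moreover have "e * a > 0" using e ab by simp
      ultimately show False using p_lower by linarith
    qed
  qed
qed

end
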